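(* Let $\mathcal{R}$ be a real closed field and $\mathcal{C}=\mathcal{R}(i)$ its algebraic closure. Let $X\subset \mathbb{P}^d$, $d\ge 2$, be a rational normal curve defined over $\mathcal{R}$. Then there is a non-empty open subset $\mathcal{U}\subset \mathbb{P}^d(\mathcal{R})$ such that $\mathbb{P}^d(\mathcal{R})\setminus \mathcal{U}$ has euclidean dimension $<d$ and each $q\in\mathcal{U}$ has admissible rank $\lceil (d+1)/2\rceil$ with respect to $X$.
   Context: Let $\sigma:\mathcal{C}\to\mathcal{C}$ be the field automorphism with $\sigma(x)=x$ for all $x\in\mathcal{R}$ and $\sigma(i)=-i$. It acts on $\mathbb{P}^d(\mathcal{C})$ and on $X(\mathcal{C})$, with fixed point sets $\mathbb{P}^d(\mathcal{R})$ and $X(\mathcal{R})$ respectively. The admissible rank of a point $P\in\mathbb{P}^d(\mathcal{R})$ with respect to $X$ is the minimal cardinality of a set $S\subset X(\mathcal{C})$ such that $P\in\langle S\rangle$ (linear span over $\mathcal{C}$ in $\mathbb{P}^d(\mathcal{C})$) and $\sigma(S)=S$. A rational normal curve in $\mathbb{P}^d$ is a smooth rational curve of degree $d$ (over $\mathcal{C}$) spanning $\mathbb{P}^d$. The euclidean topology on $\mathbb{P}^d(\mathcal{R})$ is the one coming from the ordering of $\mathcal{R}$ (open balls form a basis in affine charts), and euclidean dimension refers to dimension in the sense of real (semialgebraic) geometry over $\mathcal{R}$.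
   Formalization: If 4 divides d, X is additionally assumed to have a point in X(R); otherwise the claim fails, since σ-stable finite subsets of X(C) then have even cardinality while ⌈(d+1)/2⌉ = d/2+1 is odd (e.g. a pointless conic embedded as a quartic in P^4). *)

theory Defs
  imports "HOL-Analysis.Analysis" "HOL-Library.Poly_Mapping" "HOL-Library.Extended_Nat"
begin

section \<open>Real closed fields and the quadratic extension by a square root of -1\<close>

text \<open>Polynomials are written as sums over a coefficient function, as in the library class
  \<^class>\<open>alg_closed_field\<close>.\<close>

class real_closed_field = linordered_field +
  assumes nonneg_is_square: "0 \<le> a \<Longrightarrow> \<exists>b. b ^ 2 = a"
    and odd_degree_has_root: "odd n \<Longrightarrow> f n \<noteq> 0 \<Longrightarrow> \<exists>x. (\<Sum>k\<le>n. f k * x ^ k) = 0"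

text \<open>The element \<open>Cplx a b\<close> is \<open>a + b i\<close>.\<close>

datatype 'a cplx = Cplx (cre: 'a) (cim: 'a)

lemma cplx_eq_iff: "z = w \<longleftrightarrow> cre z = cre w \<and> cim z = cim w"
  by (cases z; cases w) simp

instantiation cplx :: (linordered_field) field
begin

definition "0 = Cplx 0 0"
definition "1 = Cplx 1 0"
definition "z + w = Cplx (cre z + cre w) (cim z + cim w)"
definition "- z = Cplx (- cre z) (- cim z)"
definition "z - w = Cplx (cre z - cre w) (cim z - cim w)"
definition "z * w = Cplx (cre z * cre w - cim z * cim w) (cre z * cim w + cim z * cre w)"
definition "inverse z = Cplx (cre z / (cre z ^ 2 + cim z ^ 2)) (- cim z / (cre z ^ 2 + cim z ^ 2))"
definition "z div w = z * inverse (w :: 'a cplx)"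

instance
proof
  fix z :: "'a cplx"
  assume "z \<noteq> 0"
  then have "cre z ^ 2 + cim z ^ 2 \<noteq> 0"
    by (simp add: cplx_eq_iff zero_cplx_def sum_power2_eq_zero_iff)
  then show "inverse z * z = 1"
    by (simp add: cplx_eq_iff inverse_cplx_def times_cplx_def one_cplx_def power2_eq_square
        add_divide_distrib [symmetric])
qed (simp_all add: cplx_eq_iff zero_cplx_def one_cplx_def plus_cplx_def uminus_cplx_def
    minus_cplx_def times_cplx_def inverse_cplx_def divide_cplx_def algebra_simps)

end

definition of_base :: "'a::zero \<Rightarrow> 'a cplx"
  where "of_base a = Cplx a 0"

definition cplx_conj :: "'a::uminus cplx \<Rightarrow> 'a cplx"
  where "cplx_conj z = Cplx (cre z) (- cim z)"


section \<open>Projective space\<close>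

text \<open>The points of \<open>('k, 'n) proj\<close> are the lines through the origin of \<open>'k ^ 'n\<close>, so this is
  projective space of dimension \<open>CARD('n) - 1\<close> over \<open>'k\<close>.\<close>

typedef (overloaded) ('k::field, 'n::finite) proj =
  "{L :: ('k ^ 'n) set. vec.subspace L \<and> vec.dim L = 1}"
  morphisms line Abs_proj
proof
  show "vec.span {axis undefined 1 :: 'k ^ 'n} \<in> {L. vec.subspace L \<and> vec.dim L = 1}"
    by (simp add: vec.subspace_span axis_eq_0_iff)
qed

definition point :: "('k::field) ^ 'n \<Rightarrow> ('k, 'n::finite) proj"
  where "point x = Abs_proj (vec.span {x})"

definition linear_span :: "('k::field, 'n::finite) proj set \<Rightarrow> ('k, 'n) proj set"
  where "linear_span S = {P. line P \<subseteq> vec.span (\<Union>Q\<in>S. line Q)}"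

definition conj_proj :: "('r::linordered_field cplx, 'n::finite) proj \<Rightarrow> ('r cplx, 'n) proj"
  where "conj_proj P = Abs_proj ((\<lambda>x. \<chi> i. cplx_conj (x $ i)) ` line P)"

text \<open>The inclusion of the projective space over the base field into the one over its
  quadratic extension.\<close>

definition complexify :: "('r::linordered_field, 'n::finite) proj \<Rightarrow> ('r cplx, 'n) proj"
  where "complexify P = Abs_proj (vec.span ((\<lambda>x. \<chi> i. of_base (x $ i)) ` line P))"


text \<open>The following lemmas confirm that the uses of \<open>Abs_proj\<close> above are well-defined.\<close>

lemma line_point: "x \<noteq> 0 \<Longrightarrow> line (point x) = vec.span {x}"
  unfolding point_def by (subst Abs_proj_inverse) (simp_all add: vec.subspace_span)

lemma point_cases:
  obtains x where "x \<noteq> 0" "P = point x"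
proof -
  have P: "vec.subspace (line P)" "vec.dim (line P) = 1"
    using line [of P] by auto
  obtain B where B: "B \<subseteq> line P" "vec.independent B" "line P \<subseteq> vec.span B" "card B = vec.dim (line P)"
    using vec.basis_exists by blast
  then obtain x where x: "B = {x}"
    using P by (metis card_1_singletonE)
  then have "x \<noteq> 0" "line P = vec.span {x}"
    using B P by (auto simp: vec.dependent_single intro: vec.span_minimal [THEN subsetD])
  then show thesis
    using that by (metis line_inverse point_def)
qed

lemma conj_proj_point:
  fixes x :: "'r::linordered_field cplx ^ 'n::finite"
  assumes "x \<noteq> 0"
  shows "conj_proj (point x) = point (\<chi> i. cplx_conj (x $ i))"
proof -
  have mult: "cplx_conj (a * b) = cplx_conj a * cplx_conj b" and inv: "cplx_conj (cplx_conj a) = a"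
    for a b :: "'r cplx"
    by (simp_all add: cplx_conj_def times_cplx_def)
  have "(\<lambda>x. \<chi> i. cplx_conj (x $ i)) ` vec.span {x} = vec.span {\<chi> i. cplx_conj (x $ i)}"
  proof (intro equalityI subsetI)
    fix y assume "y \<in> vec.span {\<chi> i. cplx_conj (x $ i)}"
    then obtain c where "y = c *s (\<chi> i. cplx_conj (x $ i))"
      by (auto simp: vec.span_singleton)
    then have "y = (\<chi> i. cplx_conj ((cplx_conj c *s x) $ i))"
      by (simp add: vec_eq_iff mult inv)
    then show "y \<in> (\<lambda>x. \<chi> i. cplx_conj (x $ i)) ` vec.span {x}"
      unfolding vec.span_singleton by (intro image_eqI [where x = "cplx_conj c *s x"]) auto
  qed (auto simp: vec.span_singleton vec_eq_iff mult)
  then show ?thesis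
    using assms by (simp add: conj_proj_def line_point) (simp add: point_def)
qed

lemma complexify_point:
  fixes x :: "'r::linordered_field ^ 'n::finite"
  assumes "x \<noteq> 0"
  shows "complexify (point x) = point (\<chi> i. of_base (x $ i))"
proof -
  let ?e = "\<lambda>x :: 'r ^ 'n. \<chi> i. of_base (x $ i)"
  have "?e ` vec.span {x} \<subseteq> vec.span {?e x}"
  proof
    fix y assume "y \<in> ?e ` vec.span {x}"
    then obtain c where "y = ?e (c *s x)"
      by (auto simp: vec.span_singleton)
    then have "y = of_base c *s ?e x"
      by (simp add: vec_eq_iff of_base_def times_cplx_def)
    then show "y \<in> vec.span {?e x}"
      by (auto simp: vec.span_singleton)
  qed
  then have "vec.span (?e ` vec.span {x}) = vec.span {?e x}"
    by (intro equalityI vec.span_minimal vec.span_mono vec.subspace_span) (auto intro: vec.span_base)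
  then show ?thesis
    using assms by (simp add: complexify_def line_point) (simp add: point_def)
qed


section \<open>Polynomials and the Zariski topology\<close>

type_synonym ('k, 'n) mpoly = "('n \<Rightarrow>\<^sub>0 nat) \<Rightarrow>\<^sub>0 'k"

definition peval :: "('k::field, 'n::finite) mpoly \<Rightarrow> 'k ^ 'n \<Rightarrow> 'k"
  where "peval F x =
    (\<Sum>m\<in>Poly_Mapping.keys F. Poly_Mapping.lookup F m * (\<Prod>j\<in>UNIV. x $ j ^ Poly_Mapping.lookup m j))"

text \<open>The partial derivative of \<open>F\<close> in the variable \<open>i\<close>, evaluated at \<open>x\<close>.\<close>

definition pderiv_eval :: "'n \<Rightarrow> ('k::field, 'n::finite) mpoly \<Rightarrow> 'k ^ 'n \<Rightarrow> 'k"
  where "pderiv_eval i F x =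
    (\<Sum>m\<in>Poly_Mapping.keys F. Poly_Mapping.lookup F m * of_nat (Poly_Mapping.lookup m i) *
      (\<Prod>j\<in>UNIV. x $ j ^ (if j = i then Poly_Mapping.lookup m j - 1 else Poly_Mapping.lookup m j)))"

definition homogeneous :: "nat \<Rightarrow> ('k::field, 'n::finite) mpoly \<Rightarrow> bool"
  where "homogeneous k F \<longleftrightarrow> (\<forall>m\<in>Poly_Mapping.keys F. (\<Sum>j\<in>UNIV. Poly_Mapping.lookup m j) = k)"

definition vanishes_at :: "('k::field, 'n::finite) mpoly \<Rightarrow> ('k, 'n) proj \<Rightarrow> bool"
  where "vanishes_at F P \<longleftrightarrow> (\<forall>x\<in>line P. peval F x = 0)"

definition forms :: "('k::field, 'n::finite) mpoly set"
  where "forms = {F. \<exists>k. homogeneous k F}"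

definition zariski_closed :: "('k::field, 'n::finite) proj set \<Rightarrow> bool"
  where "zariski_closed X \<longleftrightarrow> (\<exists>I \<subseteq> forms. X = {P. \<forall>F\<in>I. vanishes_at F P})"

definition zariski_closure :: "('k::field, 'n::finite) proj set \<Rightarrow> ('k, 'n) proj set"
  where "zariski_closure A = \<Inter>{Z. zariski_closed Z \<and> A \<subseteq> Z}"

definition defined_over_base :: "('r::linordered_field cplx, 'n::finite) proj set \<Rightarrow> bool"
  where "defined_over_base X \<longleftrightarrow>
    (\<exists>I \<subseteq> forms. X = {P. \<forall>F\<in>I. vanishes_at (Poly_Mapping.map of_base F) P})"

definition irreducible_closed :: "('k::field, 'n::finite) proj set \<Rightarrow> bool"
  where "irreducible_closed X \<longleftrightarrow> zariski_closed X \<and> X \<noteq> {} \<and>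
    (\<forall>A B. zariski_closed A \<longrightarrow> zariski_closed B \<longrightarrow> X = A \<union> B \<longrightarrow> X = A \<or> X = B)"

text \<open>Krull dimension of a Zariski closed set: the supremum of the lengths of the strict chains of
  irreducible closed subsets. The empty set gets the value 0.\<close>

definition krull_dim :: "('k::field, 'n::finite) proj set \<Rightarrow> enat"
  where "krull_dim X = Sup {enat n | n. \<exists>Z :: nat \<Rightarrow> ('k, 'n) proj set.
    (\<forall>j\<le>n. irreducible_closed (Z j) \<and> Z j \<subseteq> X) \<and> (\<forall>j<n. Z j \<subset> Z (Suc j))}"


section \<open>Rational normal curves\<close>

text \<open>The linear subspace of \<open>'k ^ 'n\<close> lying over the projective tangent space at \<open>P\<close>; its
  dimension is one more than that of the tangent space.\<close>

definition tangent_cone :: "('k::field, 'n::finite) proj set \<Rightarrow> ('k, 'n) proj \<Rightarrow> ('k ^ 'n) set"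
  where "tangent_cone X P = {v. \<forall>F\<in>forms. (\<forall>Q\<in>X. vanishes_at F Q) \<longrightarrow>
    (\<forall>x\<in>line P - {0}. (\<Sum>i\<in>UNIV. pderiv_eval i F x * v $ i) = 0)}"

text \<open>The Jacobian criterion, for irreducible closed \<open>X\<close>.\<close>

definition smooth :: "('k::field, 'n::finite) proj set \<Rightarrow> bool"
  where "smooth X \<longleftrightarrow> (\<forall>P\<in>X. enat (vec.dim (tangent_cone X P)) = krull_dim X + 1)"

text \<open>A rational map is given by a family of forms \<open>\<phi>\<close> of a common degree; it is defined at
  the points where they do not all vanish.\<close>

definition rat_defined :: "('m \<Rightarrow> ('k::field, 'n::finite) mpoly) \<Rightarrow> ('k, 'n) proj \<Rightarrow> bool"
  where "rat_defined \<phi> P \<longleftrightarrow> (\<exists>j. \<not> vanishes_at (\<phi> j) P)"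

definition rat_apply ::
    "('m \<Rightarrow> ('k::field, 'n::finite) mpoly) \<Rightarrow> ('k, 'n) proj \<Rightarrow> ('k, 'm::finite) proj"
  where "rat_apply \<phi> P = Abs_proj (vec.span ((\<lambda>x. \<chi> j. peval (\<phi> j) x) ` line P))"

text \<open>Birational equivalence of irreducible closed sets: non-empty open subsets \<open>X - Z\<close> and
  \<open>Y - W\<close> are identified by mutually inverse rational maps.\<close>

definition birational :: "('k::field, 'n::finite) proj set \<Rightarrow> ('k, 'm::finite) proj set \<Rightarrow> bool"
  where "birational X Y \<longleftrightarrow>
    (\<exists>(\<phi> :: 'm \<Rightarrow> ('k, 'n) mpoly) (\<psi> :: 'n \<Rightarrow> ('k, 'm) mpoly) k l Z W.
      (\<forall>j. homogeneous k (\<phi> j)) \<and> (\<forall>i. homogeneous l (\<psi> i)) \<and>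
      zariski_closed Z \<and> \<not> X \<subseteq> Z \<and> zariski_closed W \<and> \<not> Y \<subseteq> W \<and>
      (\<forall>P\<in>X - Z. rat_defined \<phi> P \<and> rat_apply \<phi> P \<in> Y - W \<and> rat_apply \<psi> (rat_apply \<phi> P) = P) \<and>
      (\<forall>Q\<in>Y - W. rat_defined \<psi> Q \<and> rat_apply \<psi> Q \<in> X - Z \<and> rat_apply \<phi> (rat_apply \<psi> Q) = Q))"

definition rational_curve :: "('k::field, 'n::finite) proj set \<Rightarrow> bool"
  where "rational_curve X \<longleftrightarrow> irreducible_closed X \<and> krull_dim X = 1 \<and>
    birational (UNIV :: ('k, 2) proj set) X"

definition hyperplane :: "('k::field, 'n::finite) proj \<Rightarrow> ('k, 'n) proj set"
  where "hyperplane H = {P. \<forall>a\<in>line H. \<forall>x\<in>line P. (\<Sum>i\<in>UNIV. a $ i * x $ i) = 0}"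

text \<open>The degree of a curve is the number of points in which it meets a general hyperplane. The
  exceptional hyperplanes form a proper closed subset \<open>B\<close> of the dual projective space.\<close>

definition curve_degree :: "('k::field, 'n::finite) proj set \<Rightarrow> nat \<Rightarrow> bool"
  where "curve_degree X e \<longleftrightarrow>
    (\<exists>B :: ('k, 'n) proj set. zariski_closed B \<and> B \<noteq> UNIV \<and>
      (\<forall>H. H \<notin> B \<longrightarrow> finite (X \<inter> hyperplane H) \<and> card (X \<inter> hyperplane H) = e))"

definition rational_normal_curve :: "nat \<Rightarrow> ('k::field, 'n::finite) proj set \<Rightarrow> bool"
  where "rational_normal_curve d X \<longleftrightarrow>
    CARD('n) = d + 1 \<and> rational_curve X \<and> smooth X \<and> curve_degree X d \<and> linear_span X = UNIV"


section \<open>Admissible rank\<close>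

definition admissible_rank ::
    "('r::linordered_field cplx, 'n::finite) proj set \<Rightarrow> ('r, 'n) proj \<Rightarrow> enat"
  where "admissible_rank X P =
    Inf {enat (card S) | S. finite S \<and> S \<subseteq> X \<and> conj_proj ` S = S \<and> complexify P \<in> linear_span S}"


section \<open>Euclidean topology and dimension over an ordered field\<close>

text \<open>The affine chart \<open>i\<close> consists of the points with a representative \<open>x\<close> with \<open>x $ i = 1\<close>.\<close>

definition euclidean_open :: "('r::linordered_field, 'n::finite) proj set \<Rightarrow> bool"
  where "euclidean_open U \<longleftrightarrow>
    (\<forall>i x. x $ i = 1 \<longrightarrow> point x \<in> U \<longrightarrow>
      (\<exists>\<epsilon>>0. \<forall>y. y $ i = 1 \<longrightarrow> (\<Sum>j\<in>UNIV. (y $ j - x $ j) ^ 2) < \<epsilon> ^ 2 \<longrightarrow> point y \<in> U))"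

text \<open>The sign of a form of even degree is constant on a line minus the origin.\<close>

inductive semialgebraic :: "('r::linordered_field, 'n::finite) proj set \<Rightarrow> bool"
  where
    zero: "homogeneous k F \<Longrightarrow> semialgebraic {P. vanishes_at F P}"
  | pos: "homogeneous (2 * k) F \<Longrightarrow> semialgebraic {P. \<forall>x\<in>line P - {0}. 0 < peval F x}"
  | compl: "semialgebraic A \<Longrightarrow> semialgebraic (- A)"
  | un: "semialgebraic A \<Longrightarrow> semialgebraic B \<Longrightarrow> semialgebraic (A \<union> B)"

text \<open>The dimension of a semialgebraic set is, by definition, that of its Zariski closure
  (Bochnak, Coste and Roy, Real Algebraic Geometry, Section 2.8).\<close>

definition semialgebraic_dim :: "('r::linordered_field, 'n::finite) proj set \<Rightarrow> enat"
  where "semialgebraic_dim A = krull_dim (zariski_closure A)"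

end

theory Submission
  imports "HOL-Algebra.Algebraic_Closure_Type" "HOL-Library.Function_Algebras"
    "Subresultants.Subresultant_Gcd" Defs
begin

text \<open>A rational normal curve is, in suitable coordinates, the image of the Veronese map of degree \<open>d\<close>:
  a parametrization without base points by forms of degree \<open>e\<close> meets a general hyperplane in \<open>e\<close>
  points, so \<open>e \<le> d\<close>, and it spans the space, so \<open>e \<ge> d\<close>. A point \<open>z\<close> is then a linear functional on the
  binary forms of degree \<open>d\<close>, and \<open>z\<close> lies in the span of the \<open>e\<close> points of the curve given by the zeros
  of a squarefree form \<open>f\<close> of degree \<open>e\<close> if and only if \<open>z\<close> annihilates all multiples of \<open>f\<close>, that is, if
  \<open>f\<close> is apolar to \<open>z\<close>.

  Let \<open>e = d div 2 + 1\<close>. If the \<open>e \<times> e\<close> Hankel matrix of \<open>z\<close> is regular, then no non-zero form of degree less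
  than \<open>e\<close> is apolar to \<open>z\<close>, so the rank is at least \<open>e\<close>, and generically there is a squarefree apolar form
  of degree \<open>e\<close>. Conjugation lifts to a semilinear map of the plane whose square is a real scalar \<open>c\<close>, and
  acts on the apolar forms of a real point with square \<open>c ^ e\<close>. The scalar is positive if \<open>d\<close> is odd or
  if the curve has a real point, and \<open>e\<close> is even if \<open>d \<equiv> 2\<close> modulo 4. Hence \<open>c ^ e > 0\<close> in all cases,
  conjugation is a real structure on the apolar forms, and a general real apolar form is squarefree.
  The exceptional points lie on a hypersurface.\<close>

text \<open>The Veronese coordinates of the curve cannot be chosen real in general, since the curve
  may have no real point; conjugation is therefore carried along as an antilinear action on forms.
  Cramer's rule gives an apolar form whose coefficients are polynomial in z, but this form does not
  respect conjugation: for even d and general z the apolar forms of degree e are a two-dimensional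
  space, and the rule selects one of them by a choice of coordinates. It serves to decide genericity
  over the algebraic closure. Its discriminant is a form in z, not zero by one example, and its
  leading coefficient is the Hankel determinant, so a single hypersurface takes care of both
  conditions. Conjugation enters afterwards, for a fixed real z: the fixed vectors of a real
  structure are Zariski dense, so one of them has non-zero discriminant. A negative c ^ e would
  instead give a quaternionic structure, which has no eigenvectors. General elements are found on
  lines, where a non-zero polynomial has finitely many roots; this works over every infinite
  field.\<close>

no_notation vec_index (infixl "$" 100)
no_notation fps_nth (infixl "$" 75)
no_notation Polynomials.var (\<open>X\<index>\<close>)

section \<open>The quadratic extension of a real closed field\<close>

lemma cplx_simps [simp]:
  "cre 0 = 0" "cim 0 = 0" "cre 1 = 1" "cim 1 = 0"
  "cre (z + w) = cre z + cre w" "cim (z + w) = cim z + cim w"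
  "cre (z - w) = cre z - cre w" "cim (z - w) = cim z - cim w"
  "cre (- z) = - cre z" "cim (- z) = - cim z"
  "cre (z * w) = cre z * cre w - cim z * cim w"
  "cim (z * w) = cre z * cim w + cim z * cre w"
  for z w :: "'r::linordered_field cplx"
  by (simp_all add: zero_cplx_def one_cplx_def plus_cplx_def minus_cplx_def uminus_cplx_def
      times_cplx_def)

lemma cplx_conj_sel [simp]:
  "cre (cplx_conj z) = cre z" "cim (cplx_conj z) = - cim z"
  by (simp_all add: cplx_conj_def)

lemma of_base_sel [simp]: "cre (of_base a) = a" "cim (of_base a) = 0"
  by (simp_all add: of_base_def)

lemma cplx_conj_conj [simp]: "cplx_conj (cplx_conj z) = (z :: 'r::linordered_field cplx)"
  and cplx_conj_0 [simp]: "cplx_conj 0 = (0 :: 'r cplx)"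
  and cplx_conj_1 [simp]: "cplx_conj 1 = (1 :: 'r cplx)"
  and cplx_conj_add [simp]: "cplx_conj (z + w) = cplx_conj z + (cplx_conj w :: 'r cplx)"
  and cplx_conj_minus [simp]: "cplx_conj (- z) = - (cplx_conj z :: 'r cplx)"
  and cplx_conj_mult [simp]: "cplx_conj (z * w) = cplx_conj z * (cplx_conj w :: 'r cplx)"
  and cplx_conj_of_base [simp]: "cplx_conj (of_base a) = (of_base a :: 'r cplx)"
  by (auto simp: cplx_eq_iff)

lemma cplx_conj_eq_0_iff [simp]: "cplx_conj z = 0 \<longleftrightarrow> z = (0 :: 'r::linordered_field cplx)"
  by (auto simp: cplx_eq_iff)

lemma cplx_conj_power [simp]: "cplx_conj (z ^ n) = cplx_conj z ^ n" for z :: "'r::linordered_field cplx"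
  by (induction n) auto

lemma cplx_conj_sum: "cplx_conj (\<Sum>i\<in>A. f i) = (\<Sum>i\<in>A. cplx_conj (f i :: 'r::linordered_field cplx))"
  by (induction A rule: infinite_finite_induct) auto

lemma cplx_conj_prod: "cplx_conj (\<Prod>i\<in>A. f i) = (\<Prod>i\<in>A. cplx_conj (f i :: 'r::linordered_field cplx))"
  by (induction A rule: infinite_finite_induct) auto

lemma of_base_0 [simp]: "of_base 0 = (0 :: 'r::linordered_field cplx)"
  and of_base_1 [simp]: "of_base 1 = (1 :: 'r cplx)"
  and of_base_add: "of_base (a + b) = of_base a + (of_base b :: 'r cplx)"
  and of_base_minus: "of_base (- a) = - (of_base a :: 'r cplx)"
  and of_base_mult: "of_base (a * b) = of_base a * (of_base b :: 'r cplx)"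
  and of_base_eq_iff [simp]: "of_base a = (of_base b :: 'r cplx) \<longleftrightarrow> a = b"
  and of_base_eq_0_iff [simp]: "of_base a = (0 :: 'r cplx) \<longleftrightarrow> a = 0"
  by (auto simp: cplx_eq_iff)

lemma of_base_power: "of_base (a ^ n) = (of_base a :: 'r::linordered_field cplx) ^ n"
  by (induction n) (auto simp: of_base_mult)

lemma of_base_inverse: "of_base (inverse a) = inverse (of_base a :: 'r::linordered_field cplx)"
  by (cases "a = 0") (simp_all add: cplx_eq_iff inverse_cplx_def power2_eq_square field_simps)

lemma of_base_of_nat: "of_base (of_nat n) = (of_nat n :: 'r::linordered_field cplx)"
  by (induction n) (auto simp: of_base_add)

lemma of_base_sum: "of_base (\<Sum>i\<in>A. f i) = (\<Sum>i\<in>A. of_base (f i) :: 'r::linordered_field cplx)"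
  by (induction A rule: infinite_finite_induct) (auto simp: of_base_add)

lemma of_base_prod: "of_base (\<Prod>i\<in>A. f i) = (\<Prod>i\<in>A. of_base (f i) :: 'r::linordered_field cplx)"
  by (induction A rule: infinite_finite_induct) (auto simp: of_base_mult)

lemma cplx_conj_eq_self_iff: "cplx_conj z = z \<longleftrightarrow> z = of_base (cre z)" for z :: "'r::linordered_field cplx"
  by (auto simp: cplx_eq_iff)

instance cplx :: (linordered_field) field_char_0
proof
  show "inj (of_nat :: nat \<Rightarrow> 'a cplx)"
    by (rule injI) (simp flip: of_base_of_nat)
qed

text \<open>The trivial Euclidean structure of a field. With it polynomials over
  \<open>'a cplx\<close> have greatest common divisors, on which
  \<open>veronese_automorphism\<close> and \<open>disc_nonzero_iff\<close> rely.\<close>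

instantiation cplx :: (linordered_field)
  "{unique_euclidean_ring, normalization_euclidean_semiring, normalization_semidom_multiplicative}"
begin

definition [simp]: "normalize_cplx = (normalize_field :: 'a cplx \<Rightarrow> _)"
definition [simp]: "unit_factor_cplx = (unit_factor_field :: 'a cplx \<Rightarrow> _)"
definition [simp]: "modulo_cplx = (mod_field :: 'a cplx \<Rightarrow> _)"
definition [simp]: "euclidean_size_cplx = (euclidean_size_field :: 'a cplx \<Rightarrow> _)"
definition [simp]: "division_segment (x :: 'a cplx) = 1"

instance
  by standard (simp_all add: dvd_field_iff field_split_simps del: cplx_simps split: if_splits)

end

instantiation cplx :: (linordered_field) euclidean_ring_gcd
begin

definition gcd_cplx :: "'a cplx \<Rightarrow> 'a cplx \<Rightarrow> 'a cplx" where "gcd_cplx = Euclidean_Algorithm.gcd"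
definition lcm_cplx :: "'a cplx \<Rightarrow> 'a cplx \<Rightarrow> 'a cplx" where "lcm_cplx = Euclidean_Algorithm.lcm"
definition Gcd_cplx :: "'a cplx set \<Rightarrow> 'a cplx" where "Gcd_cplx = Euclidean_Algorithm.Gcd"
definition Lcm_cplx :: "'a cplx set \<Rightarrow> 'a cplx" where "Lcm_cplx = Euclidean_Algorithm.Lcm"

instance
  by standard (simp_all add: gcd_cplx_def lcm_cplx_def Gcd_cplx_def Lcm_cplx_def)

end

instance cplx :: (linordered_field) field_gcd ..

text \<open>Half-angle formulas: if z = a + b i has modulus rho, then p ^ 2 = (rho + a) / 2 and q ^
  2 = (rho - a) / 2 give (2 p q) ^ 2 = b ^ 2, and the sign of q is adjusted so that 2 p q =
  b.\<close>

lemma cplx_sqrt_exists: "\<exists>w. w ^ 2 = (z :: 'r::real_closed_field cplx)"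
proof -
  obtain \<rho>' where "\<rho>' ^ 2 = cre z ^ 2 + cim z ^ 2"
    using nonneg_is_square [of "cre z ^ 2 + cim z ^ 2"] by auto
  then obtain \<rho> where \<rho>: "\<rho> \<ge> 0" "\<rho> ^ 2 = cre z ^ 2 + cim z ^ 2"
    by (metis abs_ge_zero power2_abs)
  have "\<bar>cre z\<bar> \<le> \<bar>\<rho>\<bar>"
    unfolding abs_le_square_iff \<rho>(2) by simp
  then have "0 \<le> (\<rho> + cre z) / 2" "0 \<le> (\<rho> - cre z) / 2"
    using \<rho>(1) by auto
  then obtain p q where p: "p ^ 2 = (\<rho> + cre z) / 2" and q: "q ^ 2 = (\<rho> - cre z) / 2"
    using nonneg_is_square by metis
  have "(2 * p * q) ^ 2 = 4 * p ^ 2 * q ^ 2" by (simp add: power_mult_distrib)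
  also have "\<dots> = \<rho> ^ 2 - cre z ^ 2"
    unfolding p q by (simp add: power2_eq_square field_simps)
  finally have "(2 * p * q) ^ 2 = cim z ^ 2"
    using \<rho>(2) by simp
  then have "2 * p * q = cim z \<or> 2 * p * q = - cim z" by (simp only: power2_eq_iff)
  then obtain q' where q': "2 * p * q' = cim z" "q' ^ 2 = q ^ 2"
  proof
    assume "2 * p * q = - cim z"
    then have "2 * p * (- q) = cim z" by simp
    then show thesis by (rule that) simp
  qed (rule that, auto)
  have "p ^ 2 - q' ^ 2 = cre z"
    unfolding q'(2) p q by (simp add: field_simps)
  then have "Cplx p q' ^ 2 = z"
    using q'(1) unfolding cplx_eq_iff power2_eq_square by simp
  then show ?thesis ..
qed

text \<open>Laplace's proof that adjoining a square root of \<open>-1\<close> to a real closed field gives an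
  algebraically closed field. Newton's identities replace the theorem on symmetric polynomials.\<close>

lemma newton_identities_fps:
  fixes y :: "'i \<Rightarrow> 'k::field"
  assumes "finite S"
  shows "(\<Prod>s\<in>S. 1 - fps_const (y s) * fps_X) * Abs_fps (\<lambda>k. \<Sum>s\<in>S. y s ^ Suc k) =
    - fps_deriv (\<Prod>s\<in>S. 1 - fps_const (y s) * fps_X)"
  using assms
proof induction
  case empty
  then show ?case by (simp add: fps_eq_iff)
next
  case (insert s S)
  define E where "E = (\<Prod>s\<in>S. 1 - fps_const (y s) * fps_X)"
  define P where "P = Abs_fps (\<lambda>k. \<Sum>s\<in>S. y s ^ Suc k)"
  define G where "G = Abs_fps (\<lambda>k. y s ^ Suc k)"
  define L where "L = 1 - fps_const (y s) * fps_X"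
  have IH: "E * P = - fps_deriv E"
    using insert.IH by (simp only: E_def P_def)
  have G: "L * G = fps_const (y s)"
    unfolding L_def G_def fps_eq_iff
    by (auto simp: algebra_simps fps_mult_fps_X_commute [symmetric] mult.assoc split: nat.splits)
       (metis One_nat_def Suc_pred power_Suc)
  have L': "fps_deriv L = - fps_const (y s)" by (simp add: L_def del: fps_const_neg)
  have "Abs_fps (\<lambda>k. \<Sum>s\<in>insert s S. y s ^ Suc k) = G + P"
    using insert.hyps by (simp add: G_def P_def fps_eq_iff)
  moreover have "(\<Prod>s\<in>insert s S. 1 - fps_const (y s) * fps_X) = L * E"
    using insert.hyps by (simp add: L_def E_def)
  moreover have "L * E * (G + P) = - fps_deriv (L * E)"
  proof -
    have "L * E * (G + P) = E * (L * G) + L * (E * P)" by (simp add: algebra_simps)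
    also have "\<dots> = - fps_deriv (L * E)"
      unfolding G IH by (simp add: L' algebra_simps del: fps_const_neg)
    finally show ?thesis .
  qed
  ultimately show ?case by simp
qed

text \<open>The reversed polynomial \<open>E\<close> is the product of the factors 1 - y X, so the
  second claim compares the coefficients of X ^ k in the identity of power series above.\<close>

lemma newton_identities:
  fixes y :: "'i \<Rightarrow> 'k::field"
  assumes "finite S"
  defines "E \<equiv> reflect_poly (\<Prod>s\<in>S. [:- y s, 1:])"
  shows "coeff E 0 = 1"
    and "(\<Sum>i\<le>k. coeff E i * (\<Sum>s\<in>S. y s ^ Suc (k - i))) = - of_nat (Suc k) * coeff E (Suc k)"
proof -
  have "reflect_poly [:- c, 1:] = [:1, - c:]" for c :: 'k
    by (simp add: reflect_poly_def)
  then have E: "E = (\<Prod>s\<in>S. [:1, - y s:])"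
    by (simp add: E_def reflect_poly_prod)
  have "fps_of_poly E = (\<Prod>s\<in>S. 1 - fps_const (y s) * fps_X)"
    unfolding E fps_of_poly_prod
    by (intro prod.cong refl) (simp add: fps_of_poly_pCons flip: fps_const_neg)
  then have eq: "fps_of_poly E * Abs_fps (\<lambda>k. \<Sum>s\<in>S. y s ^ Suc k) = - fps_deriv (fps_of_poly E)"
    using newton_identities_fps [OF assms(1), of y] by simp
  show "coeff E 0 = 1"
    unfolding E by (simp add: poly_0_coeff_0 [symmetric] poly_prod)
  have "fps_nth (fps_of_poly E * Abs_fps (\<lambda>k. \<Sum>s\<in>S. y s ^ Suc k)) k = fps_nth (- fps_deriv (fps_of_poly E)) k"
    unfolding eq ..
  then show "(\<Sum>i\<le>k. coeff E i * (\<Sum>s\<in>S. y s ^ Suc (k - i))) = - of_nat (Suc k) * coeff E (Suc k)"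
    by (simp add: fps_mult_nth atMost_atLeast0 algebra_simps)
qed

lemma sum_swap3:
  "(\<Sum>i\<in>A. \<Sum>j\<in>B. \<Sum>r\<in>C. f i j r) = (\<Sum>r\<in>C. \<Sum>i\<in>A. \<Sum>j\<in>B. f i j r)"
proof -
  have "(\<Sum>j\<in>B. \<Sum>r\<in>C. f i j r) = (\<Sum>r\<in>C. \<Sum>j\<in>B. f i j r)" for i
    by (rule sum.swap)
  then show ?thesis by (simp only:) (rule sum.swap)
qed

text \<open>The base field is treated as a subset of an algebraic closure because the roots of its
  polynomials live there; symmetric functions of the roots are shown to fall back into the
  subset.\<close>

locale subfield_set =
  fixes B :: "'k::field_char_0 set"
  assumes one_mem: "1 \<in> B"
    and add_mem: "a \<in> B \<Longrightarrow> b \<in> B \<Longrightarrow> a + b \<in> B"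
    and minus_mem: "a \<in> B \<Longrightarrow> - a \<in> B"
    and mult_mem: "a \<in> B \<Longrightarrow> b \<in> B \<Longrightarrow> a * b \<in> B"
    and inverse_mem: "a \<in> B \<Longrightarrow> inverse a \<in> B"
begin

lemma zero_mem: "0 \<in> B"
  using add_mem [OF one_mem minus_mem [OF one_mem]] by simp

lemma diff_mem: "a \<in> B \<Longrightarrow> b \<in> B \<Longrightarrow> a - b \<in> B"
  using add_mem minus_mem by (metis diff_conv_add_uminus)

lemma divide_mem: "a \<in> B \<Longrightarrow> b \<in> B \<Longrightarrow> a / b \<in> B"
  unfolding divide_inverse by (intro mult_mem inverse_mem)

lemma of_nat_mem: "of_nat n \<in> B"
  by (induction n) (auto intro: zero_mem one_mem add_mem)

lemma numeral_mem: "numeral n \<in> B"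
  using of_nat_mem [of "numeral n"] by simp

lemma sum_mem: "(\<And>i. i \<in> A \<Longrightarrow> f i \<in> B) \<Longrightarrow> sum f A \<in> B"
  by (induction A rule: infinite_finite_induct) (auto intro: zero_mem add_mem)

lemma power_mem: "a \<in> B \<Longrightarrow> a ^ n \<in> B"
  by (induction n) (auto intro: one_mem mult_mem)

lemma power_sum_mem:
  assumes "finite S" and coeffs: "\<And>i. coeff (\<Prod>s\<in>S. [:- y s, 1:]) i \<in> B"
  shows "(\<Sum>s\<in>S. y s ^ k) \<in> B"
proof (induction k rule: less_induct)
  case (less k)
  define E where "E = reflect_poly (\<Prod>s\<in>S. [:- y s, 1:])"
  note N = newton_identities [OF assms(1), of y, folded E_def]
  have E: "coeff E i \<in> B" for i
    unfolding E_def coeff_reflect_poly using coeffs zero_mem by auto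
  show ?case
  proof (cases k)
    case 0
    then show ?thesis by (simp add: of_nat_mem)
  next
    case (Suc j)
    have "(\<Sum>i\<le>j. coeff E i * (\<Sum>s\<in>S. y s ^ Suc (j - i))) =
        coeff E 0 * (\<Sum>s\<in>S. y s ^ Suc j) + (\<Sum>i\<in>{1..j}. coeff E i * (\<Sum>s\<in>S. y s ^ Suc (j - i)))"
      by (simp add: atMost_atLeast0 sum.atLeast_Suc_atMost)
    then have "(\<Sum>s\<in>S. y s ^ k) = - of_nat (Suc j) * coeff E (Suc j) -
        (\<Sum>i\<in>{1..j}. coeff E i * (\<Sum>s\<in>S. y s ^ Suc (j - i)))"
      unfolding N Suc by (simp add: algebra_simps)
    also have "\<dots> \<in> B"
      by (intro diff_mem mult_mem sum_mem minus_mem of_nat_mem E less.IH) (auto simp: Suc)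
    finally show ?thesis .
  qed
qed

text \<open>Newton's identities read backwards: k times the k-th coefficient is a polynomial in
  power sums and earlier coefficients, and characteristic 0 permits the division by k.\<close>

lemma coeff_prod_mem:
  assumes "finite S" and sums: "\<And>k. (\<Sum>s\<in>S. y s ^ k) \<in> B"
  shows "coeff (\<Prod>s\<in>S. [:- y s, 1:]) i \<in> B"
proof -
  define q where "q = (\<Prod>s\<in>S. [:- y s, 1:])"
  define E where "E = reflect_poly q"
  note N = newton_identities [OF assms(1), of y, folded q_def, folded E_def]
  have E: "coeff E k \<in> B" for k
  proof (induction k rule: less_induct)
    case (less k)
    show ?case
    proof (cases k)
      case 0
      then show ?thesis
        using N(1) one_mem by simp
    next
      case (Suc j)
      have "coeff E k = - (\<Sum>i\<le>j. coeff E i * (\<Sum>s\<in>S. y s ^ Suc (j - i))) / of_nat (Suc j)"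
        unfolding N Suc by (simp del: of_nat_Suc)
      also have "\<dots> \<in> B"
        by (intro divide_mem minus_mem sum_mem mult_mem of_nat_mem sums less.IH) (auto simp: Suc)
      finally show ?thesis .
    qed
  qed
  show ?thesis
  proof (cases "i \<le> degree q")
    case True
    then have "coeff q i = coeff E (degree q - i)"
      by (simp add: E_def coeff_reflect_poly)
    then show ?thesis
      using E by (simp add: q_def)
  next
    case False
    then show ?thesis
      unfolding q_def [symmetric] by (simp add: coeff_eq_0 zero_mem)
  qed
qed

text \<open>It suffices to treat the power sums of the new roots. Over all pairs (i, j) they expand
  binomially into products of two power sums of \<open>x\<close>; removing the diagonal and halving,
  by symmetry, leaves the pairs with i < j.\<close>

lemma laplace_poly_coeff_mem:
  fixes x :: "nat \<Rightarrow> 'k"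
  assumes coeffs: "\<And>i. coeff (\<Prod>i<n. [:- x i, 1:]) i \<in> B" and t: "t \<in> B"
  defines "I \<equiv> {(i, j). i < j \<and> j < n}"
  shows "coeff (\<Prod>(i, j)\<in>I. [:- (x i + x j + t * x i * x j), 1:]) l \<in> B"
proof -
  define z where "z = (\<lambda>(i, j). x i + x j + t * x i * x j)"
  have fin: "finite I"
    by (rule finite_subset [of _ "{..<n} \<times> {..<n}"]) (auto simp: I_def)
  have p: "(\<Sum>i<n. x i ^ k) \<in> B" for k
    by (rule power_sum_mem) (use coeffs in auto)
  have zs: "(\<Sum>s\<in>I. z s ^ k) \<in> B" for k
  proof -
    have "(\<Sum>s\<in>{..<n} \<times> {..<n}. z s ^ k) = (\<Sum>i<n. \<Sum>j<n. ((1 + t * x j) * x i + x j) ^ k)"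
      unfolding sum.cartesian_product by (intro sum.cong) (auto simp: z_def algebra_simps)
    also have "\<dots> = (\<Sum>i<n. \<Sum>j<n. \<Sum>l\<le>k. \<Sum>r\<le>l.
        of_nat (k choose l) * of_nat (l choose r) * t ^ r * (x i ^ l * x j ^ (r + (k - l))))"
    proof (intro sum.cong refl)
      fix i j
      have e: "(1 + t * x j) ^ l = (\<Sum>r\<le>l. of_nat (l choose r) * t ^ r * x j ^ r)" for l
        using binomial_ring [of "t * x j" 1 l] by (simp add: add.commute power_mult_distrib mult.assoc)
      have "((1 + t * x j) * x i + x j) ^ k =
          (\<Sum>l\<le>k. of_nat (k choose l) * ((1 + t * x j) * x i) ^ l * x j ^ (k - l))"
        by (rule binomial_ring)
      also have "\<dots> = (\<Sum>l\<le>k. \<Sum>r\<le>l.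
          of_nat (k choose l) * of_nat (l choose r) * t ^ r * (x i ^ l * x j ^ (r + (k - l))))"
        unfolding power_mult_distrib e power_add sum_distrib_left sum_distrib_right
        by (intro sum.cong refl) (simp only: mult_ac)
      finally show "((1 + t * x j) * x i + x j) ^ k = (\<Sum>l\<le>k. \<Sum>r\<le>l.
          of_nat (k choose l) * of_nat (l choose r) * t ^ r * (x i ^ l * x j ^ (r + (k - l))))" .
    qed
    also have "\<dots> = (\<Sum>l\<le>k. \<Sum>i<n. \<Sum>j<n. \<Sum>r\<le>l.
        of_nat (k choose l) * of_nat (l choose r) * t ^ r * (x i ^ l * x j ^ (r + (k - l))))"
      by (rule sum_swap3)
    also have "\<dots> = (\<Sum>l\<le>k. \<Sum>r\<le>l. \<Sum>i<n. \<Sum>j<n.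
        of_nat (k choose l) * of_nat (l choose r) * t ^ r * (x i ^ l * x j ^ (r + (k - l))))"
      by (intro sum.cong refl sum_swap3)
    also have "\<dots> = (\<Sum>l\<le>k. \<Sum>r\<le>l. of_nat (k choose l) * of_nat (l choose r) * t ^ r *
        ((\<Sum>i<n. x i ^ l) * (\<Sum>j<n. x j ^ (r + (k - l)))))"
      by (unfold sum_product, unfold sum_distrib_left) (rule refl)
    also have "\<dots> \<in> B" by (intro sum_mem mult_mem of_nat_mem power_mem t p)
    finally have all: "(\<Sum>s\<in>{..<n} \<times> {..<n}. z s ^ k) \<in> B" .
    have "(\<Sum>i<n. z (i, i) ^ k) = (\<Sum>i<n. \<Sum>l\<le>k. of_nat (k choose l) * t ^ l * 2 ^ (k - l) * x i ^ (k + l))"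
    proof (intro sum.cong refl)
      fix i
      have pow: "x i ^ (k + l) = (x i ^ 2) ^ l * x i ^ (k - l)" if "l \<le> k" for l
        using that by (simp add: add.commute flip: power_mult power_add)
      have "z (i, i) = t * x i ^ 2 + 2 * x i"
        by (simp add: z_def power2_eq_square mult.assoc)
      then show "z (i, i) ^ k = (\<Sum>l\<le>k. of_nat (k choose l) * t ^ l * 2 ^ (k - l) * x i ^ (k + l))"
        by (simp only: binomial_ring)
          (intro sum.cong refl, simp add: pow power_mult_distrib)
    qed
    also have "\<dots> = (\<Sum>l\<le>k. of_nat (k choose l) * t ^ l * 2 ^ (k - l) * (\<Sum>i<n. x i ^ (k + l)))"
      by (subst sum.swap) (simp add: sum_distrib_left)
    also have "\<dots> \<in> B"
      by (intro sum_mem mult_mem of_nat_mem power_mem t p numeral_mem)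
    finally have diag: "(\<Sum>i<n. z (i, i) ^ k) \<in> B" .
    define I' where "I' = (\<lambda>(i, j). (j, i)) ` I"
    define D where "D = (\<lambda>i. (i, i)) ` {..<n}"
    have disj: "I \<inter> I' = {}" "(I \<union> I') \<inter> D = {}" and fin': "finite I'" "finite D"
      using fin by (auto simp: I_def I'_def D_def)
    have "{..<n} \<times> {..<n} = I \<union> I' \<union> D"
      by (auto simp: I_def I'_def D_def image_iff)
    then have "(\<Sum>s\<in>{..<n} \<times> {..<n}. z s ^ k) = (\<Sum>s\<in>I. z s ^ k) + (\<Sum>s\<in>I'. z s ^ k) + (\<Sum>s\<in>D. z s ^ k)"
      using fin disj by (simp add: sum.union_disjoint fin')
    moreover have "(\<Sum>s\<in>I'. z s ^ k) = (\<Sum>s\<in>I. z s ^ k)"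
      unfolding I'_def by (subst sum.reindex) (auto simp: inj_on_def z_def ac_simps intro!: sum.cong)
    moreover have "(\<Sum>s\<in>D. z s ^ k) = (\<Sum>i<n. z (i, i) ^ k)"
      unfolding D_def by (subst sum.reindex) (auto simp: inj_on_def)
    ultimately have "(\<Sum>s\<in>I. z s ^ k) = ((\<Sum>s\<in>{..<n} \<times> {..<n}. z s ^ k) - (\<Sum>i<n. z (i, i) ^ k)) / 2"
      by simp
    also have "\<dots> \<in> B" by (intro divide_mem diff_mem all diag numeral_mem)
    finally show ?thesis .
  qed
  have "(\<Prod>(i, j)\<in>I. [:- (x i + x j + t * x i * x j), 1:]) = (\<Prod>s\<in>I. [:- z s, 1:])"
    by (intro prod.cong) (auto simp: z_def)
  then show ?thesis
    using coeff_prod_mem [OF fin zs] by simp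
qed

end

text \<open>Passing from n roots to their unordered pairs removes one factor 2 from the degree; the
  induction in \<open>base_poly_has_root\<close> runs on this.\<close>

lemma odd_mult_pred_half:
  fixes n :: nat
  assumes "n = 2 ^ Suc k * m" "odd m"
  shows "\<exists>m'. odd m' \<and> n * (n - 1) div 2 = 2 ^ k * m'"
proof (intro exI conjI)
  have "n > 0"
    using assms by (auto intro: Nat.gr0I)
  then show "odd (m * (n - 1))"
    using assms by simp
  show "n * (n - 1) div 2 = 2 ^ k * (m * (n - 1))"
    using assms(1) by simp
qed

lemma card_ordered_pairs: "card {(i, j). i < j \<and> j < (n::nat)} = n * (n - 1) div 2"
proof -
  have "{(i, j). i < j \<and> j < n} = (\<lambda>(j, i). (i, j)) ` (SIGMA j:{..<n}. {..<j})"
    by (auto simp: image_iff)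
  then have "card {(i, j). i < j \<and> j < n} = card (SIGMA j:{..<n}. {..<j})"
    by (simp add: card_image inj_on_def split_def prod_eq_iff)
  also have "\<dots> = n * (n - 1) div 2" by (simp add: lessThan_atLeast0 Sum_Ico_nat)
  finally show ?thesis .
qed

text \<open>Induction on the exponent of 2 in the degree. For every t the polynomial with roots x_i
  + x_j + t x_i x_j falls under the induction hypothesis, so some pair has its value in the
  quadratic extension. Infinitely many t share finitely many pairs; two values of t with the same
  pair put x_i + x_j and x_i x_j into the extension, where the quadratic equation is
  solvable.\<close>

lemma base_poly_has_root:
  fixes Q :: "('r::real_closed_field cplx) alg_closure poly"
  assumes "\<And>i. coeff Q i \<in> range (\<lambda>a. to_ac (of_base a))" "degree Q = 2 ^ k * m" "odd m"
  shows "\<exists>z. poly Q (to_ac z) = 0"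
  using assms
proof (induction k arbitrary: m Q)
  case 0
  define f where "f = (\<lambda>i. SOME a. coeff Q i = to_ac (of_base a))"
  have f: "coeff Q i = to_ac (of_base (f i))" for i
    unfolding f_def using 0(1) [of i] by (intro someI_ex [of "\<lambda>a. coeff Q i = to_ac (of_base a)"]) auto
  have "Q \<noteq> 0"
    using 0 by auto
  then have "f (degree Q) \<noteq> 0"
    using f [of "degree Q"] by auto
  then obtain x where "(\<Sum>i\<le>degree Q. f i * x ^ i) = 0"
    using odd_degree_has_root [of "degree Q" f] 0 by auto
  then have "to_ac (of_base (\<Sum>i\<le>degree Q. f i * x ^ i)) = to_ac (of_base 0)"
    by (simp only:)
  then have "poly Q (to_ac (of_base x)) = 0"
    by (simp add: poly_altdef f of_base_sum of_base_mult of_base_power to_ac_sum)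
  then show ?case ..
next
  case (Suc k)
  define B where "B = range (\<lambda>a::'r. to_ac (of_base a))"
  interpret subfield_set B
  proof
    show "1 \<in> B"
      unfolding B_def by (rule range_eqI [of _ _ 1]) simp
    fix a b assume "a \<in> B" "b \<in> B"
    then obtain a' b' where ab: "a = to_ac (of_base a')" "b = to_ac (of_base b')"
      by (auto simp: B_def)
    show "a + b \<in> B"
      unfolding B_def ab by (rule range_eqI [of _ _ "a' + b'"]) (simp add: of_base_add)
    show "a * b \<in> B"
      unfolding B_def ab by (rule range_eqI [of _ _ "a' * b'"]) (simp add: of_base_mult)
  next
    fix a assume "a \<in> B"
    then obtain a' where a: "a = to_ac (of_base a')" by (auto simp: B_def)
    show "- a \<in> B"
      unfolding B_def a by (rule range_eqI [of _ _ "- a'"]) (simp add: of_base_minus)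
    show "inverse a \<in> B"
      unfolding B_def a by (rule range_eqI [of _ _ "inverse a'"]) (simp add: of_base_inverse)
  qed
  have QB: "coeff Q i \<in> B" for i
    using Suc.prems(1) by (simp add: B_def)
  define n where "n = degree Q"
  have "Q \<noteq> 0"
    using Suc.prems by auto
  then obtain A where A: "size A = n" "Q = smult (lead_coeff Q) (\<Prod>x\<in>#A. [:- x, 1:])"
    using alg_closed_imp_factorization [of Q] by (auto simp: n_def)
  obtain xs where xs: "mset xs = A"
    using ex_mset by blast
  define x where "x = (\<lambda>i. xs ! i)"
  have len: "length xs = n"
    using A(1) xs by auto
  have "(\<Prod>x\<in>#A. [:- x, 1:]) = (\<Prod>x\<leftarrow>xs. [:- x, 1:])"
    unfolding xs [symmetric] by (simp flip: prod_mset_prod_list)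
  also have "\<dots> = (\<Prod>i<n. [:- x i, 1:])"
    by (simp add: prod.list_conv_set_nth x_def len lessThan_atLeast0)
  finally have Q: "Q = smult (lead_coeff Q) (\<Prod>i<n. [:- x i, 1:])"
    using A(2) by simp
  have "coeff (smult c p) i / c = coeff p i" if "c \<noteq> 0" for c i and p :: "'r cplx alg_closure poly"
    using that by simp
  then have "coeff (\<Prod>i<n. [:- x i, 1:]) i = coeff Q i / lead_coeff Q" for i
    using Q \<open>Q \<noteq> 0\<close> by (metis leading_coeff_0_iff)
  then have prodB: "coeff (\<Prod>i<n. [:- x i, 1:]) i \<in> B" for i
    using QB divide_mem by simp
  define I where "I = {(i, j). i < j \<and> j < n}"
  have fin: "finite I"
    by (rule finite_subset [of _ "{..<n} \<times> {..<n}"]) (auto simp: I_def)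
  have ex: "\<exists>s\<in>I. \<exists>z. (case s of (i, j) \<Rightarrow> x i + x j + of_nat t * x i * x j) = to_ac z" for t :: nat
  proof -
    define R where "R = (\<Prod>(i, j)\<in>I. [:- (x i + x j + of_nat t * x i * x j), 1:])"
    obtain m' where "odd m'" "n * (n - 1) div 2 = 2 ^ k * m'"
      using odd_mult_pred_half Suc.prems n_def by metis
    moreover have "degree R = n * (n - 1) div 2"
      unfolding R_def using card_ordered_pairs [of n]
      by (subst degree_prod_eq_sum_degree) (auto simp: I_def split_def)
    moreover have "coeff R i \<in> B" for i
      unfolding R_def I_def using prodB of_nat_mem by (rule laplace_poly_coeff_mem)
    ultimately obtain z where "poly R (to_ac z) = 0"
      using Suc.IH [of R m'] by (auto simp: B_def)
    then obtain s where s: "s \<in> I" "poly (case s of (i, j) \<Rightarrow> [:- (x i + x j + of_nat t * x i * x j), 1:]) (to_ac z) = 0"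
      unfolding R_def poly_prod prod_zero_iff [OF fin] by blast
    obtain i j where ij: "s = (i, j)"
      by force
    have lin: "poly [:- c, 1:] w = w - c" for c w :: "'r cplx alg_closure" by simp
    have "x i + x j + of_nat t * x i * x j = to_ac z"
      using s(2) unfolding ij prod.case lin by (rule right_minus_eq [THEN iffD1, symmetric])
    then have "(case s of (i, j) \<Rightarrow> x i + x j + of_nat t * x i * x j) = to_ac z"
      unfolding ij prod.case .
    then show ?thesis by (intro bexI [of _ s] exI [of _ z] s(1))
  qed
  then have "\<forall>t::nat. \<exists>s. s \<in> I \<and> (\<exists>z. (case s of (i, j) \<Rightarrow> x i + x j + of_nat t * x i * x j) = to_ac z)"
    by blast
  from choice [OF this] obtain S where S: "\<And>t. S t \<in> I"
      "\<And>t. \<exists>z. (case S t of (i, j) \<Rightarrow> x i + x j + of_nat t * x i * x j) = to_ac z"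
    by blast
  have "\<not> inj S"
    using fin S(1) by (metis finite_subset image_subsetI infinite_UNIV_nat finite_image_iff)
  then obtain t t' where t: "t \<noteq> t'" "S t = S t'" by (auto simp: inj_on_def)
  obtain i j where ij: "S t = (i, j)"
    by force
  obtain z z' where z: "x i + x j + of_nat t * x i * x j = to_ac z" "x i + x j + of_nat t' * x i * x j = to_ac z'"
    using S(2) [of t] S(2) [of t'] ij t(2) by auto
  \<comment> \<open>The difference of the two values isolates the product of the roots, and then the
    sum follows.\<close>
  define u where "u = (z - z') / (of_nat t - of_nat t')"
  have "(of_nat t - of_nat t') * (x i * x j) = to_ac (z - z')"
    unfolding to_ac_diff z(1) [symmetric] z(2) [symmetric] by (simp add: algebra_simps)
  then have u: "x i * x j = to_ac u"
    using t(1) by (simp add: u_def field_simps)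
  define s where "s = z - of_nat t * u"
  have s: "x i + x j = to_ac s"
    using z(1) u by (simp add: s_def algebra_simps)
  obtain w where w: "w ^ 2 = s ^ 2 - 4 * u"
    using cplx_sqrt_exists by blast
  have "(2 * x i - to_ac s) ^ 2 = to_ac (s ^ 2 - 4 * u)"
    by (simp flip: s u) (simp add: power2_eq_square algebra_simps)
  also have "\<dots> = to_ac w ^ 2" by (simp flip: w)
  finally have "2 * x i - to_ac s = to_ac w \<or> 2 * x i - to_ac s = - to_ac w"
    by (simp only: power2_eq_iff)
  then have "x i = to_ac ((s + w) / 2) \<or> x i = to_ac ((s - w) / 2)"
    by (auto simp: field_simps)
  then obtain v where v: "x i = to_ac v" by blast
  have "i < n"
    using S(1) [of t] ij by (auto simp: I_def)
  then have "poly Q (x i) = 0" by (subst Q) (auto simp: poly_prod intro!: prod_zero)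
  then show ?case
    using v by metis
qed

text \<open>The product of p with its conjugate has coefficients in the base field. A root of the
  conjugate factor is conjugated into a root of p.\<close>

instance cplx :: (real_closed_field) alg_closed_field
proof (rule alg_closedI)
  fix p :: "'a cplx poly"
  assume "degree p > 0" "lead_coeff p = 1"
  define h :: "'a cplx poly \<Rightarrow> 'a cplx alg_closure poly" where "h = map_poly to_ac"
  define q where "q = map_poly cplx_conj p"
  have cq: "coeff q i = cplx_conj (coeff p i)" for i by (simp add: q_def coeff_map_poly)
  define Q where "Q = h (p * q)"
  have cQ: "coeff Q i = to_ac (coeff (p * q) i)" for i
    by (simp add: Q_def h_def coeff_map_poly)
  have "cplx_conj (coeff (p * q) i) = coeff (q * p) i" for i
    by (simp add: coeff_mult cplx_conj_sum cq)
  then have "cplx_conj (coeff (p * q) i) = coeff (p * q) i" for i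
    by (simp add: mult.commute)
  then have real: "coeff (p * q) i \<in> range of_base" for i
    unfolding cplx_conj_eq_self_iff by (rule range_eqI)
  have coeffs: "coeff Q i \<in> range (\<lambda>a. to_ac (of_base a))" for i
    unfolding cQ using real [of i] by auto
  have "degree q = degree p"
    unfolding q_def by (rule degree_map_poly) simp
  moreover have "p \<noteq> 0" "q \<noteq> 0"
    using \<open>degree p > 0\<close> calculation by auto
  ultimately have "degree (p * q) > 0"
    using \<open>degree p > 0\<close> by (simp add: degree_mult_eq)
  moreover have "degree Q = degree (p * q)"
    unfolding Q_def h_def by (rule degree_map_poly) simp
  ultimately have "degree Q \<noteq> 0" by simp
  then obtain m where "degree Q = 2 ^ multiplicity 2 (degree Q) * m" "odd m"
    by (rule multiplicity_decompose' [of "degree Q" 2]) auto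
  then obtain z where "poly Q (to_ac z) = 0"
    using base_poly_has_root coeffs by blast
  moreover have "poly Q (to_ac z) = to_ac (poly (p * q) z)"
    by (simp add: poly_altdef \<open>degree Q = degree (p * q)\<close> cQ to_ac_sum)
  ultimately have "poly p z = 0 \<or> poly q z = 0" by simp
  then show "\<exists>x. poly p x = 0"
  proof
    assume "poly q z = 0"
    then have "cplx_conj (poly q z) = 0" by simp
    then have "poly p (cplx_conj z) = 0"
      by (simp add: poly_altdef \<open>degree q = degree p\<close> cq cplx_conj_sum)
    then show ?thesis ..
  qed blast
qed

section \<open>Forms as functions\<close>

definition mon :: "('n \<Rightarrow> nat) \<Rightarrow> 'k::field ^ 'n::finite \<Rightarrow> 'k"
  where "mon m x = (\<Prod>j\<in>UNIV. x $ j ^ m j)"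

text \<open>Homogeneous polynomials as functions: products, determinants and substitutions are then
  immediate, and \<open>form_fun_peval\<close> and \<open>form_fun_imp_peval\<close> translate from
  and to polynomials. The zero function is a form of every degree.\<close>

inductive form_fun :: "nat \<Rightarrow> ('k::field ^ 'n::finite \<Rightarrow> 'k) \<Rightarrow> bool"
  where
    mon: "sum m UNIV = k \<Longrightarrow> form_fun k (\<lambda>x. c * mon m x)"
  | add: "form_fun k f \<Longrightarrow> form_fun k g \<Longrightarrow> form_fun k (\<lambda>x. f x + g x)"

lemma form_fun_zero: "form_fun k (\<lambda>x. 0 :: 'k::field)"
proof -
  have "form_fun k (\<lambda>x :: 'k ^ 'n::finite. 0 * mon (\<lambda>j. if j = undefined then k else 0) x)"
    by (rule form_fun.mon) simp
  then show ?thesis by simp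
qed

lemma form_fun_sum: "(\<And>i. i \<in> A \<Longrightarrow> form_fun k (f i)) \<Longrightarrow> form_fun k (\<lambda>x. \<Sum>i\<in>A. f i x)"
proof (induction A rule: infinite_finite_induct)
  case (insert a A)
  then show ?case
    using form_fun.add [of k "f a" "\<lambda>x. \<Sum>i\<in>A. f i x"] by simp
qed (auto intro: form_fun_zero)

lemma form_fun_scale: "form_fun k f \<Longrightarrow> form_fun k (\<lambda>x. c * f x)"
proof (induction rule: form_fun.induct)
  case (mon m k c')
  then show ?case
    using form_fun.mon [of m k "c * c'"] by (simp add: mult.assoc)
next
  case (add k f g)
  then show ?case
    using form_fun.add [of k "\<lambda>x. c * f x" "\<lambda>x. c * g x"] by (simp add: algebra_simps)
qed

lemma form_fun_minus: "form_fun k f \<Longrightarrow> form_fun k (\<lambda>x. - f x)"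
  using form_fun_scale [of k f "-1"] by simp

lemma form_fun_mon_mult:
  assumes "form_fun l g" "sum m UNIV = k"
  shows "form_fun (k + l) (\<lambda>x. c * mon m x * g x)"
  using assms
proof (induction rule: form_fun.induct)
  case (mon m' l c')
  then have "form_fun (k + l) (\<lambda>x. (c * c') * mon (\<lambda>j. m j + m' j) x)"
    by (intro form_fun.mon) (simp add: sum.distrib)
  then show ?case by (simp add: mon_def power_add prod.distrib mult_ac)
next
  case (add l f g)
  then show ?case
    using form_fun.add [of "k + l" "\<lambda>x. c * mon m x * f x" "\<lambda>x. c * mon m x * g x"]
    by (simp add: algebra_simps)
qed

lemma form_fun_mult:
  assumes "form_fun k f" "form_fun l g"
  shows "form_fun (k + l) (\<lambda>x. f x * g x)"
  using assms
proof (induction rule: form_fun.induct)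
  case (mon m k c)
  then show ?case by (intro form_fun_mon_mult)
next
  case (add k f1 f2)
  then show ?case
    using form_fun.add [of "k + l" "\<lambda>x. f1 x * g x" "\<lambda>x. f2 x * g x"] by (simp add: algebra_simps)
qed

lemma form_fun_const: "form_fun 0 (\<lambda>x :: 'k::field ^ 'n::finite. c)"
  using form_fun.mon [of "\<lambda>j :: 'n. 0" 0 c] by (simp add: mon_def)

lemma form_fun_coord: "form_fun 1 (\<lambda>x :: 'k::field ^ 'n::finite. x $ i)"
proof -
  have "mon (\<lambda>j. if j = i then 1 else 0) x = x $ i" for x :: "'k ^ 'n"
    by (simp add: mon_def if_distrib [of "\<lambda>n. _ ^ n"] prod.delta cong: if_cong)
  then have "(\<lambda>x :: 'k ^ 'n. x $ i) = (\<lambda>x. 1 * mon (\<lambda>j. if j = i then 1 else 0) x)"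
    by auto
  then show ?thesis by (simp only:) (rule form_fun.mon, simp)
qed

lemma form_fun_linear: "form_fun 1 (\<lambda>x :: 'k::field ^ 'n::finite. \<Sum>i\<in>UNIV. a $ i * x $ i)"
  by (intro form_fun_sum form_fun_scale form_fun_coord)

lemma form_fun_prod:
  "finite A \<Longrightarrow> (\<And>i. i \<in> A \<Longrightarrow> form_fun (k i) (f i)) \<Longrightarrow> form_fun (sum k A) (\<lambda>x. \<Prod>i\<in>A. f i x)"
proof (induction A rule: finite_induct)
  case (insert a A)
  then show ?case
    using form_fun_mult [of "k a" "f a" "sum k A" "\<lambda>x. \<Prod>i\<in>A. f i x"] by simp
qed (simp add: form_fun_const)

lemma form_fun_power: "form_fun k f \<Longrightarrow> form_fun (n * k) (\<lambda>x. f x ^ n)"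
  by (induction n) (auto intro: form_fun_const form_fun_mult)

lemma form_fun_homogeneous:
  assumes "form_fun k f"
  shows "f (c *s x) = c ^ k * f x"
  using assms
proof (induction rule: form_fun.induct)
  case (mon m k a)
  then show ?case
    by (simp add: mon_def power_mult_distrib prod.distrib power_sum [symmetric])
qed (simp add: algebra_simps)

lemma form_fun_zero_arg: "form_fun k f \<Longrightarrow> 0 < k \<Longrightarrow> f 0 = 0"
  using form_fun_homogeneous [of k f 0 0] by (simp add: zero_power)

lemma form_fun_peval:
  assumes "homogeneous k F"
  shows "form_fun k (peval F)"
proof -
  have "form_fun k (\<lambda>x. \<Sum>m\<in>Poly_Mapping.keys F. Poly_Mapping.lookup F m * mon (Poly_Mapping.lookup m) x)"
    using assms by (intro form_fun_sum form_fun.mon) (auto simp: homogeneous_def)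
  then show ?thesis by (simp add: peval_def [abs_def] mon_def)
qed

lemma peval_superset:
  assumes "finite S" "Poly_Mapping.keys F \<subseteq> S"
  shows "peval F x = (\<Sum>m\<in>S. Poly_Mapping.lookup F m * mon (Poly_Mapping.lookup m) x)"
  unfolding peval_def mon_def using assms
  by (intro sum.mono_neutral_left) (auto simp: in_keys_iff)

lemma peval_add: "peval (F + G) x = peval F x + peval G x"
proof -
  let ?S = "Poly_Mapping.keys F \<union> Poly_Mapping.keys G"
  have "finite ?S" "Poly_Mapping.keys (F + G) \<subseteq> ?S"
    using Poly_Mapping.keys_add [of F G] by auto
  then show ?thesis
    by (simp add: peval_superset [of ?S] lookup_add sum.distrib algebra_simps)
qed

lemma form_fun_imp_peval:
  assumes "form_fun k (f :: 'k::field ^ 'n::finite \<Rightarrow> 'k)"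
  shows "\<exists>F. homogeneous k F \<and> peval F = f"
  using assms
proof (induction rule: form_fun.induct)
  case (mon m k c)
  define m' where "m' = Abs_poly_mapping m"
  have m': "Poly_Mapping.lookup m' = m" by (simp add: m'_def)
  define F :: "('k, 'n) mpoly" where "F = Poly_Mapping.single m' c"
  have "homogeneous k F"
    using mon m' by (auto simp: homogeneous_def F_def split: if_splits)
  moreover have "peval F x = c * mon m x" for x
    by (subst peval_superset [of "{m'}"]) (auto simp: F_def m' split: if_splits)
  ultimately show ?case by (intro exI [of _ F]) auto
next
  case (add k f g)
  then obtain F G where FG: "homogeneous k F" "peval F = f" "homogeneous k G" "peval G = g"
    by blast
  have "homogeneous k (F + G)"
    using FG(1,3) Poly_Mapping.keys_add [of F G] by (auto simp: homogeneous_def)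
  moreover have "peval (F + G) = (\<lambda>x. f x + g x)"
    using FG by (auto simp: peval_add)
  ultimately show ?case by blast
qed

text \<open>Restriction to a line reduces the search for non-zeros of forms to polynomials in one
  variable.\<close>

lemma form_fun_line_poly:
  assumes "form_fun k (f :: 'k::field ^ 'n::finite \<Rightarrow> 'k)"
  shows "\<exists>p. \<forall>t. f (x + t *s y) = poly p t"
  using assms
proof (induction rule: form_fun.induct)
  case (mon m k c)
  have "c * mon m (x + t *s y) = poly (smult c (\<Prod>j\<in>UNIV. [:x $ j, y $ j:] ^ m j)) t" for t
    by (simp add: mon_def poly_prod)
  then show ?case by blast
next
  case (add k f g)
  then obtain p q where "\<forall>t. f (x + t *s y) = poly p t" "\<forall>t. g (x + t *s y) = poly q t"
    by blast
  then show ?case by (intro exI [of _ "p + q"]) simp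
qed

lemma form_fun_line_finite_zeros:
  assumes "form_fun k (f :: 'k::field ^ 'n::finite \<Rightarrow> 'k)" "f (x + t0 *s y) \<noteq> 0"
  shows "finite {t. f (x + t *s y) = 0}"
proof -
  obtain p where p: "\<And>t. f (x + t *s y) = poly p t"
    using form_fun_line_poly [OF assms(1)] by blast
  then have "p \<noteq> 0"
    using assms(2) by auto
  then show ?thesis
    using poly_roots_finite p by simp
qed

text \<open>The common non-zero is found on the line through \<open>x\<close> and \<open>y\<close>.\<close>

lemma form_fun_common_nonzero:
  fixes f g :: "'k::field_char_0 ^ 'n::finite \<Rightarrow> 'k"
  assumes "form_fun k f" "form_fun l g" "f x \<noteq> 0" "g y \<noteq> 0"
  shows "\<exists>z. f z \<noteq> 0 \<and> g z \<noteq> 0"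
proof -
  have "finite {t. f (x + t *s (y - x)) = 0}" "finite {t. g (x + t *s (y - x)) = 0}"
    using form_fun_line_finite_zeros [OF assms(1), of x 0 "y - x"]
      form_fun_line_finite_zeros [OF assms(2), of x 1 "y - x"] assms(3,4) by auto
  then have "finite ({t. f (x + t *s (y - x)) = 0} \<union> {t. g (x + t *s (y - x)) = 0})"
    by simp
  then have "{t. f (x + t *s (y - x)) = 0} \<union> {t. g (x + t *s (y - x)) = 0} \<noteq> UNIV"
    using infinite_UNIV_char_0 [where ?'a = 'k] by metis
  then show ?thesis by blast
qed

lemma form_fun_prod_nonzero:
  fixes f :: "'i \<Rightarrow> 'k::field_char_0 ^ 'n::finite \<Rightarrow> 'k"
  assumes "finite A" "\<And>i. i \<in> A \<Longrightarrow> form_fun (k i) (f i)" "\<And>i. i \<in> A \<Longrightarrow> \<exists>x. f i x \<noteq> 0"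
  shows "\<exists>x. \<forall>i\<in>A. f i x \<noteq> 0"
  using assms
proof (induction A rule: finite_induct)
  case (insert a A)
  then obtain x where x: "\<forall>i\<in>A. f i x \<noteq> 0" by auto
  obtain y where y: "f a y \<noteq> 0"
    using insert.prems(2) by auto
  have "form_fun (sum k A) (\<lambda>x. \<Prod>i\<in>A. f i x)"
    using insert.hyps insert.prems by (intro form_fun_prod) auto
  moreover have "form_fun (k a) (f a)" "(\<Prod>i\<in>A. f i x) \<noteq> 0"
    using insert.hyps insert.prems(1) x by auto
  ultimately obtain z where "(\<Prod>i\<in>A. f i z) \<noteq> 0" "f a z \<noteq> 0"
    using form_fun_common_nonzero y by blast
  then show ?case
    using insert.hyps by (intro exI [of _ z]) auto
qed simp

section \<open>Zariski closed sets\<close>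

lemma point_in_line: "x \<noteq> 0 \<Longrightarrow> x \<in> line (point x)"
  by (simp add: line_point vec.span_base)

lemma line_nonzero_imp_point:
  assumes "x \<in> line P" "x \<noteq> 0"
  shows "P = point x"
proof -
  obtain y where y: "y \<noteq> 0" "P = point y"
    by (rule point_cases)
  then obtain c where c: "x = c *s y"
    using assms(1) by (auto simp: line_point vec.span_singleton)
  then have "c \<noteq> 0"
    using assms(2) by auto
  have "vec.span {x} = vec.span {y}"
  proof (intro equalityI vec.span_minimal vec.subspace_span)
    show "{x} \<subseteq> vec.span {y}"
      unfolding c by (auto intro: vec.span_scale vec.span_base)
    have "y = inverse c *s x"
      using \<open>c \<noteq> 0\<close> by (simp add: c)
    then show "{y} \<subseteq> vec.span {x}"
      by (metis empty_subsetI insert_subset singletonI vec.span_base vec.span_scale)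
  qed
  then show ?thesis by (simp add: y(2) point_def)
qed

lemma point_eq_iff:
  assumes "x \<noteq> 0" "y \<noteq> 0"
  shows "point x = point y \<longleftrightarrow> (\<exists>c. x = c *s y)"
proof
  assume "point x = point y"
  then have "x \<in> line (point y)"
    using point_in_line assms(1) by metis
  then show "\<exists>c. x = c *s y"
    using assms(2) by (auto simp: line_point vec.span_singleton)
next
  assume "\<exists>c. x = c *s y"
  then have "x \<in> line (point y)"
    using assms(2) by (auto simp: line_point vec.span_singleton)
  then show "point x = point y"
    using line_nonzero_imp_point assms(1) by metis
qed

lemma point_scale: "c \<noteq> 0 \<Longrightarrow> x \<noteq> 0 \<Longrightarrow> point (c *s x) = point x"
  by (subst point_eq_iff) auto

definition zero_set :: "('k::field ^ 'n::finite \<Rightarrow> 'k) \<Rightarrow> ('k, 'n) proj set"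
  where "zero_set f = {P. \<forall>x\<in>line P. f x = 0}"

lemma vanishes_at_zero_set: "{P. vanishes_at F P} = zero_set (peval F)"
  by (simp add: zero_set_def vanishes_at_def)

lemma point_in_zero_set:
  assumes "form_fun k f" "x \<noteq> 0"
  shows "point x \<in> zero_set f \<longleftrightarrow> f x = 0"
  using assms point_in_line [OF assms(2)]
  by (auto simp: zero_set_def line_point vec.span_singleton form_fun_homogeneous)

lemma zariski_closed_zero_set:
  assumes "form_fun k f"
  shows "zariski_closed (zero_set f)"
proof -
  obtain F where "homogeneous k F" "peval F = f"
    using form_fun_imp_peval [OF assms] by blast
  then show ?thesis
    unfolding zariski_closed_def
    by (intro exI [of _ "{F}"]) (auto simp: forms_def zero_set_def vanishes_at_def)
qed

lemma zariski_closed_Int: "zariski_closed A \<Longrightarrow> zariski_closed B \<Longrightarrow> zariski_closed (A \<inter> B)"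
  unfolding zariski_closed_def
proof (elim exE conjE)
  fix I J assume "I \<subseteq> forms" "A = {P. \<forall>F\<in>I. vanishes_at F P}"
    "J \<subseteq> forms" "B = {P. \<forall>F\<in>J. vanishes_at F P}"
  then show "\<exists>I\<subseteq>forms. A \<inter> B = {P. \<forall>F\<in>I. vanishes_at F P}"
    by (intro exI [of _ "I \<union> J"]) auto
qed

lemma zariski_closed_UNIV: "zariski_closed UNIV"
  unfolding zariski_closed_def by (intro exI [of _ "{}"]) auto

lemma zariski_closed_separate:
  assumes "zariski_closed Z" "P \<notin> Z"
  obtains k f where "form_fun k f" "Z \<subseteq> zero_set f" "P \<notin> zero_set f"
proof -
  obtain I where I: "I \<subseteq> forms" "Z = {P. \<forall>F\<in>I. vanishes_at F P}"
    using assms(1) by (auto simp: zariski_closed_def)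
  then obtain F where F: "F \<in> I" "\<not> vanishes_at F P"
    using assms(2) by blast
  then obtain k where "homogeneous k F"
    using I(1) by (auto simp: forms_def)
  then show thesis
    using I F by (intro that [of k "peval F"] form_fun_peval) (auto simp: zero_set_def vanishes_at_def)
qed

lemma zariski_closed_Inter:
  assumes "\<And>i. i \<in> A \<Longrightarrow> form_fun (k i) (f i)"
  shows "zariski_closed {P. \<forall>i\<in>A. P \<in> zero_set (f i)}"
proof -
  have "\<exists>F. homogeneous (k i) F \<and> peval F = f i" if "i \<in> A" for i
    using form_fun_imp_peval assms that by blast
  then obtain F where F: "\<And>i. i \<in> A \<Longrightarrow> homogeneous (k i) (F i) \<and> peval (F i) = f i"
    by metis
  then show ?thesis
    unfolding zariski_closed_def
    by (intro exI [of _ "F ` A"]) (auto simp: forms_def zero_set_def vanishes_at_def)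
qed

lemma irreducible_closed_cover:
  assumes "irreducible_closed X" "zariski_closed A" "zariski_closed B" "X \<subseteq> A \<union> B"
  shows "X \<subseteq> A \<or> X \<subseteq> B"
proof -
  have "zariski_closed (X \<inter> A)" "zariski_closed (X \<inter> B)"
    using assms zariski_closed_Int by (auto simp: irreducible_closed_def)
  moreover have "X = X \<inter> A \<union> X \<inter> B"
    using assms(4) by auto
  ultimately have "X = X \<inter> A \<or> X = X \<inter> B"
    using assms(1) unfolding irreducible_closed_def by blast
  then show ?thesis by blast
qed

lemma irreducible_closed_prime:
  assumes "irreducible_closed Z" "form_fun k f" "form_fun l g" "Z \<subseteq> zero_set (\<lambda>x. f x * g x)"
  shows "Z \<subseteq> zero_set f \<or> Z \<subseteq> zero_set g"
proof (rule irreducible_closed_cover [OF assms(1)])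
  show "zariski_closed (zero_set f)" "zariski_closed (zero_set g)"
    using assms zariski_closed_zero_set by blast+
  show "Z \<subseteq> zero_set f \<union> zero_set g"
  proof
    fix P assume "P \<in> Z"
    obtain x where x: "x \<noteq> 0" "P = point x"
      by (rule point_cases)
    then have "f x * g x = 0"
      using point_in_zero_set [OF form_fun_mult [OF assms(2,3)], of x] assms(4) \<open>P \<in> Z\<close> by auto
    then show "P \<in> zero_set f \<union> zero_set g"
      using x assms(2,3) point_in_zero_set by auto
  qed
qed

lemma irreducible_closed_UNIV: "irreducible_closed (UNIV :: ('k::field_char_0, 'n::finite) proj set)"
  unfolding irreducible_closed_def
proof (intro conjI allI impI zariski_closed_UNIV)
  fix A B :: "('k, 'n) proj set"
  assume AB: "zariski_closed A" "zariski_closed B" "UNIV = A \<union> B"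
  show "UNIV = A \<or> UNIV = B"
  proof (rule ccontr)
    assume "\<not> ?thesis"
    then obtain P Q where PQ: "P \<notin> A" "Q \<notin> B" by auto
    obtain k f where f: "form_fun k f" "A \<subseteq> zero_set f" "P \<notin> zero_set f"
      using zariski_closed_separate AB(1) PQ(1) by blast
    obtain l g where g: "form_fun l g" "B \<subseteq> zero_set g" "Q \<notin> zero_set g"
      using zariski_closed_separate AB(2) PQ(2) by blast
    obtain x0 y0 where x0: "f x0 \<noteq> 0" and y0: "g y0 \<noteq> 0"
      using f(3) g(3) by (auto simp: zero_set_def)
    \<comment> \<open>The forms may be constant, so a coordinate is multiplied in to keep the common
      non-zero away from the origin.\<close>
    have "((\<chi> i. 1) :: 'k ^ 'n) $ undefined \<noteq> 0" by simp
    then obtain y where "g y \<noteq> 0" "y $ undefined \<noteq> 0"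
      using form_fun_common_nonzero [OF g(1) form_fun_coord y0] by blast
    then have gy: "g y * y $ undefined \<noteq> 0" by simp
    have gy': "form_fun (l + 1) (\<lambda>y. g y * y $ undefined)"
      by (intro form_fun_mult g form_fun_coord)
    obtain z where z: "f z \<noteq> 0" "g z * z $ undefined \<noteq> 0"
      using form_fun_common_nonzero [OF f(1) gy' x0 gy] by blast
    then have "z \<noteq> 0" by auto
    then have "point z \<notin> zero_set f" "point z \<notin> zero_set g"
      using z point_in_zero_set [OF f(1)] point_in_zero_set [OF g(1)] by auto
    then have "point z \<notin> A \<union> B"
      using f(2) g(2) by auto
    then show False
      using AB(3) by auto
  qed
qed simp

section \<open>Krull dimension of hypersurfaces\<close>

text \<open>A witness that the Hilbert function of \<open>Z\<close> is at least \<open>N\<close> in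
  degree \<open>k\<close>: the forms are independent modulo those vanishing on
  \<open>Z\<close>.\<close>

definition forms_independent_on ::
    "('k::field, 'n::finite) proj set \<Rightarrow> nat \<Rightarrow> nat \<Rightarrow> (nat \<Rightarrow> 'k ^ 'n \<Rightarrow> 'k) \<Rightarrow> bool"
  where "forms_independent_on Z k N f \<longleftrightarrow> (\<forall>i<N. form_fun k (f i)) \<and>
    (\<forall>c. Z \<subseteq> zero_set (\<lambda>x. \<Sum>i<N. c i * f i x) \<longrightarrow> (\<forall>i<N. c i = 0))"

lemma zero_set_subset_iff:
  assumes "form_fun k f"
  shows "Z \<subseteq> zero_set f \<longleftrightarrow> (\<forall>x. x \<noteq> 0 \<longrightarrow> point x \<in> Z \<longrightarrow> f x = 0)"
proof safe
  fix x assume "Z \<subseteq> zero_set f" "x \<noteq> 0" "point x \<in> Z"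
  then show "f x = 0"
    using point_in_zero_set assms by blast
next
  fix P assume *: "\<forall>x. x \<noteq> 0 \<longrightarrow> point x \<in> Z \<longrightarrow> f x = 0" "P \<in> Z"
  obtain x where "x \<noteq> 0" "P = point x"
    by (rule point_cases)
  then show "P \<in> zero_set f"
    using * point_in_zero_set assms by blast
qed

text \<open>All exponents but one determine the monomial, and each is at most
  \<open>k\<close>.\<close>

lemma card_exponents_le:
  "card {m :: 'n::finite \<Rightarrow> nat. sum m UNIV = k} \<le> (k + 1) ^ (CARD('n) - 1)"
  "finite {m :: 'n \<Rightarrow> nat. sum m UNIV = k}"
proof -
  define a :: 'n where "a = undefined"
  define T where "T = (UNIV - {a} \<rightarrow>\<^sub>E {..k})"
  define r where "r = (\<lambda>m :: 'n \<Rightarrow> nat. restrict m (UNIV - {a}))"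
  let ?M = "{m :: 'n \<Rightarrow> nat. sum m UNIV = k}"
  have "finite T"
    unfolding T_def by (intro finite_PiE) auto
  have le: "m j \<le> sum m UNIV" for m :: "'n \<Rightarrow> nat" and j
    by (rule member_le_sum) auto
  have "r m \<in> T" if "m \<in> ?M" for m
    using le [of m] that by (simp add: T_def r_def PiE_def Pi_def)
  then have sub: "r ` ?M \<subseteq> T" by blast
  have inj: "inj_on r ?M"
  proof (rule inj_onI)
    fix m m' :: "'n \<Rightarrow> nat"
    assume m: "m \<in> ?M" "m' \<in> ?M" "r m = r m'"
    have eq: "m j = m' j" if "j \<noteq> a" for j
      using fun_cong [OF m(3), of j] that by (simp add: r_def)
    have "sum m UNIV = m a + sum m (UNIV - {a})" for m :: "'n \<Rightarrow> nat"
      by (simp add: sum.remove)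
    moreover have "sum m (UNIV - {a}) = sum m' (UNIV - {a})"
      by (intro sum.cong) (auto simp: eq)
    ultimately have "m a = m' a"
      using m(1,2) by (metis (mono_tags, lifting) add_right_cancel mem_Collect_eq)
    then show "m = m'"
      using eq by (metis ext)
  qed
  show "finite ?M"
    using finite_subset [OF sub \<open>finite T\<close>] inj by (rule finite_imageD)
  have "card ?M \<le> card T"
    using card_inj_on_le [OF inj sub \<open>finite T\<close>] .
  also have "card T = (k + 1) ^ (CARD('n) - 1)"
    unfolding T_def by (simp add: card_PiE card_Diff_singleton)
  finally show "card ?M \<le> (k + 1) ^ (CARD('n) - 1)" .
qed

lemma vector_space_functions: "vector_space (\<lambda>c (f :: 'b \<Rightarrow> 'k::field) x. c * f x)"
  by unfold_locales (auto simp: algebra_simps fun_eq_iff)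

lemma form_fun_in_span:
  fixes g :: "'k::field ^ 'n::finite \<Rightarrow> 'k"
  assumes "form_fun k g"
  shows "g \<in> module.span (\<lambda>c (f :: 'k ^ 'n \<Rightarrow> 'k) x. c * f x) (mon ` {m. sum m UNIV = k})"
proof -
  interpret fs: vector_space "\<lambda>c (f :: 'k ^ 'n \<Rightarrow> 'k) x. c * f x"
    by (rule vector_space_functions)
  show ?thesis
    using assms
  proof (induction rule: form_fun.induct)
    case (mon m k c)
    then show ?case by (intro fs.span_scale fs.span_base) auto
  next
    case (add k f g)
    then have "f + g \<in> fs.span (mon ` {m. sum m UNIV = k})" by (intro fs.span_add)
    then show ?case by (simp add: plus_fun_def)
  qed
qed

lemma forms_independent_on_le:
  fixes Z :: "('k::field, 'n::finite) proj set"
  assumes "forms_independent_on Z k N f"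
  shows "N \<le> (k + 1) ^ (CARD('n) - 1)"
proof -
  interpret fs: vector_space "\<lambda>c (f :: 'k ^ 'n \<Rightarrow> 'k) x. c * f x"
    by (rule vector_space_functions)
  define T where "T = (mon :: _ \<Rightarrow> 'k ^ 'n \<Rightarrow> 'k) ` {m. sum m UNIV = k}"
  have fin: "finite T"
    unfolding T_def by (intro finite_imageI card_exponents_le)
  have form: "form_fun k (f i)" if "i < N" for i
    using assms that by (auto simp: forms_independent_on_def)
  have ind: "c i = 0" if "\<And>x. (\<Sum>i<N. c i * f i x) = 0" "i < N" for c i
    using assms that by (auto simp: forms_independent_on_def zero_set_def)
  have span: "f i \<in> fs.span T" if "i < N" for i
    unfolding T_def by (rule form_fun_in_span [OF form [OF that]])
  have inj: "inj_on f {..<N}"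
  proof (rule inj_onI, rule ccontr)
    fix i j assume ij: "i \<in> {..<N}" "j \<in> {..<N}" "f i = f j" "i \<noteq> j"
    define c where "c = (\<lambda>l. (if l = i then 1 else 0) - (if l = j then 1 else 0 :: 'k))"
    have "(\<Sum>l<N. c l * f l x) = 0" for x
      using ij by (simp add: c_def left_diff_distrib sum_subtractf if_distrib [of "\<lambda>c. c * _"] cong: if_cong)
    then have "c i = 0"
      using ind [of c i] ij by auto
    then show False
      using ij by (simp add: c_def)
  qed
  have "\<not> fs.dependent (f ` {..<N})"
  proof
    assume "fs.dependent (f ` {..<N})"
    then obtain t u v where t: "finite t" "t \<subseteq> f ` {..<N}" "(\<Sum>v\<in>t. (\<lambda>x. u v * v x)) = 0" "v \<in> t" "u v \<noteq> 0"
      unfolding fs.dependent_explicit by blast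
    define c where "c = (\<lambda>i. if f i \<in> t then u (f i) else 0)"
    have "(\<Sum>i<N. c i * f i x) = 0" for x
    proof -
      have "(\<Sum>i<N. c i * f i x) = (\<Sum>v\<in>f ` {..<N}. (if v \<in> t then u v else 0) * v x)"
        by (subst sum.reindex [OF inj]) (simp add: c_def)
      also have "\<dots> = (\<Sum>v\<in>t. u v * v x)"
        using t(2) by (intro sum.mono_neutral_cong_right) auto
      also have "\<dots> = (\<Sum>v\<in>t. (\<lambda>x. u v * v x)) x"
        by (induction t rule: infinite_finite_induct) auto
      finally show ?thesis by (simp add: t(3))
    qed
    moreover obtain i where "i < N" "v = f i"
      using t(2,4) by auto
    ultimately have "c i = 0"
      using ind by blast
    then show False
      using t(4,5) \<open>v = f i\<close> by (simp add: c_def)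
  qed
  then have "card (f ` {..<N}) \<le> card T"
    using fs.independent_span_bound [OF fin] span by blast
  also have "card T \<le> card {m :: 'n \<Rightarrow> nat. sum m UNIV = k}"
    unfolding T_def by (intro card_image_le card_exponents_le)
  finally show ?thesis
    using card_exponents_le(1) [where ?'n = 'n, of k] inj by (simp add: card_image)
qed

text \<open>A relation restricted to \<open>Y\<close> loses the multiples of \<open>F\<close>, so
  the coefficients of the \<open>f i\<close> vanish. In what remains \<open>F\<close> can be
  cancelled, because \<open>Z\<close> is irreducible and not contained in the zeros of
  \<open>F\<close>.\<close>

lemma forms_independent_on_extend:
  fixes Z :: "('k::field, 'n::finite) proj set"
  assumes Z: "irreducible_closed Z" and "Y \<subseteq> Z"
    and F: "form_fun l F" "Y \<subseteq> zero_set F" "\<not> Z \<subseteq> zero_set F"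
    and f: "forms_independent_on Y (k + l) p f" and g: "forms_independent_on Z k q g"
  shows "forms_independent_on Z (k + l) (p + q) (\<lambda>i. if i < p then f i else (\<lambda>x. g (i - p) x * F x))"
proof -
  define h where "h = (\<lambda>i. if i < p then f i else (\<lambda>x. g (i - p) x * F x))"
  have fg: "form_fun (k + l) (f i)" if "i < p" for i
    using f that by (auto simp: forms_independent_on_def)
  have gg: "form_fun k (g i)" if "i < q" for i
    using g that by (auto simp: forms_independent_on_def)
  have hh: "form_fun (k + l) (h i)" if "i < p + q" for i
    using that fg gg F(1) by (auto simp: h_def intro!: form_fun_mult)
  have split: "(\<Sum>i<p + q. c i * h i x) = (\<Sum>i<p. c i * f i x) + (\<Sum>i<q. c (p + i) * g i x) * F x" for c x
  proof -
    have "(\<Sum>i<p + q. c i * h i x) = (\<Sum>i<p. c i * h i x) + (\<Sum>i<q. c (p + i) * h (p + i) x)" for h :: "nat \<Rightarrow> 'k ^ 'n \<Rightarrow> 'k" and q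
      by (induction q) (auto simp: add.assoc)
    moreover have "(\<Sum>i<p. c i * h i x) = (\<Sum>i<p. c i * f i x)"
      by (intro sum.cong) (auto simp: h_def)
    moreover have "h (p + i) x = g i x * F x" for i by (simp add: h_def)
    ultimately show ?thesis by (simp only: sum_distrib_right mult.assoc)
  qed
  have "\<forall>i<p + q. c i = 0" if c: "Z \<subseteq> zero_set (\<lambda>x. \<Sum>i<p + q. c i * h i x)" for c
  proof -
    have fs: "form_fun (k + l) (\<lambda>x. \<Sum>i<p. c i * f i x)" and gs: "form_fun k (\<lambda>x. \<Sum>i<q. c (p + i) * g i x)"
      using fg gg by (auto intro!: form_fun_sum form_fun_scale)
    have hs: "form_fun (k + l) (\<lambda>x. \<Sum>i<p + q. c i * h i x)"
      using hh by (auto intro!: form_fun_sum form_fun_scale)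
    have 0: "(\<Sum>i<p. c i * f i x) + (\<Sum>i<q. c (p + i) * g i x) * F x = 0" if "x \<noteq> 0" "point x \<in> Z" for x
    proof -
      have "(\<Sum>i<p + q. c i * h i x) = 0"
        using c [unfolded zero_set_subset_iff [OF hs]] that by simp
      then show ?thesis by (simp only: split)
    qed
    have "Y \<subseteq> zero_set (\<lambda>x. \<Sum>i<p. c i * f i x)"
      unfolding zero_set_subset_iff [OF fs]
    proof (intro allI impI)
      fix x assume x: "x \<noteq> 0" "point x \<in> Y"
      then have "F x = 0"
        using F(1,2) zero_set_subset_iff by blast
      then show "(\<Sum>i<p. c i * f i x) = 0"
        using 0 [of x] x \<open>Y \<subseteq> Z\<close> by auto
    qed
    then have cp: "\<forall>i<p. c i = 0"
      using f by (auto simp: forms_independent_on_def)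
    have "Z \<subseteq> zero_set (\<lambda>x. (\<Sum>i<q. c (p + i) * g i x) * F x)"
      unfolding zero_set_subset_iff [OF form_fun_mult [OF gs F(1)]] using 0 cp by auto
    then have "Z \<subseteq> zero_set (\<lambda>x. \<Sum>i<q. c (p + i) * g i x)"
      using irreducible_closed_prime [OF Z gs F(1)] F(3) by blast
    then have cq: "\<forall>i<q. c (p + i) = 0"
      using g by (auto simp: forms_independent_on_def)
    show ?thesis
    proof (intro allI impI)
      fix i assume i: "i < p + q"
      show "c i = 0"
      proof (cases "i < p")
        case False
        then have "c (p + (i - p)) = 0"
          using cq i by (metis less_diff_conv2 not_less add.commute)
        then show ?thesis
          using False by simp
      qed (use cp in blast)
    qed
  qed
  then show ?thesis
    unfolding forms_independent_on_def h_def [symmetric] using hh by blast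
qed

text \<open>Each step of the chain raises the order of growth of the Hilbert function by one: the
  two contributions in \<open>forms_independent_on_extend\<close> add up by Pascal's rule, in a
  double induction on \<open>j\<close> and \<open>s\<close>.\<close>

lemma forms_independent_on_chain:
  fixes Z :: "nat \<Rightarrow> ('k::field, 'n::finite) proj set"
  assumes irr: "\<And>j. j \<le> n \<Longrightarrow> irreducible_closed (Z j)"
    and mono: "\<And>j. j < n \<Longrightarrow> Z j \<subseteq> Z (Suc j)"
    and F: "\<And>j. j < n \<Longrightarrow> form_fun K (F j)" "\<And>j. j < n \<Longrightarrow> Z j \<subseteq> zero_set (F j)"
      "\<And>j. j < n \<Longrightarrow> \<not> Z (Suc j) \<subseteq> zero_set (F j)"
    and "j \<le> n"
  shows "\<exists>f. forms_independent_on (Z j) (s * K) ((s + j) choose j) f"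
proof -
  have base: "\<exists>f. forms_independent_on (Z j) k 1 f" if j: "j \<le> n" for j k
  proof -
    obtain P where P: "P \<in> Z j"
      using irr [OF j] by (auto simp: irreducible_closed_def)
    obtain x where x: "x \<noteq> 0" "P = point x"
      by (rule point_cases)
    then obtain i where i: "x $ i \<noteq> 0" by (auto simp: vec_eq_iff)
    define f where "f = (\<lambda>x :: 'k ^ 'n. (x $ i) ^ k)"
    have "form_fun k f"
      using form_fun_power [OF form_fun_coord, of k i] by (simp add: f_def)
    moreover have "c = 0" if "Z j \<subseteq> zero_set (\<lambda>x. c * f x)" for c
      using that P x i zero_set_subset_iff [OF form_fun_scale [OF \<open>form_fun k f\<close>]]
      by (fastforce simp: f_def)
    ultimately have "forms_independent_on (Z j) k 1 (\<lambda>_. f)"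
      by (auto simp: forms_independent_on_def)
    then show ?thesis by blast
  qed
  show ?thesis
    using \<open>j \<le> n\<close>
  proof (induction j arbitrary: s)
    case 0
    then show ?case
      using base [of 0] by simp
  next
    case (Suc j)
    note IH = Suc.IH and le = Suc.prems
    show ?case
    proof (induction s)
      case 0
      then show ?case
        using base [of "Suc j" 0] le by simp
    next
      case (Suc s)
      then obtain g where g: "forms_independent_on (Z (Suc j)) (s * K) ((s + Suc j) choose Suc j) g"
        by blast
      obtain f where f: "forms_independent_on (Z j) (s * K + K) ((Suc s + j) choose j) f"
        using IH [of "Suc s"] le by (auto simp: add.commute)
      have "((Suc s + Suc j) choose Suc j) = ((Suc s + j) choose j) + ((s + Suc j) choose Suc j)"
        by simp
      moreover have "Suc s * K = s * K + K" by simp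
      moreover have "\<exists>h. forms_independent_on (Z (Suc j)) (s * K + K) (((Suc s + j) choose j) + ((s + Suc j) choose Suc j)) h"
        by (rule exI, rule forms_independent_on_extend [OF irr [OF le] mono F f g]) (use le in auto)
      ultimately show ?case by (simp only:)
    qed
  qed
qed

text \<open>In \<open>s\<close> the left side grows with order n and the right side at most with
  order m.\<close>

lemma binomial_growth:
  assumes "\<And>s. ((s + n) choose n) \<le> (s * K + 1) ^ m"
  shows "n \<le> m"
proof (rule ccontr)
  assume "\<not> n \<le> m"
  then have n: "0 < n" "Suc m \<le> n" by auto
  \<comment> \<open>At s = r n the binomial coefficient is at least (r + 1) ^ n, while the bound is
    at most A ^ m (r + 1) ^ m. The choice r = A ^ m makes this too small for n > m.\<close>
  define A where "A = n * K + 1"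
  define r where "r = A ^ m"
  have "Suc r ^ Suc m \<le> Suc r ^ n"
    using n by (intro power_increasing) auto
  also have "\<dots> \<le> ((r * n + n) choose n)"
  proof -
    have "(of_nat (r * n + n) / of_nat n :: real) ^ n \<le> of_nat ((r * n + n) choose n)"
      by (rule binomial_ge_n_over_k_pow_k) simp
    also have "of_nat (r * n + n) / of_nat n = (of_nat (Suc r) :: real)"
      using n by (simp add: field_simps)
    finally show ?thesis by (simp only: of_nat_power [symmetric] of_nat_le_iff)
  qed
  also have "\<dots> \<le> (r * n * K + 1) ^ m" by (rule assms)
  also have "\<dots> \<le> (A * Suc r) ^ m"
    by (intro power_mono) (auto simp: A_def algebra_simps)
  also have "\<dots> = r * Suc r ^ m" by (simp only: power_mult_distrib r_def)
  finally show False by simp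
qed

text \<open>A chain of length n forces at least (s + n choose n) independent forms of degree s K,
  whereas the number of monomials of that degree is bounded by a polynomial in s of order
  \<open>CARD('n) - 1\<close>.\<close>

lemma irreducible_chain_length_le:
  fixes Z :: "nat \<Rightarrow> ('k::field, 'n::finite) proj set"
  assumes irr: "\<And>j. j \<le> n \<Longrightarrow> irreducible_closed (Z j)"
    and mono: "\<And>j. j < n \<Longrightarrow> Z j \<subset> Z (Suc j)"
  shows "n \<le> CARD('n) - 1"
proof -
  have "\<exists>k f. form_fun k f \<and> Z j \<subseteq> zero_set f \<and> \<not> Z (Suc j) \<subseteq> zero_set f" if j: "j < n" for j
  proof -
    obtain P where P: "P \<in> Z (Suc j)" "P \<notin> Z j"
      using mono [OF j] by auto
    moreover have "zariski_closed (Z j)"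
      using irr j by (auto simp: irreducible_closed_def)
    ultimately show ?thesis by (metis subsetD zariski_closed_separate)
  qed
  then obtain k F where F: "\<And>j. j < n \<Longrightarrow> form_fun (k j) (F j)" "\<And>j. j < n \<Longrightarrow> Z j \<subseteq> zero_set (F j)"
      "\<And>j. j < n \<Longrightarrow> \<not> Z (Suc j) \<subseteq> zero_set (F j)"
    by metis
  have kpos: "0 < k j" if j: "j < n" for j
  proof (rule ccontr)
    assume "\<not> 0 < k j"
    then have const: "F j x = F j 0" for x
      using form_fun_homogeneous [OF F(1) [OF j], of 0 x] by simp
    obtain P where "P \<in> Z j"
      using irr [of j] j by (auto simp: irreducible_closed_def)
    then have "F j 0 = 0"
      using F(2) [OF j] vec.subspace_0 [of "line P"] line [of P] by (auto simp: zero_set_def)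
    then show False
      using F(3) [OF j] const by (auto simp: zero_set_def)
  qed
  \<comment> \<open>The separating forms are raised to powers of a common degree, which does not
    change their zero sets.\<close>
  define K where "K = (\<Prod>j<n. k j)"
  define e where "e = (\<lambda>j. K div k j)"
  have e: "e j * k j = K" "0 < e j" if "j < n" for j
  proof -
    have "k j dvd K"
      unfolding K_def using that by (intro dvd_prodI) auto
    then show eq: "e j * k j = K" by (simp add: e_def)
    have "0 < K"
      unfolding K_def using kpos by (intro prod_pos) auto
    then show "0 < e j"
      using eq by (metis gr_zeroI mult_is_0 less_not_refl2)
  qed
  define G where "G = (\<lambda>j x. F j x ^ e j)"
  have zG: "zero_set (G j) = zero_set (F j)" if "j < n" for j
    using e(2) [OF that] by (auto simp: zero_set_def G_def)
  have G: "form_fun K (G j)" if "j < n" for j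
    unfolding G_def e(1) [OF that, symmetric] using F(1) that by (intro form_fun_power)
  have "((s + n) choose n) \<le> (s * K + 1) ^ (CARD('n) - 1)" for s
  proof -
    obtain f where "forms_independent_on (Z n) (s * K) ((s + n) choose n) f"
      using forms_independent_on_chain [of n Z K G n s] irr mono G F(2,3) zG by (metis order.refl psubset_imp_subset)
    then show ?thesis by (rule forms_independent_on_le)
  qed
  then show ?thesis by (rule binomial_growth)
qed

text \<open>A chain inside a proper hypersurface is prolonged by the whole space, which is
  irreducible.\<close>

lemma krull_dim_zero_set_less:
  fixes G :: "'k::field_char_0 ^ 'n::finite \<Rightarrow> 'k"
  assumes "form_fun k G" "0 < k" "G x \<noteq> 0" "CARD('n) = d + 1" "0 < d"
  shows "krull_dim (zero_set G) < enat d"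
proof -
  have "x \<noteq> 0"
    using form_fun_zero_arg assms(1-3) by blast
  then have ne: "zero_set G \<noteq> UNIV"
    using point_in_zero_set assms(1,3) by blast
  have "n \<le> d - 1" if Z: "\<forall>j\<le>n. irreducible_closed (Z j) \<and> Z j \<subseteq> zero_set G" "\<forall>j<n. Z j \<subset> Z (Suc j)" for n Z
  proof -
    define Y where "Y = (\<lambda>j. if j \<le> n then Z j else UNIV)"
    have "irreducible_closed (Y j)" if "j \<le> Suc n" for j
      using Z(1) irreducible_closed_UNIV by (auto simp: Y_def)
    moreover have "Y j \<subset> Y (Suc j)" if "j < Suc n" for j
    proof (cases "j = n")
      case True
      then show ?thesis
        using Z(1) ne by (auto simp: Y_def)
    next
      case False
      then show ?thesis
        using Z(2) that by (simp add: Y_def)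
    qed
    ultimately have "Suc n \<le> CARD('n) - 1" by (rule irreducible_chain_length_le)
    then show ?thesis
      using assms by simp
  qed
  then have "krull_dim (zero_set G) \<le> enat (d - 1)"
    unfolding krull_dim_def by (intro Sup_least) (auto simp del: enat_ord_simps simp: enat_ord_simps(1))
  also have "\<dots> < enat d"
    using \<open>0 < d\<close> by simp
  finally show ?thesis .
qed

section \<open>Binary forms\<close>

text \<open>A polynomial \<open>p\<close> of degree at most \<open>e\<close> is the dehomogenization of the binary form
  \<open>hev e p\<close> of degree \<open>e\<close>.\<close>

definition hev :: "nat \<Rightarrow> 'k::field poly \<Rightarrow> 'k \<Rightarrow> 'k \<Rightarrow> 'k"
  where "hev e p x y = (\<Sum>k\<le>e. coeff p k * x ^ k * y ^ (e - k))"

lemma poly_as_sum: "degree p \<le> e \<Longrightarrow> poly p x = (\<Sum>k\<le>e. coeff p k * x ^ k)"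
  for p :: "'k::field poly"
  unfolding poly_altdef by (rule sum.mono_neutral_left) (auto simp: coeff_eq_0)

lemma hev_affine: "degree p \<le> e \<Longrightarrow> hev e p x 1 = poly p x"
  by (simp add: hev_def poly_as_sum)

lemma hev_scale: "hev e p (c * x) (c * y) = c ^ e * hev e p x y"
  unfolding hev_def sum_distrib_left
proof (intro sum.cong refl)
  fix k assume "k \<in> {..e}"
  then have "c ^ e = c ^ k * c ^ (e - k)" by (simp flip: power_add)
  then show "coeff p k * (c * x) ^ k * (c * y) ^ (e - k) = c ^ e * (coeff p k * x ^ k * y ^ (e - k))"
    by (simp add: power_mult_distrib)
qed

lemma hev_divide:
  assumes "degree p \<le> e" "y \<noteq> 0"
  shows "hev e p x y = y ^ e * poly p (x / y)"
  using hev_scale [of e p y "x / y" 1] assms by (simp add: hev_affine)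

lemma hev_infinity: "hev e p x 0 = coeff p e * x ^ e"
proof -
  have "hev e p x 0 = (\<Sum>k\<in>{e}. coeff p k * x ^ k * 0 ^ (e - k))"
    unfolding hev_def by (intro sum.mono_neutral_right) auto
  then show ?thesis by simp
qed

lemma hev_0 [simp]: "hev e 0 x y = 0"
  by (simp add: hev_def)

lemma hev_add: "hev e (p + q) x y = hev e p x y + hev e q x y"
  by (simp add: hev_def sum.distrib algebra_simps)

lemma hev_smult: "hev e (smult c p) x y = c * hev e p x y"
  by (simp add: hev_def sum_distrib_left mult.assoc)

lemma hev_sum: "hev e (\<Sum>i\<in>A. p i) x y = (\<Sum>i\<in>A. hev e (p i) x y)"
  by (induction A rule: infinite_finite_induct) (auto simp: hev_add)

lemma hev_monom: "k \<le> e \<Longrightarrow> hev e (monom c k) x y = c * x ^ k * y ^ (e - k)"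
  by (simp add: hev_def if_distrib [of "\<lambda>c. c * _"] cong: if_cong)

lemma degree_mult_bound: "degree p \<le> a \<Longrightarrow> degree q \<le> b \<Longrightarrow> degree (p * q) \<le> a + b"
  for p q :: "'k::field poly"
  using degree_mult_le [of p q] by linarith

lemma coeff_mult_top:
  fixes p q :: "'k::field poly"
  assumes "degree p \<le> a" "degree q \<le> b"
  shows "coeff (p * q) (a + b) = coeff p a * coeff q b"
proof (cases "degree p = a \<and> degree q = b")
  case True
  then show ?thesis
    using coeff_mult_degree_sum by blast
next
  case False
  then have "degree p < a \<or> degree q < b"
    using assms by auto
  moreover have "degree (p * q) < a + b"
    using False assms degree_mult_le [of p q] by linarith
  ultimately show ?thesis by (auto simp: coeff_eq_0)
qed

lemma hev_mult:
  assumes "degree p \<le> a" "degree q \<le> b"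
  shows "hev (a + b) (p * q) x y = hev a p x y * hev b q x y"
proof (cases "y = 0")
  case True
  then show ?thesis
    using coeff_mult_top [OF assms] by (simp add: hev_infinity power_add)
next
  case False
  then show ?thesis
    using assms degree_mult_bound [OF assms] by (simp add: hev_divide power_add)
qed

lemma hev_1_0: "hev 0 1 x y = 1"
  by (simp add: hev_def)

lemma hev_power:
  assumes "degree p \<le> a"
  shows "degree (p ^ n) \<le> n * a \<and> hev (n * a) (p ^ n) x y = hev a p x y ^ n"
proof (induction n)
  case (Suc n)
  then show ?case
    using degree_mult_bound [OF assms, of "p ^ n" "n * a"] hev_mult [OF assms, of "p ^ n" "n * a"] by simp
qed (simp add: hev_1_0)

lemma hev_prod:
  assumes "finite A" "\<And>i. i \<in> A \<Longrightarrow> degree (p i) \<le> a i"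
  shows "degree (prod p A) \<le> sum a A \<and> hev (sum a A) (prod p A) x y = (\<Prod>i\<in>A. hev (a i) (p i) x y)"
  using assms
proof (induction A rule: finite_induct)
  case (insert i A)
  then show ?case
    using degree_mult_bound [of "p i" "a i" "prod p A" "sum a A"]
      hev_mult [of "p i" "a i" "prod p A" "sum a A"] by simp
qed (simp add: hev_1_0)

lemma hev_eqI:
  fixes p q :: "'k::field_char_0 poly"
  assumes "degree p \<le> e" "degree q \<le> e" "\<And>x y. hev e p x y = hev e q x y"
  shows "p = q"
proof -
  have "poly p = poly q"
    using assms(3) [of _ 1] assms(1,2) by (auto simp: hev_affine fun_eq_iff)
  then show ?thesis by (simp add: poly_eq_poly_eq_iff)
qed

lemma form_fun_hev_comp:
  fixes g :: "'k::field ^ 'n::finite \<Rightarrow> 'k"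
  assumes "form_fun k g" and deg: "\<And>i. degree (q i) \<le> e"
  shows "\<exists>r. degree r \<le> k * e \<and> (\<forall>x y. g (\<chi> i. hev e (q i) x y) = hev (k * e) r x y)"
  using assms(1)
proof (induction rule: form_fun.induct)
  case (mon m k c)
  have deg': "degree (q i ^ m i) \<le> m i * e" for i
    using hev_power [OF deg] by blast
  have k: "(\<Sum>i\<in>UNIV. m i * e) = k * e"
    using mon by (simp flip: sum_distrib_right)
  have *: "degree (\<Prod>i\<in>UNIV. q i ^ m i) \<le> k * e \<and>
      hev (k * e) (\<Prod>i\<in>UNIV. q i ^ m i) x y = (\<Prod>i\<in>UNIV. hev e (q i) x y ^ m i)" for x y
    using hev_prod [of UNIV "\<lambda>i. q i ^ m i" "\<lambda>i. m i * e"] deg' hev_power [OF deg] unfolding k by simp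
  show ?case
    using * by (intro exI [of _ "smult c (\<Prod>i\<in>UNIV. q i ^ m i)"]) (simp add: hev_smult mon_def)
next
  case (add k f g)
  then obtain r s where "degree r \<le> k * e" "\<forall>x y. f (\<chi> i. hev e (q i) x y) = hev (k * e) r x y"
    "degree s \<le> k * e" "\<forall>x y. g (\<chi> i. hev e (q i) x y) = hev (k * e) s x y"
    by blast
  then show ?case
    by (intro exI [of _ "r + s"]) (auto simp: hev_add intro: degree_add_le)
qed

lemma form_fun_binary:
  fixes g :: "'k::field ^ 2 \<Rightarrow> 'k"
  assumes "form_fun k g"
  shows "\<exists>p. degree p \<le> k \<and> (\<forall>u. g u = hev k p (u $ 1) (u $ 2))"
proof -
  define q :: "2 \<Rightarrow> 'k poly" where "q = (\<lambda>i. if i = 1 then monom 1 1 else monom 1 0)"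
  have "degree (q i) \<le> 1" for i
    by (auto simp: q_def intro: order_trans [OF degree_monom_le])
  then obtain p where p: "degree p \<le> k * 1" "\<And>x y. g (\<chi> i. hev 1 (q i) x y) = hev (k * 1) p x y"
    using form_fun_hev_comp [OF assms, of q 1] by blast
  have "(\<chi> i. hev 1 (q i) (u $ 1) (u $ 2)) = u" for u :: "'k ^ 2"
    by (simp add: vec_eq_iff q_def hev_def forall_2)
  then show ?thesis
    using p by (metis mult_1_right)
qed

section \<open>Removal of common zeros of binary forms\<close>

definition root_form :: "'k::field \<Rightarrow> 'k \<Rightarrow> 'k \<Rightarrow> 'k \<Rightarrow> 'k"
  where "root_form x0 y0 x y = (if y0 = 0 then y else x - x0 / y0 * y)"

lemma hev_divide_root:
  fixes p :: "'k::field poly"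
  assumes p: "degree p \<le> Suc e" and 0: "hev (Suc e) p x0 y0 = 0" "(x0, y0) \<noteq> (0, 0)"
  shows "\<exists>q. degree q \<le> e \<and> (\<forall>x y. hev (Suc e) p x y = root_form x0 y0 x y * hev e q x y)"
proof (cases "y0 = 0")
  case True
  then have c: "coeff p (Suc e) = 0"
    using 0 by (simp add: hev_infinity)
  then have deg: "degree p \<le> e"
    using p by (metis le_SucE leading_coeff_0_iff degree_0 le0 nat.distinct(1))
  have "hev (Suc e) p x y = y * hev e p x y" for x y
    unfolding hev_def using c
    by (auto simp: sum_distrib_left Suc_diff_le mult_ac intro!: sum.cong)
  then show ?thesis
    using True deg by (auto simp: root_form_def)
next
  case False
  define a where "a = x0 / y0"
  have "poly p a = 0"
    using 0 False p by (simp add: hev_divide a_def)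
  then obtain q where q: "p = [:- a, 1:] * q"
    using poly_eq_0_iff_dvd by (metis dvdE)
  have deg: "degree q \<le> e"
  proof (cases "q = 0")
    case False
    then have "degree p = 1 + degree q"
      unfolding q by (subst degree_mult_eq) auto
    then show ?thesis
      using p by simp
  qed simp
  have "hev (1 + e) p x y = hev 1 [:- a, 1:] x y * hev e q x y" for x y
    unfolding q using deg by (intro hev_mult) auto
  moreover have "hev 1 [:- a, 1:] x y = x - a * y" for x y by (simp add: hev_def)
  ultimately show ?thesis
    using False deg by (auto simp: root_form_def a_def)
qed

text \<open>While the forms have a common zero, its linear form is divided out of all of them, which
  lowers the degree; \<open>g\<close> collects the removed factors.\<close>

lemma base_points_remove:
  fixes p :: "'n \<Rightarrow> 'k::field_char_0 poly"
  assumes "\<And>i. degree (p i) \<le> k" "\<exists>i. p i \<noteq> 0"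
  shows "\<exists>e q g. (\<forall>i. degree (q i) \<le> e) \<and>
    (\<forall>x y. (x, y) \<noteq> (0, 0) \<longrightarrow> (\<exists>i. hev e (q i) x y \<noteq> 0)) \<and>
    (\<forall>i x y. hev k (p i) x y = g x y * hev e (q i) x y)"
  using assms
proof (induction k arbitrary: p)
  case 0
  then obtain i where "coeff (p i) 0 \<noteq> 0"
    by (metis leading_coeff_0_iff le_zero_eq)
  then have "\<exists>i. hev 0 (p i) x y \<noteq> 0" for x y by (auto simp: hev_def)
  then show ?case
    using 0 by (intro exI [of _ 0] exI [of _ p] exI [of _ "\<lambda>_ _. 1"]) auto
next
  case (Suc k)
  show ?case
  proof (cases "\<forall>x y. (x, y) \<noteq> (0, 0) \<longrightarrow> (\<exists>i. hev (Suc k) (p i) x y \<noteq> 0)")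
    case True
    then show ?thesis
      using Suc.prems by (intro exI [of _ "Suc k"] exI [of _ p] exI [of _ "\<lambda>_ _. 1"]) auto
  next
    case False
    then obtain x0 y0 where xy: "(x0, y0) \<noteq> (0, 0)" "\<And>i. hev (Suc k) (p i) x0 y0 = 0"
      by blast
    have "\<exists>q. degree q \<le> k \<and> (\<forall>x y. hev (Suc k) (p i) x y = root_form x0 y0 x y * hev k q x y)" for i
      using hev_divide_root [OF Suc.prems(1) xy(2) xy(1)] .
    then obtain q where q: "\<And>i. degree (q i) \<le> k"
        "\<And>i x y. hev (Suc k) (p i) x y = root_form x0 y0 x y * hev k (q i) x y"
      by metis
    obtain i where i: "p i \<noteq> 0"
      using Suc.prems by blast
    have "q i \<noteq> 0"
    proof
      assume "q i = 0"
      then have "p i = 0"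
        using q(2) [of i] Suc.prems(1) by (intro hev_eqI [of _ "Suc k"]) auto
      then show False
        using i by simp
    qed
    then have "\<exists>i. q i \<noteq> 0" by blast
    from Suc.IH [of q, OF q(1) this] obtain e q' g where q': "\<forall>i. degree (q' i) \<le> e"
      "\<forall>x y. (x, y) \<noteq> (0, 0) \<longrightarrow> (\<exists>i. hev e (q' i) x y \<noteq> 0)"
      "\<forall>i x y. hev k (q i) x y = g x y * hev e (q' i) x y"
      by (elim exE conjE) (rule that)
    then have "\<forall>i x y. hev (Suc k) (p i) x y = (root_form x0 y0 x y * g x y) * hev e (q' i) x y"
      by (simp add: q(2) mult.assoc)
    then show ?thesis
      by (intro exI [of _ e] exI [of _ q'] exI [of _ "\<lambda>x y. root_form x0 y0 x y * g x y"] conjI)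
        (rule q'(1), rule q'(2), assumption)
  qed
qed

section \<open>Parametrizations of rational curves\<close>

definition curve_vec :: "nat \<Rightarrow> ('n \<Rightarrow> 'k::field poly) \<Rightarrow> 'k \<Rightarrow> 'k \<Rightarrow> 'k ^ 'n::finite"
  where "curve_vec e q x y = (\<chi> i. hev e (q i) x y)"

lemma rat_apply_point:
  fixes \<phi> :: "'m::finite \<Rightarrow> ('k::field, 'n::finite) mpoly"
  assumes \<phi>: "\<And>j. homogeneous k (\<phi> j)" and "u \<noteq> 0" and nz: "(\<chi> j. peval (\<phi> j) u) \<noteq> 0"
  shows "rat_apply \<phi> (point u) = point (\<chi> j. peval (\<phi> j) u)"
proof -
  let ?f = "\<lambda>x. \<chi> j. peval (\<phi> j) x"
  have "?f ` line (point u) \<subseteq> vec.span {?f u}"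
  proof
    fix w assume "w \<in> ?f ` line (point u)"
    then obtain c where "w = ?f (c *s u)"
      using \<open>u \<noteq> 0\<close> by (auto simp: line_point vec.span_singleton)
    then have "w = c ^ k *s ?f u"
      using form_fun_homogeneous [OF form_fun_peval [OF \<phi>]] by (simp add: vec_eq_iff)
    then show "w \<in> vec.span {?f u}" by (auto simp: vec.span_singleton)
  qed
  moreover have "?f u \<in> ?f ` line (point u)"
    using point_in_line [OF \<open>u \<noteq> 0\<close>] by blast
  ultimately have "vec.span (?f ` line (point u)) = vec.span {?f u}"
    by (intro equalityI vec.span_minimal vec.subspace_span vec.span_mono) auto
  then show ?thesis by (simp add: rat_apply_def point_def)
qed

lemma rat_defined_point:
  fixes \<phi> :: "'m::finite \<Rightarrow> ('k::field, 'n::finite) mpoly"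
  assumes "\<And>j. homogeneous k (\<phi> j)" "u \<noteq> 0"
  shows "rat_defined \<phi> (point u) \<longleftrightarrow> (\<chi> j. peval (\<phi> j) u) \<noteq> 0"
proof -
  have "vanishes_at (\<phi> j) (point u) \<longleftrightarrow> peval (\<phi> j) u = 0" for j
    using point_in_zero_set [OF form_fun_peval [OF assms(1)] assms(2)]
    by (simp add: zero_set_def vanishes_at_def)
  then show ?thesis by (simp add: rat_defined_def vec_eq_iff)
qed

definition pair_vec :: "'k::zero \<Rightarrow> 'k \<Rightarrow> 'k ^ 2"
  where "pair_vec x y = (\<chi> i. if i = 1 then x else y)"

lemma pair_vec_nth [simp]: "pair_vec x y $ 1 = x" "pair_vec x y $ 2 = y"
  by (simp_all add: pair_vec_def)

lemma pair_vec_eq_0_iff: "pair_vec x y = 0 \<longleftrightarrow> (x, y) = (0, 0)"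
  by (auto simp: vec_eq_iff forall_2)

lemma pair_vec_cases: obtains x y where "u = pair_vec x y"
  by (rule that [of "u $ 1" "u $ 2"]) (simp add: vec_eq_iff forall_2)

text \<open>Without base points the rational map from the line is defined everywhere. Its image
  stays in \<open>X\<close>: a form vanishing on \<open>X\<close> vanishes at all but finitely many
  parameters, hence identically along the map. Surjectivity and injectivity are inherited from
  birationality, hence only off the exceptional sets \<open>W\<close> and \<open>E\<close>.\<close>

lemma birational_parametrization:
  fixes X :: "('k::field_char_0, 'n::finite) proj set"
  assumes bir: "birational (UNIV :: ('k, 2) proj set) X" and cl: "zariski_closed X"
  obtains e q W E where
    "\<And>i. degree (q i) \<le> e"
    "\<And>x y. (x, y) \<noteq> (0, 0) \<Longrightarrow> curve_vec e q x y \<noteq> (0 :: 'k ^ 'n)"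
    "\<And>x y. (x, y) \<noteq> (0, 0) \<Longrightarrow> point (curve_vec e q x y) \<in> X"
    "zariski_closed W" "\<not> X \<subseteq> W"
    "\<And>P. P \<in> X - W \<Longrightarrow> \<exists>x y. (x, y) \<noteq> (0, 0) \<and> P = point (curve_vec e q x y)"
    "finite E"
    "\<And>s t. s \<notin> E \<Longrightarrow> t \<notin> E \<Longrightarrow> point (curve_vec e q s 1) = point (curve_vec e q t 1) \<Longrightarrow> s = t"
proof -
  obtain \<phi> :: "'n \<Rightarrow> ('k, 2) mpoly" and \<psi> :: "2 \<Rightarrow> ('k, 'n) mpoly" and k l Z W where
    \<phi>: "\<And>j. homogeneous k (\<phi> j)" and
    Z: "zariski_closed Z" "\<not> UNIV \<subseteq> Z" and W: "zariski_closed W" "\<not> X \<subseteq> W" and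
    P: "\<And>P. P \<notin> Z \<Longrightarrow> rat_defined \<phi> P \<and> rat_apply \<phi> P \<in> X - W \<and> rat_apply \<psi> (rat_apply \<phi> P) = P" and
    Q: "\<And>Q. Q \<in> X - W \<Longrightarrow> rat_apply \<psi> Q \<notin> Z \<and> rat_apply \<phi> (rat_apply \<psi> Q) = Q"
    using bir unfolding birational_def by blast
  have "\<exists>p. degree p \<le> k \<and> (\<forall>u. peval (\<phi> i) u = hev k p (u $ 1) (u $ 2))" for i
    using form_fun_binary [OF form_fun_peval [OF \<phi>]] .
  then obtain p where p: "\<And>i. degree (p i) \<le> k" "\<And>i u. peval (\<phi> i) u = hev k (p i) (u $ 1) (u $ 2)"
    by metis
  obtain P0 where "P0 \<notin> Z"
    using Z(2) by auto
  obtain u0 where u0: "u0 \<noteq> 0" "P0 = point u0"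
    by (rule point_cases)
  have "(\<chi> j. peval (\<phi> j) u0) \<noteq> 0"
    using P [OF \<open>P0 \<notin> Z\<close>] rat_defined_point [where \<phi> = \<phi>, OF \<phi> u0(1)] u0(2) by auto
  then obtain i where "hev k (p i) (u0 $ 1) (u0 $ 2) \<noteq> 0"
    by (auto simp: vec_eq_iff p(2))
  then have "p i \<noteq> 0" by auto
  then obtain e q g where q: "\<And>i. degree (q i) \<le> e"
      "\<And>x y. (x, y) \<noteq> (0, 0) \<Longrightarrow> \<exists>i. hev e (q i) x y \<noteq> 0"
      "\<And>i x y. hev k (p i) x y = g x y * hev e (q i) x y"
    using base_points_remove [of p k] p(1) by metis
  define v where "v = curve_vec e q"
  have v: "v x y \<noteq> 0" if "(x, y) \<noteq> (0, 0)" for x y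
    using q(2) [OF that] by (auto simp: v_def curve_vec_def vec_eq_iff)
  have \<phi>v: "rat_apply \<phi> (point (pair_vec x y)) = point (v x y)"
    if xy: "(x, y) \<noteq> (0, 0)" and nZ: "point (pair_vec x y) \<notin> Z" for x y
  proof -
    have u: "pair_vec x y \<noteq> 0"
      using xy by (simp add: pair_vec_eq_0_iff)
    have eq: "(\<chi> j. peval (\<phi> j) (pair_vec x y)) = g x y *s v x y"
      by (simp add: vec_eq_iff p(2) q(3) v_def curve_vec_def)
    have "(\<chi> j. peval (\<phi> j) (pair_vec x y)) \<noteq> 0"
      using P [OF nZ] rat_defined_point [where \<phi> = \<phi>, OF \<phi> u] by auto
    moreover from this have "g x y \<noteq> 0"
      unfolding eq by auto
    ultimately show ?thesis
      using rat_apply_point [where \<phi> = \<phi>, OF \<phi> u] point_scale [OF _ v [OF xy]] unfolding eq by simp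
  qed
  define E where "E = {t. point (pair_vec t 1) \<in> Z}"
  have "finite E"
  proof -
    obtain m f where f: "form_fun m f" "Z \<subseteq> zero_set f" "P0 \<notin> zero_set f"
      using zariski_closed_separate Z(1) \<open>P0 \<notin> Z\<close> by blast
    obtain r where r: "degree r \<le> m" "\<And>u. f u = hev m r (u $ 1) (u $ 2)"
      using form_fun_binary [OF f(1)] by blast
    have "f u0 \<noteq> 0"
      using f(3) u0 point_in_zero_set [OF f(1)] by auto
    then have "r \<noteq> 0" by (auto simp: r(2))
    moreover have "E \<subseteq> {t. poly r t = 0}"
    proof
      fix t assume "t \<in> E"
      then have "f (pair_vec t 1) = 0"
        using f(2) point_in_zero_set [OF f(1), of "pair_vec t 1"] by (auto simp: E_def pair_vec_eq_0_iff)
      then show "t \<in> {t. poly r t = 0}"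
        using r by (simp add: hev_affine)
    qed
    ultimately show ?thesis
      using poly_roots_finite finite_subset by blast
  qed
  have vX: "point (v t 1) \<in> X - W" if "t \<notin> E" for t
    using \<phi>v [of t 1] P [of "point (pair_vec t 1)"] that by (auto simp: E_def)
  show thesis
  proof (rule that [of q e W E])
    show "point (curve_vec e q x y) \<in> X" if xy: "(x, y) \<noteq> (0, 0)" for x y
    proof (rule ccontr)
      assume "point (curve_vec e q x y) \<notin> X"
      then obtain m f where f: "form_fun m f" "X \<subseteq> zero_set f" "point (v x y) \<notin> zero_set f"
        using zariski_closed_separate [OF cl] by (metis v_def)
      obtain r where r: "degree r \<le> m * e" "\<And>x y. f (v x y) = hev (m * e) r x y"
        using form_fun_hev_comp [where q = q, OF f(1) q(1)] unfolding v_def curve_vec_def by blast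
      have "poly r t = 0" if "t \<notin> E" for t
      proof -
        have "f (v t 1) = 0"
          using f(2) vX [OF that] point_in_zero_set [OF f(1) v, of t 1] by auto
        then show ?thesis
          using r by (simp add: hev_affine)
      qed
      then have "UNIV \<subseteq> E \<union> {t. poly r t = 0}" by blast
      then have "r = 0"
        using \<open>finite E\<close> poly_roots_finite infinite_UNIV_char_0 [where ?'a = 'k] finite_subset
        by (metis finite_Un)
      then have "f (v x y) = 0" by (simp add: r(2))
      then show False
        using f(3) point_in_zero_set [OF f(1) v [OF xy]] by simp
    qed
    show "\<exists>x y. (x, y) \<noteq> (0, 0) \<and> P = point (curve_vec e q x y)" if PX: "P \<in> X - W" for P
    proof -
      obtain u where u: "u \<noteq> 0" "rat_apply \<psi> P = point u"
        by (rule point_cases)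
      obtain x y where xy: "u = pair_vec x y"
        by (rule pair_vec_cases)
      have "(x, y) \<noteq> (0, 0)"
        using u(1) by (simp add: xy pair_vec_eq_0_iff)
      moreover have "P = point (v x y)"
        using Q [OF PX] \<phi>v [OF calculation] u(2) xy by simp
      ultimately show ?thesis
        unfolding v_def by blast
    qed
    show "s = t" if st: "s \<notin> E" "t \<notin> E" "point (curve_vec e q s 1) = point (curve_vec e q t 1)" for s t
    proof -
      have "rat_apply \<phi> (point (pair_vec s 1)) = rat_apply \<phi> (point (pair_vec t 1))"
        using \<phi>v [of s 1] \<phi>v [of t 1] st by (simp add: E_def v_def)
      then have "point (pair_vec s 1) = point (pair_vec t 1)"
        using P [of "point (pair_vec s 1)"] P [of "point (pair_vec t 1)"] st(1,2) by (metis E_def mem_Collect_eq)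
      then obtain c where "pair_vec s 1 = c *s pair_vec t 1"
        by (subst (asm) point_eq_iff) (auto simp: pair_vec_eq_0_iff)
      then show "s = t" by (auto simp: vec_eq_iff forall_2)
    qed
  qed (use q(1) v W \<open>finite E\<close> in \<open>simp_all add: v_def\<close>)
qed

lemma poly_card_roots:
  fixes p :: "'k::{alg_closed_field, field_char_0} poly"
  assumes "p \<noteq> 0" "\<And>t. poly p t = 0 \<Longrightarrow> poly (pderiv p) t \<noteq> 0"
  shows "card {t. poly p t = 0} = degree p"
proof -
  obtain A where A: "size A = degree p" "p = smult (lead_coeff p) (\<Prod>x\<in>#A. [:- x, 1:])"
    using alg_closed_imp_factorization [OF assms(1)] by blast
  have sq: "rsquarefree p"
    using assms(2) by (auto simp: rsquarefree_roots)
  have root: "poly p t = 0 \<longleftrightarrow> t \<in># A" for t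
    by (subst A(2)) (use assms(1) in \<open>auto simp: poly_prod_mset prod_mset_zero_iff\<close>)
  have "count A t \<le> 1" for t
  proof (rule ccontr)
    assume "\<not> count A t \<le> 1"
    then have "{#t, t#} \<subseteq># A" by (simp add: subseteq_mset_def)
    then obtain B where B: "A = add_mset t (add_mset t B)"
      by (metis add_mset_add_single mset_subset_eq_exists_conv union_mset_add_mset_left add.commute union_commute empty_neutral(2) add_mset_commute)
    define r where "r = smult (lead_coeff p) (\<Prod>x\<in>#B. [:- x, 1:])"
    have p: "p = [:- t, 1:] ^ 2 * r"
      by (subst A(2)) (simp only: B r_def image_mset_add_mset prod_mset.add_mset power2_eq_square
          mult_smult_right mult.assoc)
    have L0: "poly [:- t, 1:] t = 0" by simp
    have "poly p t = 0" "poly (pderiv p) t = 0"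
      unfolding p power2_eq_square
      by (simp_all only: pderiv_mult poly_mult poly_add L0 mult_zero_left mult_zero_right add_0_left)
    then show False
      using assms(2) by blast
  qed
  then have "A = mset_set {t. poly p t = 0}"
  proof -
    have "finite {t. poly p t = 0}"
      using assms(1) poly_roots_finite by blast
    then show ?thesis
      using \<open>\<And>t. count A t \<le> 1\<close> root
      by (intro multiset_eqI) (metis (mono_tags, lifting) count_greater_eq_one_iff count_mset_set(1,3)
          le_antisym mem_Collect_eq not_in_iff)
  qed
  then show ?thesis
    using A(1) by (metis size_mset_set)
qed

section \<open>General hyperplane sections of a parametrized curve\<close>

lemma form_fun_line_finite_zeros_at_0:
  fixes f :: "'k::field ^ 'n::finite \<Rightarrow> 'k"
  assumes "form_fun k f" "f x \<noteq> 0"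
  shows "finite {t. f (x + t *s y) = 0}"
  using form_fun_line_finite_zeros [OF assms(1), of x 0 y] assms(2) by simp

text \<open>The pullback of the linear functional \<open>a\<close> to the parameter line; its roots
  are the affine parameters of a hyperplane section.\<close>

definition dual_poly :: "('n \<Rightarrow> 'k::field poly) \<Rightarrow> 'k ^ 'n::finite \<Rightarrow> 'k poly"
  where "dual_poly q a = (\<Sum>i\<in>UNIV. smult (a $ i) (q i))"

lemma degree_dual_poly: "(\<And>i. degree (q i) \<le> e) \<Longrightarrow> degree (dual_poly q a) \<le> e"
  unfolding dual_poly_def by (intro degree_sum_le) (auto intro: order_trans [OF degree_smult_le])

lemma hev_dual_poly: "hev e (dual_poly q a) x y = (\<Sum>i\<in>UNIV. a $ i * curve_vec e q x y $ i)"
  by (simp add: dual_poly_def hev_sum hev_smult curve_vec_def)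

lemma coeff_dual_poly: "coeff (dual_poly q a) k = (\<Sum>i\<in>UNIV. a $ i * coeff (q i) k)"
  by (simp add: dual_poly_def coeff_sum)

lemma dual_poly_add: "dual_poly q (a + b) = dual_poly q a + dual_poly q b"
  by (simp add: dual_poly_def smult_add_left sum.distrib)

lemma dual_poly_scale: "dual_poly q (c *s a) = smult c (dual_poly q a)"
  by (simp add: poly_eq_iff coeff_dual_poly sum_distrib_left mult.assoc)

lemma form_fun_dual: "form_fun 1 (\<lambda>a :: 'k::field ^ 'n::finite. \<Sum>i\<in>UNIV. a $ i * w $ i)"
proof -
  have "form_fun 1 (\<lambda>a :: 'k ^ 'n. \<Sum>i\<in>UNIV. w $ i * a $ i)"
    by (rule form_fun_linear)
  then show ?thesis by (simp only: mult.commute)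
qed

lemma dual_nonzero:
  assumes "w \<noteq> (0 :: 'k::field ^ 'n::finite)"
  shows "\<exists>a. (\<Sum>i\<in>UNIV. a $ i * w $ i) \<noteq> 0"
proof -
  obtain i where "w $ i \<noteq> 0"
    using assms by (auto simp: vec_eq_iff)
  moreover have "(\<Sum>j\<in>UNIV. axis i 1 $ j * w $ j) = w $ i"
    by (simp add: axis_def if_distrib [of "\<lambda>c. c * _"] cong: if_cong)
  ultimately show ?thesis by metis
qed

text \<open>A general pencil \<open>p + s r\<close> of hyperplane sections has a member with \<open>e\<close> distinct zeros: a
  double zero of a member is a zero of the Wronskian of \<open>p\<close> and \<open>r\<close>.\<close>

lemma generic_hyperplane_section:
  fixes q :: "'n::finite \<Rightarrow> 'k::{alg_closed_field, field_char_0} poly"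
  assumes deg: "\<And>i. degree (q i) \<le> e"
    and v: "\<And>x y. (x, y) \<noteq> (0, 0) \<Longrightarrow> curve_vec e q x y \<noteq> 0"
    and E: "finite E" and G: "form_fun m G" "G a0 \<noteq> 0" and "0 < e"
  obtains a where "G a \<noteq> 0" "a \<noteq> 0" "card {t. poly (dual_poly q a) t = 0} = e"
    "{t. poly (dual_poly q a) t = 0} \<inter> E = {}"
proof -
  let ?l = "\<lambda>w a :: 'k ^ 'n. \<Sum>i\<in>UNIV. a $ i * w $ i"
  have ev: "poly (dual_poly q a) t = ?l (curve_vec e q t 1) a" for a t
    using hev_dual_poly [of e q a t 1] degree_dual_poly [of q e a] deg by (simp add: hev_affine)
  have top: "coeff (dual_poly q a) e = ?l (curve_vec e q 1 0) a" for a
    using hev_dual_poly [of e q a 1 0] by (simp add: hev_infinity)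
  \<comment> \<open>Non-vanishing at the parameter (1 : 0) means a non-zero leading coefficient, so
    that all \<open>e\<close> zeros are affine.\<close>
  obtain a1 where a1: "?l (curve_vec e q 1 0) a1 \<noteq> 0"
    using dual_nonzero v [of 1 0] by auto
  obtain a where a: "G a \<noteq> 0" "?l (curve_vec e q 1 0) a \<noteq> 0"
    using form_fun_common_nonzero [OF G(1) form_fun_dual G(2) a1] by blast
  define p where "p = dual_poly q a"
  have p: "degree p = e" "p \<noteq> 0"
  proof -
    have "coeff p e \<noteq> 0"
      using a(2) by (simp add: p_def top)
    then show "degree p = e" "p \<noteq> 0"
      using degree_dual_poly [of q e a] deg le_degree [of p e] by (auto simp: p_def)
  qed
  define T where "T = {t. poly p t = 0}"
  have "finite T"
    unfolding T_def by (rule poly_roots_finite [OF p(2)])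
  moreover have "\<exists>b. ?l (curve_vec e q t 1) b \<noteq> 0" if "t \<in> T" for t
    using dual_nonzero v [of t 1] by auto
  ultimately obtain b where b: "\<forall>t\<in>T. ?l (curve_vec e q t 1) b \<noteq> 0"
    using form_fun_prod_nonzero [of T "\<lambda>_. 1" "\<lambda>t. ?l (curve_vec e q t 1)"] form_fun_dual by blast
  define r where "r = dual_poly q b"
  have cop: "poly r t \<noteq> 0" if "poly p t = 0" for t
    using b that by (simp add: r_def ev T_def)
  define w where "w = p * pderiv r - pderiv p * r"
  \<comment> \<open>At a root of \<open>p\<close>, where \<open>r\<close> does not vanish, the order
    of \<open>pderiv p * r\<close> is one less than that of \<open>p\<close>, but
    \<open>p * pderiv r\<close> has at least the order of \<open>p\<close>.\<close>
  have "w \<noteq> 0"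
  proof
    assume "w = 0"
    then have eq: "p * pderiv r = pderiv p * r" by (simp add: w_def)
    obtain t where t: "poly p t = 0"
      using alg_closed_imp_poly_has_root p(1) \<open>0 < e\<close> by blast
    have dp: "pderiv p \<noteq> 0"
      using p(1) \<open>0 < e\<close> by (simp add: pderiv_eq_0_iff)
    have rne: "r \<noteq> 0"
      using cop [OF t] by auto
    have ord: "order t p = Suc (order t (pderiv p))"
      using order_pderiv [of p t] dp t p(2) by (simp add: order_root)
    have "order t r = 0"
      using cop [OF t] by (simp add: order_0I)
    then have "order t (pderiv p * r) = order t (pderiv p)"
      using dp rne by (simp add: order_mult)
    moreover have "p * pderiv r \<noteq> 0"
      using eq dp rne by simp
    then have "order t (p * pderiv r) \<ge> order t p" by (simp add: order_mult)
    ultimately show False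
      using eq ord by simp
  qed
  \<comment> \<open>Excluded are the members of the pencil where \<open>G\<close> vanishes, where a
    zero escapes to infinity, or where a zero lies in \<open>E\<close> or is double.\<close>
  define bad where "bad = {s. G (a + s *s b) = 0} \<union> {s. coeff p e + s * coeff r e = 0} \<union>
    (\<lambda>t. - poly p t / poly r t) ` (E \<union> {t. poly w t = 0})"
  have "finite bad"
  proof -
    have "finite {s. G (a + s *s b) = 0}"
      by (rule form_fun_line_finite_zeros_at_0 [OF G(1) a(1)])
    moreover have "{s. coeff p e + s * coeff r e = 0} \<subseteq> {- coeff p e / coeff r e}"
    proof
      fix s assume s: "s \<in> {s. coeff p e + s * coeff r e = 0}"
      moreover have "coeff p e \<noteq> 0"
        using a(2) by (simp add: p_def top)
      ultimately have "coeff r e \<noteq> 0" by auto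
      then show "s \<in> {- coeff p e / coeff r e}"
        using s by (simp add: field_simps eq_neg_iff_add_eq_0)
    qed
    ultimately show ?thesis
      unfolding bad_def using E poly_roots_finite [OF \<open>w \<noteq> 0\<close>] finite_subset by blast
  qed
  then obtain s where s: "s \<notin> bad"
    using infinite_UNIV_char_0 [where ?'a = 'k] by (metis ex_new_if_finite)
  define c where "c = a + s *s b"
  define f where "f = dual_poly q c"
  have f: "f = p + smult s r"
    by (simp add: f_def c_def dual_poly_add dual_poly_scale p_def r_def)
  have root: "s = - poly p t / poly r t" if "poly f t = 0" for t
  proof -
    have z: "poly p t + s * poly r t = 0"
      using that by (simp add: f)
    then have "poly r t \<noteq> 0"
      using cop [of t] by auto
    then show ?thesis
      using z by (simp add: field_simps eq_neg_iff_add_eq_0)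
  qed
  have "coeff f e \<noteq> 0"
    using s by (simp add: f bad_def)
  then have degf: "degree f = e" "f \<noteq> 0"
    using degree_dual_poly [of q e c] deg le_degree [of f e] by (auto simp: f_def)
  have "poly (pderiv f) t \<noteq> 0" if t: "poly f t = 0" for t
  proof
    assume "poly (pderiv f) t = 0"
    then have d: "poly (pderiv p) t = - s * poly (pderiv r) t"
      by (simp add: f pderiv_add pderiv_smult eq_neg_iff_add_eq_0)
    have "poly p t = - s * poly r t"
      using t by (simp add: f eq_neg_iff_add_eq_0)
    then have "poly w t = 0" by (simp add: w_def d)
    then show False
      using s root [OF t] by (auto simp: bad_def)
  qed
  then have card: "card {t. poly f t = 0} = e"
    using poly_card_roots [OF degf(2)] degf(1) by blast
  have "{t. poly f t = 0} \<inter> E = {}"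
    using s root by (auto simp: bad_def)
  moreover have "G c \<noteq> 0"
    using s by (simp add: bad_def c_def)
  moreover have "c \<noteq> 0"
    using degf(2) by (auto simp: f_def dual_poly_def)
  ultimately show thesis
    using that card by (simp add: f_def)
qed

section \<open>Coordinates adapted to a rational normal curve\<close>

definition coord :: "(nat \<Rightarrow> 'k::field ^ 'n::finite) \<Rightarrow> nat \<Rightarrow> 'k ^ 'n \<Rightarrow> 'k"
  where "coord b k x = (\<Sum>i\<in>UNIV. b k $ i * x $ i)"

lemma coord_add: "coord b k (x + y) = coord b k x + coord b k y"
  and coord_diff: "coord b k (x - y) = coord b k x - coord b k y"
  and coord_scale: "coord b k (c *s x) = c * coord b k x"
  and coord_0: "coord b k 0 = 0"
  by (simp_all add: coord_def sum.distrib sum_subtractf sum_distrib_left algebra_simps)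

lemma coord_sum: "coord b k (\<Sum>i\<in>A. f i) = (\<Sum>i\<in>A. coord b k (f i))"
  by (induction A rule: infinite_finite_induct) (auto simp: coord_add coord_0)

lemma form_fun_coord_functional: "form_fun 1 (coord b k)"
  unfolding coord_def [abs_def] by (rule form_fun_linear)

text \<open>If \<open>a 0\<close> is not zero, the minors make the sequence geometric. Otherwise the
  square of each entry before the last is a multiple of the preceding entry, so that only
  \<open>a d\<close> survives: the point at infinity.\<close>

lemma hankel_minors_imp_veronese:
  fixes a :: "nat \<Rightarrow> 'k::field"
  assumes minors: "\<And>i j. i < d \<Longrightarrow> j < d \<Longrightarrow> a i * a (Suc j) = a (Suc i) * a j"
  shows "\<exists>c x y. \<forall>k\<le>d. a k = c * x ^ k * y ^ (d - k)"
proof (cases "a 0 = 0")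
  case False
  have "a k = a 0 * (a 1 / a 0) ^ k" if "k \<le> d" for k
    using that
  proof (induction k)
    case (Suc k)
    then have "a 0 * a (Suc k) = a 1 * a k"
      using minors [of 0 k] by simp
    then have "a (Suc k) = a k * (a 1 / a 0)"
      using False by (simp add: nonzero_eq_divide_eq mult.commute)
    moreover have "k \<le> d"
      using Suc.prems by (rule Suc_leD)
    ultimately show ?case
      using Suc.IH by (metis mult.assoc power_Suc2)
  qed simp
  then have "\<forall>k\<le>d. a k = a 0 * (a 1 / a 0) ^ k * 1 ^ (d - k)"
    unfolding power_one mult_1_right by blast
  then show ?thesis by blast
next
  case True
  have 0: "a k = 0" if "k < d" for k
    using that
  proof (induction k)
    case (Suc k)
    then show ?case
      using minors [of "Suc k" k] by simp
  qed (simp add: True)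
  have "a k = a d * 1 ^ k * 0 ^ (d - k)" if "k \<le> d" for k
    using that 0 [of k] by (cases "k = d") auto
  then show ?thesis by blast
qed

lemma veronese_minor:
  fixes s t :: "'k::field"
  assumes "i < d" "j < d"
  shows "s ^ i * t ^ (d - i) * (s ^ Suc j * t ^ (d - Suc j)) =
    s ^ Suc i * t ^ (d - Suc i) * (s ^ j * t ^ (d - j))"
proof -
  have "i + Suc j = Suc i + j" "(d - i) + (d - Suc j) = (d - Suc i) + (d - j)"
    using assms by auto
  then have "s ^ (i + Suc j) * t ^ ((d - i) + (d - Suc j)) = s ^ (Suc i + j) * t ^ ((d - Suc i) + (d - j))"
    by (simp only:)
  then show ?thesis by (simp only: power_add mult_ac)
qed

lemma point_in_hyperplane:
  fixes a w :: "'k::field ^ 'n::finite"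
  assumes "a \<noteq> 0" "w \<noteq> 0" "(\<Sum>i\<in>UNIV. a $ i * w $ i) = 0"
  shows "point w \<in> hyperplane (point a)"
proof -
  have "(\<Sum>i\<in>UNIV. (s *s a) $ i * (t *s w) $ i) = (s * t) * (\<Sum>i\<in>UNIV. a $ i * w $ i)" for s t
    by (simp add: sum_distrib_left mult_ac)
  then show ?thesis
    using assms by (auto simp: hyperplane_def line_point vec.span_singleton)
qed

lemma linear_span_UNIV_imp_not_in_hyperplane:
  fixes X :: "('k::field, 'n::finite) proj set"
  assumes "linear_span X = UNIV" "a \<noteq> 0"
  shows "\<not> X \<subseteq> zero_set (\<lambda>x. \<Sum>i\<in>UNIV. a $ i * x $ i)"
proof
  let ?H = "{x. (\<Sum>i\<in>UNIV. a $ i * x $ i) = 0}"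
  assume "X \<subseteq> zero_set (\<lambda>x. \<Sum>i\<in>UNIV. a $ i * x $ i)"
  then have "(\<Union>Q\<in>X. line Q) \<subseteq> ?H" by (auto simp: zero_set_def)
  moreover have "vec.subspace ?H"
    unfolding vec.subspace_def
    by (auto simp: sum.distrib distrib_left mult.left_commute simp flip: sum_distrib_left)
  ultimately have span: "vec.span (\<Union>Q\<in>X. line Q) \<subseteq> ?H"
    by (rule vec.span_minimal)
  have H: "x \<in> ?H" for x
  proof (cases "x = 0")
    case False
    have "point x \<in> linear_span X"
      using assms(1) by simp
    then have "line (point x) \<subseteq> vec.span (\<Union>Q\<in>X. line Q)"
      by (simp add: linear_span_def)
    then show ?thesis
      using span point_in_line [OF False] by blast
  qed simp
  obtain x where "(\<Sum>i\<in>UNIV. x $ i * a $ i) \<noteq> 0"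
    using dual_nonzero [OF assms(2)] by blast
  then show False
    using H [of x] by (simp add: mult.commute)
qed

text \<open>Otherwise the curve would lie in a hyperplane off \<open>W\<close>, hence entirely by
  irreducibility, against the spanning condition. So the coordinate forms are linearly independent,
  which bounds \<open>e\<close> from below.\<close>

lemma parametrization_independent:
  fixes X :: "('k::field_char_0, 'n::finite) proj set"
  assumes X: "irreducible_closed X" "linear_span X = UNIV"
    and W: "zariski_closed W" "\<not> X \<subseteq> W"
    and cover: "\<And>P. P \<in> X - W \<Longrightarrow> \<exists>x y. (x, y) \<noteq> (0, 0) \<and> P = point (curve_vec e q x y)"
    and v: "\<And>x y. (x, y) \<noteq> (0, 0) \<Longrightarrow> curve_vec e q x y \<noteq> (0 :: 'k ^ 'n)"
    and "dual_poly q a = 0"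
  shows "a = 0"
proof (rule ccontr)
  assume "a \<noteq> 0"
  let ?f = "\<lambda>x :: 'k ^ 'n. \<Sum>i\<in>UNIV. a $ i * x $ i"
  have "X \<subseteq> W \<union> zero_set ?f"
  proof
    fix P assume "P \<in> X"
    show "P \<in> W \<union> zero_set ?f"
    proof (cases "P \<in> W")
      case False
      then obtain x y where xy: "(x, y) \<noteq> (0, 0)" "P = point (curve_vec e q x y)"
        using cover \<open>P \<in> X\<close> by blast
      have "?f (curve_vec e q x y) = 0"
        using hev_dual_poly [of e q a x y] assms(7) by simp
      then show ?thesis
        using point_in_zero_set [OF form_fun_linear v [OF xy(1)]] xy(2) by simp
    qed simp
  qed
  then have "X \<subseteq> zero_set ?f"
    using irreducible_closed_cover [OF X(1) W(1) zariski_closed_zero_set [OF form_fun_linear]] W(2)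
    by blast
  then show False
    using linear_span_UNIV_imp_not_in_hyperplane [OF X(2) \<open>a \<noteq> 0\<close>] by blast
qed

text \<open>The \<open>e\<close> parameters of a general hyperplane section avoid \<open>E\<close>,
  so they give distinct points among the \<open>d\<close> points of the section.\<close>

lemma parametrization_degree_le:
  fixes X :: "('k::{alg_closed_field, field_char_0}, 'n::finite) proj set"
  assumes deg: "\<And>i. degree (q i) \<le> e"
    and v: "\<And>x y. (x, y) \<noteq> (0, 0) \<Longrightarrow> curve_vec e q x y \<noteq> (0 :: 'k ^ 'n)"
    and vX: "\<And>x y. (x, y) \<noteq> (0, 0) \<Longrightarrow> point (curve_vec e q x y) \<in> X"
    and E: "finite E" and inj: "\<And>s t. s \<notin> E \<Longrightarrow> t \<notin> E \<Longrightarrow>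
      point (curve_vec e q s 1) = point (curve_vec e q t 1) \<Longrightarrow> s = t"
    and cd: "curve_degree X d"
  shows "e \<le> d"
proof (cases "e = 0")
  case False
  obtain B :: "('k, 'n) proj set" where B: "zariski_closed B" "B \<noteq> UNIV"
    "\<And>H. H \<notin> B \<Longrightarrow> finite (X \<inter> hyperplane H) \<and> card (X \<inter> hyperplane H) = d"
    using cd unfolding curve_degree_def by blast
  obtain P0 where P0: "P0 \<notin> B"
    using B(2) by auto
  obtain m G where G: "form_fun m G" "B \<subseteq> zero_set G" "P0 \<notin> zero_set G"
    using zariski_closed_separate [OF B(1) P0] by blast
  obtain a0 where a0: "G a0 \<noteq> 0"
    using G(3) by (auto simp: zero_set_def)
  obtain a where a: "G a \<noteq> 0" "a \<noteq> 0" "card {t. poly (dual_poly q a) t = 0} = e"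
      "{t. poly (dual_poly q a) t = 0} \<inter> E = {}"
    using generic_hyperplane_section [OF deg v E G(1) a0] False by blast
  let ?T = "{t. poly (dual_poly q a) t = 0}"
  have "point a \<notin> B"
    using a(1,2) G(1,2) point_in_zero_set by blast
  then have H: "finite (X \<inter> hyperplane (point a))" "card (X \<inter> hyperplane (point a)) = d"
    using B(3) by auto
  have "inj_on (\<lambda>t. point (curve_vec e q t 1)) ?T"
    using inj a(4) by (intro inj_onI) blast
  moreover have "(\<lambda>t. point (curve_vec e q t 1)) ` ?T \<subseteq> X \<inter> hyperplane (point a)"
  proof safe
    fix t assume "poly (dual_poly q a) t = 0"
    then have "(\<Sum>i\<in>UNIV. a $ i * curve_vec e q t 1 $ i) = 0"
      using hev_dual_poly [of e q a t 1] hev_affine degree_dual_poly [of q e a] deg by metis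
    then show "point (curve_vec e q t 1) \<in> hyperplane (point a)"
      using a(2) v [of t 1] by (intro point_in_hyperplane) auto
  qed (use vX in auto)
  ultimately show ?thesis
    using card_inj_on_le H a(3) by metis
qed simp

text \<open>Because \<open>e\<close> is at most \<open>d\<close>, the coefficients of the
  \<open>d + 1\<close> coordinate forms make up a square matrix \<open>M\<close>, invertible by
  independence. Its inverse changes the coordinate forms into the monomials of degree
  \<open>d\<close>.\<close>

theorem rational_normal_curve_coordinates:
  fixes X :: "('k::{alg_closed_field, field_char_0}, 'n::finite) proj set"
  assumes rnc: "rational_normal_curve d X" and "1 \<le> d"
  obtains b :: "nat \<Rightarrow> 'k ^ 'n" where
    "\<And>x. (\<And>k. k \<le> d \<Longrightarrow> coord b k x = 0) \<Longrightarrow> x = 0"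
    "\<And>c. \<exists>x. \<forall>k\<le>d. coord b k x = c k"
    "\<And>x. x \<noteq> 0 \<Longrightarrow> point x \<in> X \<longleftrightarrow> (\<exists>c s t. \<forall>k\<le>d. coord b k x = c * s ^ k * t ^ (d - k))"
proof -
  have card: "CARD('n) = d + 1" and irr: "irreducible_closed X"
    and bir: "birational (UNIV :: ('k, 2) proj set) X" and cd: "curve_degree X d"
    and span: "linear_span X = UNIV"
    using rnc by (auto simp: rational_normal_curve_def rational_curve_def)
  have cl: "zariski_closed X"
    using irr by (simp add: irreducible_closed_def)
  obtain e and q :: "'n \<Rightarrow> 'k poly" and W E where
    deg: "\<And>i. degree (q i) \<le> e" and
    v: "\<And>x y. (x, y) \<noteq> (0, 0) \<Longrightarrow> curve_vec e q x y \<noteq> (0 :: 'k ^ 'n)" and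
    vX: "\<And>x y. (x, y) \<noteq> (0, 0) \<Longrightarrow> point (curve_vec e q x y) \<in> X" and
    W: "zariski_closed W" "\<not> X \<subseteq> W" and
    cover: "\<And>P. P \<in> X - W \<Longrightarrow> \<exists>x y. (x, y) \<noteq> (0, 0) \<and> P = point (curve_vec e q x y)" and
    E: "finite E" "\<And>s t. s \<notin> E \<Longrightarrow> t \<notin> E \<Longrightarrow> point (curve_vec e q s 1) = point (curve_vec e q t 1) \<Longrightarrow> s = t"
    by (rule birational_parametrization [OF bir cl]) blast
  have ind: "a = 0" if "dual_poly q a = 0" for a
    using parametrization_independent [OF irr span W cover v that] .
  have "e \<le> d" by (rule parametrization_degree_le [OF deg v vX E cd])
  obtain h :: "'n \<Rightarrow> nat" where h: "bij_betw h UNIV {..d}"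
    using finite_same_card_bij [of "UNIV :: 'n set" "{..d}"] card by auto
  define M :: "'k ^ 'n ^ 'n" where "M = (\<chi> i j. coeff (q j) (h i))"
  have M: "(M *v a) $ i = coeff (dual_poly q a) (h i)" for a i
    by (simp add: M_def matrix_vector_mult_def coeff_dual_poly mult.commute)
  have hk: "\<exists>i. h i = k" if "k \<le> d" for k
    using h that by (metis atMost_iff bij_betw_iff_bijections)
  have hle: "h i \<le> d" for i
    using h by (metis UNIV_I atMost_iff bij_betwE)
  have hinj: "h i = h j \<longleftrightarrow> i = j" for i j
    using h by (metis UNIV_I bij_betw_iff_bijections)
  have dz: "dual_poly q a = p" if "\<And>i. (M *v a) $ i = coeff p (h i)" "degree p \<le> d" for a p
  proof (rule poly_eqI)
    fix k
    show "coeff (dual_poly q a) k = coeff p k"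
    proof (cases "k \<le> d")
      case True
      then show ?thesis
        using hk [OF True] that(1) M by metis
    next
      case False
      then show ?thesis
        using degree_dual_poly [of q e a] deg \<open>e \<le> d\<close> that(2) by (simp add: coeff_eq_0)
    qed
  qed
  have "M *v a = 0 \<Longrightarrow> a = 0" for a
    using dz [of a 0] ind by simp
  then have "inj ((*v) M)" by (subst vec.linear_inj_iff_eq_0) auto
  then obtain N where N: "N ** M = mat 1"
    using matrix_left_invertible_injective by blast
  then have N': "M ** N = mat 1"
    using matrix_left_right_inverse by blast
  \<comment> \<open>For \<open>e < d\<close> the coefficient with index \<open>d\<close> would
    vanish in the whole image of \<open>M\<close>, although \<open>M\<close> is onto.\<close>
  have "e = d"
  proof (rule ccontr)
    assume "e \<noteq> d"
    obtain i where i: "h i = d"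
      using hk by blast
    have "(M *v (N *v axis i 1)) $ i = 0"
      unfolding M i using degree_dual_poly [of q e] deg \<open>e \<le> d\<close> \<open>e \<noteq> d\<close>
      by (metis coeff_eq_0 le_neq_implies_less le_less_trans)
    then show False by (simp add: matrix_vector_mul_assoc N' axis_def)
  qed
  \<comment> \<open>Columns of the inverse of \<open>M\<close>: the functional \<open>b k\<close>
    pulls back to the monomial with exponent \<open>k\<close>.\<close>
  define b where "b = (\<lambda>k. N *v axis (inv_into UNIV h k) 1)"
  have bN: "b (h j) $ i = N $ i $ j" for i j
  proof -
    have "inv_into UNIV h (h j) = j"
      using h by (simp add: bij_betw_def)
    then show ?thesis
      by (simp add: b_def matrix_vector_mult_def axis_def if_distrib [of "\<lambda>c. _ * c"] cong: if_cong)
  qed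
  have mono: "dual_poly q (b k) = monom 1 k" if kd: "k \<le> d" for k
  proof (rule dz)
    fix i
    obtain j where j: "h j = k"
      using hk [OF kd] by blast
    then have "M *v b k = axis j 1"
      using h by (auto simp: b_def matrix_vector_mul_assoc N' bij_betw_def)
    then show "(M *v b k) $ i = coeff (monom 1 k) (h i)"
      using hinj j by (auto simp: axis_def)
  qed (use kd in \<open>simp add: degree_monom_eq\<close>)
  have bv: "coord b k (curve_vec e q x y) = x ^ k * y ^ (d - k)" if "k \<le> d" for k x y
    using hev_dual_poly [of d q "b k" x y] that \<open>e = d\<close> by (simp add: coord_def mono hev_monom)
  have bN': "coord b (h j) x = (transpose N *v x) $ j" for j x
    by (simp add: coord_def bN matrix_vector_mult_def transpose_def)
  have T1: "transpose M ** transpose N = mat 1" "transpose N ** transpose M = mat 1"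
    by (simp_all flip: matrix_transpose_mul add: N N' transpose_mat)
  have inj: "x = 0" if "\<And>k. k \<le> d \<Longrightarrow> coord b k x = 0" for x
  proof -
    have "transpose N *v x = 0"
      unfolding vec_eq_iff bN' [symmetric] using that hle by simp
    then have "(transpose M ** transpose N) *v x = 0"
      unfolding matrix_vector_mul_assoc [symmetric] by simp
    then show ?thesis
      unfolding T1 by simp
  qed
  show thesis
  proof (rule that [of b])
    show "\<exists>x. \<forall>k\<le>d. coord b k x = c k" for c
    proof (intro exI allI impI)
      fix k assume "k \<le> d"
      then obtain j where j: "h j = k"
        using hk by blast
      show "coord b k (transpose M *v (\<chi> j. c (h j))) = c k"
        unfolding j [symmetric] bN' matrix_vector_mul_assoc T1 by simp
    qed
    fix x :: "'k ^ 'n" assume "x \<noteq> 0"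
    let ?minor = "\<lambda>(i, j) x. coord b i x * coord b (Suc j) x - coord b (Suc i) x * coord b j x"
    have minor: "form_fun 2 (?minor s)" for s
    proof -
      have "form_fun (1 + 1) (\<lambda>x. coord b i x * coord b j x)" for i j
        by (intro form_fun_mult form_fun_coord_functional)
      then have "form_fun (1 + 1) (\<lambda>x. coord b i x * coord b (Suc j) x + - (coord b (Suc i) x * coord b j x))" for i j
        by (intro form_fun.add form_fun_minus)
      then show ?thesis by (cases s) (simp add: numeral_2_eq_2)
    qed
    \<comment> \<open>The minors cut out a closed set that contains \<open>X - W\<close>, hence
      \<open>X\<close> by irreducibility; so also the points of \<open>X\<close> in \<open>W\<close>
      are reached by the parametrization.\<close>
    define S where "S = {P. \<forall>s\<in>{..<d} \<times> {..<d}. P \<in> zero_set (?minor s)}"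
    have "zariski_closed S"
      unfolding S_def using minor by (rule zariski_closed_Inter)
    moreover have "X \<subseteq> W \<union> S"
    proof
      fix P assume "P \<in> X"
      show "P \<in> W \<union> S"
      proof (cases "P \<in> W")
        case False
        then obtain s t where st: "(s, t) \<noteq> (0, 0)" "P = point (curve_vec e q s t)"
          using cover \<open>P \<in> X\<close> by blast
        have "?minor (i, j) (curve_vec e q s t) = 0" if "i < d" "j < d" for i j
          using that veronese_minor [OF that, of s t]
          by (simp only: prod.case bv Suc_leI less_imp_le diff_self)
        then have "P \<in> S"
          unfolding S_def st(2) using point_in_zero_set [OF minor v [OF st(1)]] by auto
        then show ?thesis ..
      qed simp
    qed
    ultimately have XS: "X \<subseteq> S"
      using irreducible_closed_cover [OF irr W(1)] W(2) by blast
    show "point x \<in> X \<longleftrightarrow> (\<exists>c s t. \<forall>k\<le>d. coord b k x = c * s ^ k * t ^ (d - k))"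
    proof
      assume "point x \<in> X"
      then have "?minor (i, j) x = 0" if "i < d" "j < d" for i j
        using XS that point_in_zero_set [OF minor \<open>x \<noteq> 0\<close>] unfolding S_def by blast
      then have "coord b i x * coord b (Suc j) x = coord b (Suc i) x * coord b j x" if "i < d" "j < d" for i j
        using that by simp
      then show "\<exists>c s t. \<forall>k\<le>d. coord b k x = c * s ^ k * t ^ (d - k)"
        by (rule hankel_minors_imp_veronese)
    next
      assume "\<exists>c s t. \<forall>k\<le>d. coord b k x = c * s ^ k * t ^ (d - k)"
      then obtain c s t where cst: "\<And>k. k \<le> d \<Longrightarrow> coord b k x = c * s ^ k * t ^ (d - k)"
        by blast
      have x: "x = c *s curve_vec e q s t"
      proof -
        have "x - c *s curve_vec e q s t = 0"
          by (rule inj) (simp add: coord_diff coord_scale cst bv mult.assoc)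
        then show ?thesis by simp
      qed
      then have "c \<noteq> 0"
        using \<open>x \<noteq> 0\<close> by auto
      have "(s, t) \<noteq> (0, 0)"
      proof
        assume "(s, t) = (0, 0)"
        then have "coord b k x = 0" if "k \<le> d" for k
          using cst [OF that] \<open>1 \<le> d\<close> by (auto simp: power_0_left)
        then show False
          using inj \<open>x \<noteq> 0\<close> by blast
      qed
      then show "point x \<in> X"
        unfolding x using vX point_scale [OF \<open>c \<noteq> 0\<close> v] by metis
    qed
  qed (rule inj)
qed

section \<open>The conjugation on a rational normal curve\<close>

text \<open>Let P / Q be F 1 / F 0 in lowest terms. The minors give F k = F 0 (P / Q) ^ k, and since
  F d is a polynomial, Q ^ d divides F 0. Hence F k = K P ^ k Q ^ (d - k), where the degree bound
  leaves P and Q at most linear.\<close>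

lemma veronese_automorphism:
  fixes F :: "nat \<Rightarrow> 'k::{field_gcd, field_char_0} poly"
  assumes deg: "\<And>k. k \<le> d \<Longrightarrow> degree (F k) \<le> d" and "1 \<le> d"
    and minors: "\<And>i j. i < d \<Longrightarrow> j < d \<Longrightarrow> F i * F (Suc j) = F (Suc i) * F j"
    and ind: "\<And>s t. smult s (F 0) + smult t (F 1) = 0 \<Longrightarrow> s = 0 \<and> t = 0"
  shows "\<exists>\<kappa> \<alpha> \<beta> \<gamma> \<delta>. \<kappa> \<noteq> 0 \<and>
    (\<forall>k\<le>d. \<forall>x y. hev d (F k) x y = \<kappa> * (\<alpha> * x + \<beta> * y) ^ k * (\<gamma> * x + \<delta> * y) ^ (d - k))"
proof -
  have F0: "F 0 \<noteq> 0" and F1: "F 1 \<noteq> 0"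
    using ind [of 1 0] ind [of 0 1] by auto
  define G where "G = gcd (F 1) (F 0)"
  have "G \<noteq> 0"
    using F0 by (simp add: G_def)
  then obtain P Q where PQ: "F 1 = P * G" "F 0 = Q * G" "coprime P Q"
    using gcd_coprime_exists [of "F 1" "F 0"] unfolding G_def [symmetric] by blast
  have ne: "P \<noteq> 0" "Q \<noteq> 0"
    using F0 F1 PQ by auto
  have step: "Q * F (Suc k) = P * F k" if "Suc k \<le> d" for k
  proof -
    have "G * (Q * F (Suc k)) = F 0 * F (Suc k)" by (simp only: PQ mult_ac)
    also have "\<dots> = F 1 * F k"
      using minors [of 0 k] that by simp
    also have "\<dots> = G * (P * F k)" by (simp only: PQ mult_ac)
    finally show ?thesis
      using \<open>G \<noteq> 0\<close> by simp
  qed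
  have pow: "F k * Q ^ k = P ^ k * F 0" if "k \<le> d" for k
    using that
  proof (induction k)
    case (Suc k)
    have "F (Suc k) * Q ^ Suc k = (Q * F (Suc k)) * Q ^ k"
      by (simp only: power_Suc mult_ac)
    also have "\<dots> = P * (F k * Q ^ k)" by (simp only: step [OF Suc.prems] mult_ac)
    also have "\<dots> = P ^ Suc k * F 0"
      by (simp only: Suc.IH [OF Suc_leD [OF Suc.prems]] power_Suc mult_ac)
    finally show ?case .
  qed simp
  have "Q ^ d dvd P ^ d * F 0"
    unfolding pow [OF order.refl, symmetric] by simp
  moreover have "coprime (Q ^ d) (P ^ d)"
    using PQ(3) by (simp add: coprime_commute)
  ultimately have "Q ^ d dvd F 0" by (simp add: coprime_dvd_mult_right_iff)
  then obtain K where K: "F 0 = Q ^ d * K" by (rule dvdE)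
  have FK: "F k = K * P ^ k * Q ^ (d - k)" if "k \<le> d" for k
  proof -
    have "F k * Q ^ k = P ^ k * (Q ^ ((d - k) + k) * K)"
      using pow [OF that] K that by simp
    then have "F k * Q ^ k = K * P ^ k * Q ^ (d - k) * Q ^ k"
      by (simp only: power_add mult_ac)
    then show ?thesis
      using ne(2) by simp
  qed
  have "K \<noteq> 0"
    using F0 K by auto
  then have "degree (F d) = degree K + d * degree P" "degree (F 0) = degree K + d * degree Q"
    using ne by (simp_all add: FK degree_mult_eq degree_power_eq)
  then have dK: "degree K + d * degree P \<le> d" "degree K + d * degree Q \<le> d"
    using deg [of d] deg [of 0] by auto
  then have "d * degree P \<le> d * 1" "d * degree Q \<le> d * 1" by linarith+
  then have dPQ: "degree P \<le> 1" "degree Q \<le> 1"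
    using mult_left_le_imp_le [of d _ 1] \<open>1 \<le> d\<close> by simp_all
  \<comment> \<open>Constant \<open>P\<close> and \<open>Q\<close> would make \<open>F 0\<close> and
    \<open>F 1\<close> proportional. A linear one uses up the degree \<open>d\<close>, so
    \<open>K\<close> is constant.\<close>
  have "degree P = 1 \<or> degree Q = 1"
  proof (rule ccontr)
    assume "\<not> ?thesis"
    then have "degree P = 0" "degree Q = 0"
      using dPQ by auto
    then obtain p q where pq: "P = [:p:]" "Q = [:q:]" by (metis degree_eq_zeroE)
    have "smult (- p) (F 0) + smult q (F 1) = 0"
      unfolding PQ pq by (simp add: mult.commute)
    then show False
      using ind ne(2) pq(2) by fastforce
  qed
  then have "degree K = 0"
    using dK by auto
  then obtain \<kappa> where \<kappa>: "K = [:\<kappa>:]" by (metis degree_eq_zeroE)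
  have h1: "hev 1 R x y = coeff R 1 * x + coeff R 0 * y" for R :: "'k poly" and x y
    by (simp add: hev_def)
  have "hev d (F k) x y = \<kappa> * (hev 1 P x y) ^ k * (hev 1 Q x y) ^ (d - k)" if "k \<le> d" for k x y
  proof -
    note hP = hev_power [OF dPQ(1), of k x y, simplified mult_1_right]
    note hQ = hev_power [OF dPQ(2), of "d - k" x y, simplified mult_1_right]
    have "hev (k + (d - k)) (P ^ k * Q ^ (d - k)) x y = hev 1 P x y ^ k * hev 1 Q x y ^ (d - k)"
      using hP hQ by (subst hev_mult) auto
    moreover have "F k = smult \<kappa> (P ^ k * Q ^ (d - k))"
      using FK [OF that] by (simp add: \<kappa>)
    ultimately show ?thesis
      using that by (simp add: hev_smult mult.assoc)
  qed
  moreover have "\<kappa> \<noteq> 0"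
    using \<open>K \<noteq> 0\<close> \<kappa> by simp
  ultimately show ?thesis
    unfolding h1 by blast
qed

section \<open>Conjugation in Veronese coordinates\<close>

definition vec_conj :: "'r::linordered_field cplx ^ 'n \<Rightarrow> 'r cplx ^ 'n::finite"
  where "vec_conj x = (\<chi> i. cplx_conj (x $ i))"

lemma vec_conj_simps [simp]:
  "vec_conj (vec_conj x) = x" "vec_conj 0 = 0" "vec_conj (x + y) = vec_conj x + vec_conj y"
  "vec_conj (c *s x) = cplx_conj c *s vec_conj x" "vec_conj x = 0 \<longleftrightarrow> x = 0"
  by (simp_all add: vec_conj_def vec_eq_iff)

lemma vec_conj_sum: "vec_conj (\<Sum>i\<in>A. f i) = (\<Sum>i\<in>A. vec_conj (f i))"
  by (induction A rule: infinite_finite_induct) auto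

lemma peval_map_of_base_conj:
  "peval (Poly_Mapping.map of_base F) (vec_conj x) = cplx_conj (peval (Poly_Mapping.map of_base F) x)"
proof -
  have "cplx_conj (Poly_Mapping.lookup (Poly_Mapping.map of_base F) m) =
      Poly_Mapping.lookup (Poly_Mapping.map of_base F) m" for m
    by (simp add: Poly_Mapping.map.rep_eq when_def)
  then show ?thesis by (simp add: peval_def cplx_conj_sum cplx_conj_prod vec_conj_def)
qed

lemma defined_over_base_conj:
  assumes "defined_over_base X" "x \<noteq> 0" "point x \<in> X"
  shows "point (vec_conj x) \<in> X"
proof -
  obtain I where I: "X = {P. \<forall>F\<in>I. vanishes_at (Poly_Mapping.map of_base F) P}"
    using assms(1) unfolding defined_over_base_def by blast
  have "vanishes_at (Poly_Mapping.map of_base F) (point (vec_conj x))" if "F \<in> I" for F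
    unfolding vanishes_at_def
  proof
    fix y assume "y \<in> line (point (vec_conj x))"
    then obtain c where "y = c *s vec_conj x"
      using assms(2) by (auto simp: line_point vec.span_singleton)
    then have "vec_conj y \<in> line (point x)"
      using assms(2) by (auto simp: line_point vec.span_singleton)
    moreover have "vanishes_at (Poly_Mapping.map of_base F) (point x)"
      using assms(3) that unfolding I by blast
    ultimately have "peval (Poly_Mapping.map of_base F) (vec_conj y) = 0"
      by (simp add: vanishes_at_def)
    then show "peval (Poly_Mapping.map of_base F) y = 0"
      by (simp add: peval_map_of_base_conj)
  qed
  then show ?thesis
    unfolding I by blast
qed

text \<open>The coordinates \<open>b\<close> need not be compatible with conjugation; the real
  structure enters through \<open>conj_curve\<close>.\<close>

locale real_rational_normal_curve =
  fixes X :: "('r::real_closed_field cplx, 'n::finite) proj set" and d :: nat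
    and b :: "nat \<Rightarrow> 'r cplx ^ 'n"
  assumes d: "2 \<le> d"
    and coord_inj: "\<And>x. (\<And>k. k \<le> d \<Longrightarrow> coord b k x = 0) \<Longrightarrow> x = 0"
    and coord_surj: "\<And>c. \<exists>x. \<forall>k\<le>d. coord b k x = c k"
    and curve: "\<And>x. x \<noteq> 0 \<Longrightarrow> point x \<in> X \<longleftrightarrow> (\<exists>c s t. \<forall>k\<le>d. coord b k x = c * s ^ k * t ^ (d - k))"
    and conj_curve: "\<And>x. x \<noteq> 0 \<Longrightarrow> point x \<in> X \<Longrightarrow> point (vec_conj x) \<in> X"
begin

lemma coord_eqI: "(\<And>k. k \<le> d \<Longrightarrow> coord b k x = coord b k y) \<Longrightarrow> x = y"
  using coord_inj [of "x - y"] by (simp add: coord_diff)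

definition dual_vec :: "nat \<Rightarrow> 'r cplx ^ 'n"
  where "dual_vec l = (SOME x. \<forall>k\<le>d. coord b k x = (if k = l then 1 else 0))"

lemma coord_dual_vec: "k \<le> d \<Longrightarrow> coord b k (dual_vec l) = (if k = l then 1 else 0)"
  unfolding dual_vec_def
  using someI_ex [OF coord_surj [of "\<lambda>k. if k = l then 1 else 0"]] by simp

lemma expand_dual_vec: "x = (\<Sum>l\<le>d. coord b l x *s dual_vec l)"
  by (rule coord_eqI)
    (simp add: coord_sum coord_scale coord_dual_vec if_distrib [of "\<lambda>c. _ * c"] cong: if_cong)

definition veronese :: "'r cplx \<Rightarrow> 'r cplx \<Rightarrow> 'r cplx ^ 'n"
  where "veronese x y = (\<Sum>l\<le>d. (x ^ l * y ^ (d - l)) *s dual_vec l)"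

lemma coord_veronese: "k \<le> d \<Longrightarrow> coord b k (veronese x y) = x ^ k * y ^ (d - k)"
  by (simp add: veronese_def coord_sum coord_scale coord_dual_vec if_distrib [of "\<lambda>c. _ * c"]
      cong: if_cong)

lemma veronese_eq_0_iff: "veronese x y = 0 \<longleftrightarrow> x = 0 \<and> y = 0"
proof
  assume *: "veronese x y = 0"
  show "x = 0 \<and> y = 0"
    using coord_veronese [of 0 x y] coord_veronese [of d x y] d * by (simp add: coord_0)
next
  assume "x = 0 \<and> y = 0"
  then show "veronese x y = 0"
    using d by (intro coord_inj) (simp add: coord_veronese power_0_left)
qed

lemma veronese_in_curve:
  assumes "(x, y) \<noteq> (0, 0)"
  shows "point (veronese x y) \<in> X"
proof -
  have "\<forall>k\<le>d. coord b k (veronese x y) = 1 * x ^ k * y ^ (d - k)"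
    by (simp add: coord_veronese)
  moreover have "veronese x y \<noteq> 0"
    using assms by (auto simp: veronese_eq_0_iff)
  ultimately show ?thesis
    using curve by blast
qed

lemma curve_cases:
  assumes "P \<in> X"
  obtains x y where "(x, y) \<noteq> (0, 0)" "P = point (veronese x y)"
proof -
  obtain z where z: "z \<noteq> 0" "P = point z"
    by (rule point_cases)
  then obtain c s t where "\<And>k. k \<le> d \<Longrightarrow> coord b k z = c * s ^ k * t ^ (d - k)"
    using curve assms by blast
  then have zc: "z = c *s veronese s t"
    by (intro coord_eqI) (simp add: coord_scale coord_veronese)
  then have "c \<noteq> 0" "veronese s t \<noteq> 0"
    using z(1) by auto
  then have "(s, t) \<noteq> (0, 0)" "P = point (veronese s t)"
    unfolding z(2) zc by (auto simp: veronese_eq_0_iff point_scale)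
  then show thesis by (rule that)
qed

definition conj_entry :: "nat \<Rightarrow> nat \<Rightarrow> 'r cplx"
  where "conj_entry k l = coord b k (vec_conj (dual_vec l))"

lemma coord_conj: "coord b k (vec_conj x) = (\<Sum>l\<le>d. conj_entry k l * cplx_conj (coord b l x))"
  by (subst expand_dual_vec [of x]) (simp add: vec_conj_sum coord_sum coord_scale conj_entry_def mult.commute)

text \<open>Row \<open>k\<close> of the matrix of conjugation as a binary form. Conjugating the
  parameters as well, as in \<open>hev_conj_poly\<close>, makes the dependence on them
  polynomial.\<close>

definition conj_poly :: "nat \<Rightarrow> 'r cplx poly"
  where "conj_poly k = (\<Sum>l\<le>d. monom (conj_entry k l) l)"

lemma degree_conj_poly: "degree (conj_poly k) \<le> d"
  unfolding conj_poly_def by (intro degree_sum_le) (auto intro: order_trans [OF degree_monom_le])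

lemma coeff_conj_poly: "l \<le> d \<Longrightarrow> coeff (conj_poly k) l = conj_entry k l"
  by (simp add: conj_poly_def coeff_sum)

lemma hev_conj_poly:
  "hev d (conj_poly k) x y = coord b k (vec_conj (veronese (cplx_conj x) (cplx_conj y)))"
  by (simp add: coord_conj hev_def coeff_conj_poly coord_veronese mult.assoc)

text \<open>Conjugate points lie on the curve again, so the minors vanish at every parameter and
  thus identically. The first two forms are independent because conjugation is onto.\<close>

lemma conj_poly_form:
  "\<exists>\<kappa> \<alpha> \<beta> \<gamma> \<delta>. \<kappa> \<noteq> 0 \<and>
    (\<forall>k\<le>d. \<forall>x y. hev d (conj_poly k) x y = \<kappa> * (\<alpha> * x + \<beta> * y) ^ k * (\<gamma> * x + \<delta> * y) ^ (d - k))"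
proof (rule veronese_automorphism)
  show "degree (conj_poly k) \<le> d" for k by (rule degree_conj_poly)
  show "1 \<le> d"
    using d by simp
  show "conj_poly i * conj_poly (Suc j) = conj_poly (Suc i) * conj_poly j" if ij: "i < d" "j < d" for i j
  proof -
    have "poly (conj_poly i) x * poly (conj_poly (Suc j)) x = poly (conj_poly (Suc i)) x * poly (conj_poly j) x" for x
    proof -
      let ?z = "vec_conj (veronese (cplx_conj x) 1)"
      have p: "poly (conj_poly k) x = coord b k ?z" for k
        using hev_conj_poly [of k x 1] hev_affine [OF degree_conj_poly] by simp
      have "?z \<noteq> 0" "point ?z \<in> X"
        using conj_curve veronese_in_curve [of "cplx_conj x" 1] by (auto simp: veronese_eq_0_iff)
      then obtain c s t where cst: "\<And>k. k \<le> d \<Longrightarrow> coord b k ?z = c * s ^ k * t ^ (d - k)"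
        using curve by blast
      have "(c * c) * (s ^ i * t ^ (d - i) * (s ^ Suc j * t ^ (d - Suc j))) =
          (c * c) * (s ^ Suc i * t ^ (d - Suc i) * (s ^ j * t ^ (d - j)))"
        by (simp only: veronese_minor [OF ij])
      then show ?thesis
        unfolding p using ij by (simp only: cst Suc_leI less_imp_le mult_ac)
    qed
    then have "poly (conj_poly i * conj_poly (Suc j)) = poly (conj_poly (Suc i) * conj_poly j)"
      by (simp add: fun_eq_iff)
    then show ?thesis by (simp only: poly_eq_poly_eq_iff)
  qed
  show "s = 0 \<and> t = 0" if st: "smult s (conj_poly 0) + smult t (conj_poly 1) = 0" for s t
  proof -
    have e: "s * conj_entry 0 l + t * conj_entry 1 l = 0" if "l \<le> d" for l
      using arg_cong [OF st, of "\<lambda>p. coeff p l"] that by (simp add: coeff_conj_poly)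
    have eq: "s * coord b 0 (vec_conj x) + t * coord b 1 (vec_conj x) =
        (\<Sum>l\<le>d. (s * conj_entry 0 l + t * conj_entry 1 l) * cplx_conj (coord b l x))" for x
      unfolding coord_conj sum_distrib_left sum.distrib [symmetric]
      by (intro sum.cong refl) (simp only: distrib_right mult.assoc)
    have 0: "s * coord b 0 (vec_conj x) + t * coord b 1 (vec_conj x) = 0" for x
      unfolding eq by (rule sum.neutral) (use e in simp)
    show ?thesis
      using 0 [of "vec_conj (dual_vec 0)"] 0 [of "vec_conj (dual_vec 1)"] d
      by (simp add: coord_dual_vec)
  qed
qed

end

text \<open>Conjugation on the curve lifts to the semilinear map \<open>(x, y) \<mapsto> (tw1 x y, tw2 x y)\<close> of the plane,
  whose square is a non-zero real scalar \<open>twist_scalar\<close>.\<close>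

locale twisted_rational_normal_curve = real_rational_normal_curve X d b
  for X :: "('r::real_closed_field cplx, 'n::finite) proj set" and d b +
  fixes \<kappa> \<alpha> \<beta> \<gamma> \<delta> :: "'r cplx"
  assumes \<kappa>: "\<kappa> \<noteq> 0"
    and conj_poly_eq: "\<And>k x y. k \<le> d \<Longrightarrow>
      hev d (conj_poly k) x y = \<kappa> * (\<alpha> * x + \<beta> * y) ^ k * (\<gamma> * x + \<delta> * y) ^ (d - k)"
begin

definition tw1 :: "'r cplx \<Rightarrow> 'r cplx \<Rightarrow> 'r cplx"
  where "tw1 x y = \<alpha> * cplx_conj x + \<beta> * cplx_conj y"

definition tw2 :: "'r cplx \<Rightarrow> 'r cplx \<Rightarrow> 'r cplx"
  where "tw2 x y = \<gamma> * cplx_conj x + \<delta> * cplx_conj y"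

lemma vec_conj_veronese: "vec_conj (veronese x y) = \<kappa> *s veronese (tw1 x y) (tw2 x y)"
proof (rule coord_eqI)
  fix k assume k: "k \<le> d"
  have "coord b k (vec_conj (veronese x y)) = hev d (conj_poly k) (cplx_conj x) (cplx_conj y)"
    by (simp add: hev_conj_poly)
  then show "coord b k (vec_conj (veronese x y)) = coord b k (\<kappa> *s veronese (tw1 x y) (tw2 x y))"
    using k by (simp add: conj_poly_eq coord_scale coord_veronese tw1_def tw2_def mult.assoc)
qed

lemma tw_scale:
  "tw1 (c * x) (c * y) = cplx_conj c * tw1 x y" "tw2 (c * x) (c * y) = cplx_conj c * tw2 x y"
  by (simp_all add: tw1_def tw2_def algebra_simps)

definition twist_scalar :: 'r
  where "twist_scalar = cre (\<alpha> * cplx_conj \<alpha> + \<beta> * cplx_conj \<gamma>)"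

text \<open>Conjugating twice is the identity, so the square of the semilinear map preserves all
  monomials of degree \<open>d\<close> up to one common factor. The parameters (1, 0), (0, 1) and
  (1, 1) show that its matrix is diagonal with equal entries.\<close>

lemma twist_scalar_aux:
  defines "A \<equiv> \<alpha> * cplx_conj \<alpha> + \<beta> * cplx_conj \<gamma>"
  shows "tw1 (tw1 x y) (tw2 x y) = A * x" "tw2 (tw1 x y) (tw2 x y) = A * y"
    "\<kappa> * cplx_conj \<kappa> * A ^ d = 1"
proof -
  define B where "B = \<alpha> * cplx_conj \<beta> + \<beta> * cplx_conj \<delta>"
  define C where "C = \<gamma> * cplx_conj \<alpha> + \<delta> * cplx_conj \<gamma>"
  define D where "D = \<gamma> * cplx_conj \<beta> + \<delta> * cplx_conj \<delta>"
  have tt: "tw1 (tw1 x y) (tw2 x y) = A * x + B * y" "tw2 (tw1 x y) (tw2 x y) = C * x + D * y" for x y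
    by (simp_all add: tw1_def tw2_def A_def B_def C_def D_def algebra_simps)
  have v: "veronese x y = (cplx_conj \<kappa> * \<kappa>) *s veronese (A * x + B * y) (C * x + D * y)" for x y
  proof -
    have "veronese x y = vec_conj (vec_conj (veronese x y))" by simp
    then show ?thesis
      unfolding vec_conj_veronese vec_conj_simps(4) tt vector_smult_assoc .
  qed
  have c: "x ^ k * y ^ (d - k) = cplx_conj \<kappa> * \<kappa> * ((A * x + B * y) ^ k * (C * x + D * y) ^ (d - k))"
    if "k \<le> d" for k x y
    using arg_cong [OF v [of x y], of "coord b k"] that by (simp only: coord_scale coord_veronese)
  have "C = 0"
    using c [of 0 1 0] d \<kappa> by (simp add: power_0_left)
  have "B = 0"
    using c [of d 0 1] d \<kappa> by (simp add: power_0_left)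
  have Ad: "cplx_conj \<kappa> * \<kappa> * A ^ d = 1"
    using c [of d 1 0] by simp
  then have "A \<noteq> 0"
    using d by (auto simp: power_0_left)
  have "cplx_conj \<kappa> * \<kappa> * (A ^ (d - 1) * D) = 1"
    using c [of "d - 1" 1 1] d \<open>C = 0\<close> \<open>B = 0\<close> by simp
  moreover have "A ^ d = A ^ (d - 1) * A"
    using d by (metis One_nat_def Suc_pred less_le_trans pos2 power_Suc2)
  ultimately have "cplx_conj \<kappa> * \<kappa> * A ^ (d - 1) * D = cplx_conj \<kappa> * \<kappa> * A ^ (d - 1) * A"
    using Ad by (simp only: mult.assoc)
  then have "D = A"
    using \<kappa> \<open>A \<noteq> 0\<close> by simp
  show "tw1 (tw1 x y) (tw2 x y) = A * x" "tw2 (tw1 x y) (tw2 x y) = A * y"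
    unfolding tt \<open>B = 0\<close> \<open>C = 0\<close> \<open>D = A\<close> by simp_all
  show "\<kappa> * cplx_conj \<kappa> * A ^ d = 1"
    using Ad by (simp only: mult.commute)
qed

text \<open>If J is the semilinear map with square A, then J applied three times is both A J and
  \<open>cplx_conj A\<close> J; hence A is real.\<close>

lemma twist_scalar_eq: "of_base twist_scalar = \<alpha> * cplx_conj \<alpha> + \<beta> * cplx_conj \<gamma>"
proof -
  define A where "A = \<alpha> * cplx_conj \<alpha> + \<beta> * cplx_conj \<gamma>"
  note aux = twist_scalar_aux [folded A_def]
  have "cplx_conj A * tw1 x y = A * tw1 x y" "cplx_conj A * tw2 x y = A * tw2 x y" for x y
    using tw_scale [of A x y] aux(1,2) [of x y] aux(1,2) [of "tw1 x y" "tw2 x y"] by simp_all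
  then have "cplx_conj A * \<alpha> = A * \<alpha>" "cplx_conj A * \<gamma> = A * \<gamma>"
    by (metis add_0_right cplx_conj_0 cplx_conj_1 mult_1_right mult_zero_right tw1_def tw2_def)+
  moreover have "\<alpha> \<noteq> 0 \<or> \<gamma> \<noteq> 0"
  proof (rule ccontr)
    assume "\<not> ?thesis"
    then have "A = 0" by (simp add: A_def)
    then show False
      using aux(3) d by (simp add: power_0_left)
  qed
  ultimately have "cplx_conj A = A" by auto
  then show ?thesis
    unfolding cplx_conj_eq_self_iff twist_scalar_def A_def by simp
qed

lemma tw_tw:
  "tw1 (tw1 x y) (tw2 x y) = of_base twist_scalar * x"
  "tw2 (tw1 x y) (tw2 x y) = of_base twist_scalar * y"
  and twist_scalar_power: "\<kappa> * cplx_conj \<kappa> * of_base twist_scalar ^ d = 1"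
  using twist_scalar_aux by (simp_all add: twist_scalar_eq)

lemma mult_conj_of_base: "z * cplx_conj z = of_base (cre z ^ 2 + cim z ^ 2)" for z :: "'r cplx"
  by (simp add: cplx_eq_iff power2_eq_square)

lemma twist_scalar_nonzero: "twist_scalar \<noteq> 0"
  using twist_scalar_power d by (auto simp: power_0_left)

text \<open>The norm of \<kappa> times the d-th power of the scalar is 1, so this odd power is
  positive.\<close>

lemma twist_scalar_pos_if_odd:
  assumes "odd d"
  shows "0 < twist_scalar"
proof -
  have "of_base ((cre \<kappa> ^ 2 + cim \<kappa> ^ 2) * twist_scalar ^ d) = (of_base 1 :: 'r cplx)"
    using twist_scalar_power by (simp add: mult_conj_of_base of_base_mult of_base_power)
  then have "(cre \<kappa> ^ 2 + cim \<kappa> ^ 2) * twist_scalar ^ d = 1"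
    by (simp only: of_base_eq_iff)
  moreover have "0 \<le> cre \<kappa> ^ 2 + cim \<kappa> ^ 2" by simp
  ultimately have "0 < twist_scalar ^ d"
    using mult_nonneg_nonpos [of "cre \<kappa> ^ 2 + cim \<kappa> ^ 2" "twist_scalar ^ d"] by fastforce
  then show ?thesis
    using assms d by (simp add: zero_less_power_eq)
qed

text \<open>The parameters of a real point are an eigenvector of the semilinear map, with some
  eigenvalue l; applying the map twice shows that the scalar is the norm of l.\<close>

lemma twist_scalar_pos_if_real_point:
  assumes "P \<in> X" "conj_proj P = P"
  shows "0 < twist_scalar"
proof -
  obtain x y where xy: "(x, y) \<noteq> (0, 0)" "P = point (veronese x y)"
    using curve_cases assms(1) by blast
  have v: "veronese x y \<noteq> 0"
    using xy(1) by (auto simp: veronese_eq_0_iff)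
  then have "point (vec_conj (veronese x y)) = point (veronese x y)"
    using assms(2) xy(2) conj_proj_point [OF v] by (simp add: vec_conj_def)
  then obtain c where c: "vec_conj (veronese x y) = c *s veronese x y"
    using v by (subst (asm) point_eq_iff) auto
  then have "c \<noteq> 0"
    using v by auto
  have k: "\<kappa> * (tw1 x y ^ k * tw2 x y ^ (d - k)) = c * (x ^ k * y ^ (d - k))" if "k \<le> d" for k
    using arg_cong [OF c, of "coord b k"] that
    by (simp only: vec_conj_veronese coord_scale coord_veronese)
  have "\<exists>l. tw1 x y = l * x \<and> tw2 x y = l * y"
  proof (cases "y = 0")
    case True
    then have "tw2 x y = 0"
      using k [of 0] d \<kappa> by (simp add: power_0_left)
    then show ?thesis
      using True xy(1) by (intro exI [of _ "tw1 x y / x"]) auto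
  next
    case False
    have 0: "\<kappa> * tw2 x y ^ d = c * y ^ d"
      using k [of 0] by simp
    have 1: "\<kappa> * (tw1 x y * tw2 x y ^ (d - 1)) = c * (x * y ^ (d - 1))"
      using k [of 1] d by simp
    have "tw2 x y ^ d \<noteq> 0"
      using 0 \<open>c \<noteq> 0\<close> False d by (auto simp: power_0_left)
    have "\<kappa> * tw2 x y ^ d * (tw1 x y * y) = (\<kappa> * (tw1 x y * tw2 x y ^ (d - 1))) * (tw2 x y * y)"
      using d by (simp add: power_eq_if [of _ d] mult_ac)
    also have "\<dots> = (c * y ^ d) * (x * tw2 x y)"
      unfolding 1 using d by (simp add: power_eq_if [of _ d] mult_ac)
    also have "\<dots> = \<kappa> * tw2 x y ^ d * (x * tw2 x y)" by (simp only: 0)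
    finally have "tw1 x y * y = x * tw2 x y"
      using \<kappa> \<open>tw2 x y ^ d \<noteq> 0\<close> d by simp
    then show ?thesis
      using False by (intro exI [of _ "tw2 x y / y"]) (simp add: field_simps)
  qed
  then obtain l where l: "tw1 x y = l * x" "tw2 x y = l * y" by blast
  have "of_base twist_scalar * x = cplx_conj l * l * x" "of_base twist_scalar * y = cplx_conj l * l * y"
    using tw_tw [of x y] tw_scale [of l x y] l by (auto simp: mult.assoc)
  then have "of_base twist_scalar = l * cplx_conj l"
    using xy(1) by (auto simp: mult.commute)
  then have "twist_scalar = cre l ^ 2 + cim l ^ 2"
    unfolding mult_conj_of_base of_base_eq_iff .
  then show ?thesis
    using twist_scalar_nonzero by (metis add_nonneg_nonneg order_less_le zero_le_power2)
qed

text \<open>The antilinear action on forms of degree \<open>e\<close>, dehomogenized: precompose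
  with the semilinear map of the plane and conjugate the value, see
  \<open>hev_twist\<close>.\<close>

definition twist :: "nat \<Rightarrow> 'r cplx poly \<Rightarrow> 'r cplx poly"
  where "twist e g = (\<Sum>k\<le>e. smult (cplx_conj (coeff g k))
    ([:cplx_conj \<beta>, cplx_conj \<alpha>:] ^ k * [:cplx_conj \<delta>, cplx_conj \<gamma>:] ^ (e - k)))"

lemma hev_twist_summand:
  assumes "k \<le> e"
  defines "p \<equiv> [:cplx_conj \<beta>, cplx_conj \<alpha>:] ^ k * [:cplx_conj \<delta>, cplx_conj \<gamma>:] ^ (e - k)"
  shows "degree p \<le> e" "hev e p x y = cplx_conj (tw1 x y ^ k * tw2 x y ^ (e - k))"
proof -
  have lin: "degree [:s, t:] \<le> 1" "hev 1 [:s, t:] x y = s * y + t * x" for s t :: "'r cplx"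
    by (simp_all add: hev_def)
  note h = hev_power [OF lin(1), simplified mult_1_right]
  have "degree p \<le> k + (e - k)"
    unfolding p_def using h by (intro degree_mult_bound) blast+
  then show "degree p \<le> e"
    using assms(1) by simp
  have "hev (k + (e - k)) p x y = (cplx_conj \<beta> * y + cplx_conj \<alpha> * x) ^ k * (cplx_conj \<delta> * y + cplx_conj \<gamma> * x) ^ (e - k)"
    unfolding p_def using h by (subst hev_mult) (simp_all only: lin)
  then show "hev e p x y = cplx_conj (tw1 x y ^ k * tw2 x y ^ (e - k))"
    using assms(1) by (simp add: tw1_def tw2_def add.commute)
qed

lemma degree_twist: "degree (twist e g) \<le> e"
  unfolding twist_def
  by (intro degree_sum_le order_trans [OF degree_smult_le] hev_twist_summand) auto

lemma hev_twist: "hev e (twist e g) x y = cplx_conj (hev e g (tw1 x y) (tw2 x y))"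
  unfolding twist_def hev_sum hev_smult hev_def [of e g] cplx_conj_sum
  by (intro sum.cong refl) (simp add: hev_twist_summand mult.assoc)

lemma twist_add: "twist e (f + g) = twist e f + twist e g"
  by (rule hev_eqI [of _ e]) (auto simp: degree_twist degree_add_le hev_twist hev_add)

lemma twist_smult: "twist e (smult c f) = smult (cplx_conj c) (twist e f)"
  by (rule hev_eqI [of _ e])
    (auto simp: degree_twist hev_twist hev_smult intro: order_trans [OF degree_smult_le])

lemma twist_mult:
  assumes "degree f \<le> k" "degree g \<le> l"
  shows "twist (k + l) (f * g) = twist k f * twist l g"
  by (rule hev_eqI [of _ "k + l"]) (auto simp: degree_twist degree_mult_bound hev_twist hev_mult assms)

lemma twist_twist:
  assumes "degree f \<le> e"
  shows "twist e (twist e f) = smult (of_base twist_scalar ^ e) f"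
  by (rule hev_eqI [of _ e])
    (auto simp: degree_twist hev_twist hev_smult tw_tw hev_scale assms intro: order_trans [OF degree_smult_le])

section \<open>Apolar forms of a real point\<close>

definition pairing :: "'r cplx ^ 'n \<Rightarrow> 'r cplx poly \<Rightarrow> 'r cplx"
  where "pairing z g = (\<Sum>k\<le>d. coeff g k * coord b k z)"

text \<open>For real z the matrix of conjugation can be moved from the coordinates of z to the
  coefficients of g. This produces \<open>R\<close>, which its values at all parameters identify
  with a multiple of \<open>twist d g\<close>.\<close>

lemma pairing_twist:
  assumes "vec_conj z = z"
  shows "cplx_conj (pairing z g) = cplx_conj \<kappa> * pairing z (twist d g)"
proof -
  have a: "cplx_conj (coord b k z) = (\<Sum>l\<le>d. cplx_conj (conj_entry k l) * coord b l z)" for k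
    using coord_conj [of k z] assms by (simp add: cplx_conj_sum)
  define R where "R = (\<Sum>k\<le>d. \<Sum>l\<le>d. monom (cplx_conj (coeff g k) * cplx_conj (conj_entry k l)) l)"
  have cR: "coeff R l = (\<Sum>k\<le>d. cplx_conj (coeff g k) * cplx_conj (conj_entry k l))" if "l \<le> d" for l
    using that by (simp add: R_def coeff_sum)
  have "R = smult (cplx_conj \<kappa>) (twist d g)"
  proof (rule hev_eqI [of _ d])
    show "degree R \<le> d"
      unfolding R_def by (intro degree_sum_le) (auto intro: order_trans [OF degree_monom_le])
    show "degree (smult (cplx_conj \<kappa>) (twist d g)) \<le> d"
      using degree_twist by (intro order_trans [OF degree_smult_le])
    fix x y
    have h: "hev d (conj_poly k) (cplx_conj x) (cplx_conj y) =
        (\<Sum>l\<le>d. conj_entry k l * cplx_conj (x ^ l * y ^ (d - l)))" for k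
      by (simp add: hev_def coeff_conj_poly mult.assoc)
    have "cplx_conj (\<Sum>l\<le>d. conj_entry k l * cplx_conj (x ^ l * y ^ (d - l))) =
        cplx_conj (\<kappa> * (tw1 x y ^ k * tw2 x y ^ (d - k)))" if "k \<le> d" for k
      using conj_poly_eq [OF that, of "cplx_conj x" "cplx_conj y"] h [of k]
      by (simp only: tw1_def tw2_def mult.assoc)
    then have m: "(\<Sum>l\<le>d. cplx_conj (conj_entry k l) * (x ^ l * y ^ (d - l))) =
        cplx_conj \<kappa> * cplx_conj (tw1 x y ^ k * tw2 x y ^ (d - k))" if "k \<le> d" for k
      using that by (simp add: cplx_conj_sum)
    have "hev d R x y = (\<Sum>k\<le>d. cplx_conj (coeff g k) * (\<Sum>l\<le>d. cplx_conj (conj_entry k l) * (x ^ l * y ^ (d - l))))"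
      by (simp add: R_def hev_sum hev_monom sum_distrib_left mult.assoc)
    also have "\<dots> = (\<Sum>k\<le>d. cplx_conj (coeff g k) * (cplx_conj \<kappa> * cplx_conj (tw1 x y ^ k * tw2 x y ^ (d - k))))"
      by (intro sum.cong refl) (simp only: m atMost_iff)
    also have "\<dots> = cplx_conj \<kappa> * cplx_conj (hev d g (tw1 x y) (tw2 x y))"
      by (simp add: hev_def cplx_conj_sum sum_distrib_left mult_ac)
    finally show "hev d R x y = hev d (smult (cplx_conj \<kappa>) (twist d g)) x y"
      by (simp add: hev_smult hev_twist)
  qed
  then have "cplx_conj \<kappa> * pairing z (twist d g) = (\<Sum>l\<le>d. coeff R l * coord b l z)"
    by (simp add: pairing_def sum_distrib_left mult.assoc)
  also have "\<dots> = (\<Sum>l\<le>d. \<Sum>k\<le>d. cplx_conj (coeff g k) * (cplx_conj (conj_entry k l) * coord b l z))"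
    by (intro sum.cong refl) (simp add: cR sum_distrib_right mult.assoc)
  also have "\<dots> = (\<Sum>k\<le>d. \<Sum>l\<le>d. cplx_conj (coeff g k) * (cplx_conj (conj_entry k l) * coord b l z))"
    by (rule sum.swap)
  also have "\<dots> = (\<Sum>k\<le>d. cplx_conj (coeff g k) * cplx_conj (coord b k z))"
    by (simp add: a sum_distrib_left)
  also have "\<dots> = cplx_conj (pairing z g)" by (simp add: pairing_def cplx_conj_sum)
  finally show ?thesis ..
qed

definition apolar :: "'r cplx ^ 'n \<Rightarrow> nat \<Rightarrow> 'r cplx poly \<Rightarrow> bool"
  where "apolar z e f \<longleftrightarrow> degree f \<le> e \<and> (\<forall>h. degree h \<le> d - e \<longrightarrow> pairing z (f * h) = 0)"

lemma pairing_add: "pairing z (f + g) = pairing z f + pairing z g"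
  and pairing_smult: "pairing z (smult c f) = c * pairing z f"
  by (simp_all add: pairing_def distrib_right sum.distrib sum_distrib_left mult.assoc)

lemma apolar_add: "apolar z e f \<Longrightarrow> apolar z e g \<Longrightarrow> apolar z e (f + g)"
  by (auto simp: apolar_def degree_add_le distrib_right pairing_add)

lemma apolar_smult: "apolar z e f \<Longrightarrow> apolar z e (smult c f)"
  by (auto simp: apolar_def pairing_smult intro: order_trans [OF degree_smult_le])

lemma apolar_twist:
  assumes "vec_conj z = z" "e \<le> d" "apolar z e f"
  shows "apolar z e (twist e f)"
  unfolding apolar_def
proof (intro conjI allI impI degree_twist)
  fix h :: "'r cplx poly" assume h: "degree h \<le> d - e"
  \<comment> \<open>The test form is itself a twist, because twisting it again returns
    \<open>h\<close> up to a non-zero scalar.\<close>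
  have "pairing z (f * twist (d - e) h) = 0"
    using assms(3) degree_twist by (auto simp: apolar_def)
  then have "cplx_conj \<kappa> * pairing z (twist d (f * twist (d - e) h)) = 0"
    using pairing_twist [OF assms(1), of "f * twist (d - e) h"] by simp
  moreover have "twist d (f * twist (d - e) h) = twist e f * twist (d - e) (twist (d - e) h)"
    using twist_mult [of f e "twist (d - e) h" "d - e"] assms(2,3) degree_twist by (simp add: apolar_def)
  ultimately have "of_base twist_scalar ^ (d - e) * pairing z (twist e f * h) = 0"
    using \<kappa> by (simp add: twist_twist [OF h] pairing_smult)
  then show "pairing z (twist e f * h) = 0"
    using twist_scalar_nonzero by simp
qed

text \<open>If \<open>twist e\<close> squares to a positive scalar, then the forms fixed by it up to a scalar are Zariski
  dense in the space of apolar forms.\<close>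

lemma apolar_twist_eigenform:
  assumes z: "vec_conj z = z" and e: "e \<le> d" and pos: "0 < twist_scalar ^ e"
    and f0: "apolar z e f0" "D f0 \<noteq> 0"
    and D: "\<And>f g. \<exists>p. \<forall>t. D (f + smult t g) = poly p t"
  shows "\<exists>f s. apolar z e f \<and> D f \<noteq> 0 \<and> s \<noteq> 0 \<and> twist e f = smult s f"
proof -
  obtain s where s: "s ^ 2 = twist_scalar ^ e"
    using nonneg_is_square pos by (metis less_imp_le)
  then have s0: "s \<noteq> 0"
    using pos by (metis less_irrefl zero_power2)
  define S where "S = (of_base s :: 'r cplx)"
  have S: "S \<noteq> 0" "cplx_conj S = S" "S * S = of_base twist_scalar ^ e"
    using s0 s by (simp_all add: S_def of_base_mult [symmetric] of_base_power [symmetric] power2_eq_square)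
  define I where "I = (Cplx 0 1 :: 'r cplx)"
  have I: "I * I = -1" "cplx_conj I = - I" by (simp_all add: I_def cplx_eq_iff)
  define g0 where "g0 = smult (inverse S) (twist e f0)"
  have degf0: "degree f0 \<le> e"
    using f0(1) by (simp add: apolar_def)
  have ci: "cplx_conj (inverse S) = inverse S"
    by (simp add: S_def flip: of_base_inverse)
  have tf0: "twist e f0 = smult S g0"
    using S(1) by (simp add: g0_def)
  have tg0: "twist e g0 = smult S f0"
  proof -
    have "twist e g0 = smult (inverse S * (S * S)) f0"
      by (simp add: g0_def twist_smult ci twist_twist [OF degf0] S(3))
    then show ?thesis
      using S(1) by (simp flip: mult.assoc)
  qed
  define H where "H = (of_base (1 / 2) :: 'r cplx)"
  have H: "H + H = 1" "cplx_conj H = H" by (simp_all add: H_def flip: of_base_add)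
  \<comment> \<open>The real and imaginary parts of \<open>f0\<close>, up to sign, for the
    antilinear involution \<open>twist e\<close> divided by \<open>S\<close>: \<open>f0\<close> is
    \<open>f1 - I * f2\<close>.\<close>
  define f1 where "f1 = smult H (f0 + g0)"
  define f2 where "f2 = smult (I * H) (f0 + smult (-1) g0)"
  have ag0: "apolar z e g0"
    unfolding g0_def by (intro apolar_smult apolar_twist z e f0)
  have t1: "twist e f1 = smult S f1"
    by (simp add: f1_def twist_add twist_smult tf0 tg0 smult_add_right H add.commute mult.commute)
  have t2: "twist e f2 = smult S f2"
  proof -
    have "twist e f2 = smult (- (I * H)) (smult S g0 + smult (-1) (smult S f0))"
      by (simp only: f2_def twist_smult twist_add tf0 tg0 cplx_conj_mult I H cplx_conj_minus cplx_conj_1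
          mult_minus_left)
    then show ?thesis by (simp add: f2_def poly_eq_iff algebra_simps)
  qed
  have "f1 + smult (- I) f2 = smult (H + H) f0"
  proof -
    have "(- I) * (I * H) = H"
      using I(1) by (metis minus_mult_left minus_minus mult.assoc mult_1)
    then have "smult (- I) f2 = smult H (f0 + smult (-1) g0)"
      by (simp only: f2_def smult_smult)
    then show ?thesis by (simp only: f1_def) (simp add: poly_eq_iff algebra_simps)
  qed
  then have f0_eq: "f1 + smult (- I) f2 = f0" by (simp add: H)
  \<comment> \<open>\<open>D\<close> is not zero at the parameter \<open>- I\<close>, which gives
    \<open>f0\<close>, so it is not zero at some parameter from the base field, and there the
    eigenform property persists.\<close>
  obtain p where p: "\<And>t. D (f1 + smult t f2) = poly p t"
    using D [of f1 f2] by blast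
  have "p \<noteq> 0"
    using p [of "- I"] f0(2) f0_eq by auto
  then have "finite (of_base -` {t. poly p t = 0} :: 'r set)"
    by (intro finite_vimageI poly_roots_finite) (auto simp: inj_on_def)
  then obtain t :: 'r where "t \<notin> of_base -` {t. poly p t = 0}"
    using infinite_UNIV_char_0 [where ?'a = 'r] by (metis ex_new_if_finite)
  then have t: "poly p (of_base t) \<noteq> 0" by simp
  define f where "f = f1 + smult (of_base t) f2"
  have "apolar z e f"
    unfolding f_def f1_def f2_def by (intro apolar_add apolar_smult f0 ag0)
  moreover have "D f \<noteq> 0"
    using t by (simp add: f_def p)
  moreover have "twist e f = smult S f"
    by (simp add: f_def twist_add twist_smult t1 t2 smult_add_right mult.commute)
  ultimately show ?thesis
    using S(1) by blast
qed

text \<open>The value of \<open>twist e f\<close> at a parameter is the conjugate of the value of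
  \<open>f\<close> at its image, so the semilinear map carries zeros of an eigenform to
  zeros.\<close>

lemma eigenform_zeros_conj_stable:
  assumes f: "degree f = e" "twist e f = smult s f" "f \<noteq> 0"
  defines "S \<equiv> (\<lambda>t. point (veronese t 1)) ` {t. poly f t = 0}"
  shows "conj_proj ` S = S"
proof -
  have v: "veronese x y \<noteq> 0" if "(x, y) \<noteq> (0, 0)" for x y
    using that by (auto simp: veronese_eq_0_iff)
  have sub: "conj_proj ` S \<subseteq> S"
  proof
    fix Q assume "Q \<in> conj_proj ` S"
    then obtain t where t: "poly f t = 0" "Q = conj_proj (point (veronese t 1))"
      by (auto simp: S_def)
    have Q: "Q = point (\<kappa> *s veronese (tw1 t 1) (tw2 t 1))"
      using t(2) conj_proj_point [OF v [of t 1]] vec_conj_veronese by (simp add: vec_conj_def)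
    have "hev e (twist e f) t 1 = 0"
      unfolding f(2) hev_smult using t(1) f(1) by (simp add: hev_affine)
    then have 0: "hev e f (tw1 t 1) (tw2 t 1) = 0" by (simp add: hev_twist)
    have ne: "tw1 t 1 \<noteq> 0 \<or> tw2 t 1 \<noteq> 0"
      using tw_tw(2) [of t 1] twist_scalar_nonzero by (auto simp: tw2_def [of "tw1 t 1"])
    \<comment> \<open>Infinity is not a zero of \<open>f\<close>, since its degree is exactly
      \<open>e\<close>.\<close>
    have "tw2 t 1 \<noteq> 0"
    proof
      assume 2: "tw2 t 1 = 0"
      then have "coeff f e * tw1 t 1 ^ e = 0"
        using 0 by (simp add: hev_infinity)
      then show False
        using ne 2 f by auto
    qed
    define t' where "t' = tw1 t 1 / tw2 t 1"
    have "poly f t' = 0"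
      using 0 hev_divide [of f e "tw2 t 1" "tw1 t 1"] f(1) \<open>tw2 t 1 \<noteq> 0\<close> by (simp add: t'_def)
    moreover have "veronese (tw1 t 1) (tw2 t 1) = tw2 t 1 ^ d *s veronese t' 1"
    proof (rule coord_eqI)
      fix k assume k: "k \<le> d"
      have "tw2 t 1 ^ d = tw2 t 1 ^ k * tw2 t 1 ^ (d - k)"
        using k by (simp flip: power_add)
      then show "coord b k (veronese (tw1 t 1) (tw2 t 1)) = coord b k (tw2 t 1 ^ d *s veronese t' 1)"
        using k \<open>tw2 t 1 \<noteq> 0\<close> by (simp add: coord_scale coord_veronese t'_def power_divide)
    qed
    then have "Q = point (veronese t' 1)"
      unfolding Q vector_smult_assoc using \<kappa> \<open>tw2 t 1 \<noteq> 0\<close> v [of t' 1] by (simp add: point_scale)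
    ultimately show "Q \<in> S" by (auto simp: S_def)
  qed
  have inv: "conj_proj (conj_proj P) = P" for P :: "('r cplx, 'n) proj"
  proof -
    obtain x where x: "x \<noteq> 0" "P = point x"
      by (rule point_cases)
    have "conj_proj (conj_proj (point x)) = point (vec_conj (vec_conj x))"
      using conj_proj_point [OF x(1)] conj_proj_point [of "vec_conj x"] x(1) vec_conj_simps(5) [of x]
      by (simp only: vec_conj_def [symmetric] simp_thms)
    then show ?thesis
      using x(2) by simp
  qed
  have "S = conj_proj ` conj_proj ` S" by (simp add: image_image inv)
  also have "\<dots> \<subseteq> conj_proj ` S"
    using sub by blast
  finally show ?thesis
    using sub by blast
qed

end

section \<open>Apolarity and rank\<close>

definition lagrange_poly :: "'k::field set \<Rightarrow> 'k \<Rightarrow> 'k poly"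
  where "lagrange_poly T t = smult (inverse (\<Prod>s\<in>T - {t}. t - s)) (\<Prod>s\<in>T - {t}. [:- s, 1:])"

lemma poly_lagrange_poly:
  assumes "finite T" "s \<in> T" "t \<in> T"
  shows "poly (lagrange_poly T t) s = (if s = t then 1 else 0)"
proof (cases "s = t")
  case True
  have "(\<Prod>r\<in>T - {t}. t - r) \<noteq> 0"
    using assms by (simp add: prod_zero_iff)
  then show ?thesis
    using True by (simp add: lagrange_poly_def poly_prod)
next
  case False
  then have "(\<Prod>r\<in>T - {t}. poly [:- r, 1:] s) = 0"
    using assms by (intro prod_zero) auto
  then show ?thesis
    using False by (simp add: lagrange_poly_def poly_prod)
qed

lemma degree_lagrange_poly:
  assumes "finite T"
  shows "degree (lagrange_poly T t) \<le> card T"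
proof -
  have "degree (\<Prod>s\<in>T - {t}. [:- s, 1:]) \<le> (\<Sum>s\<in>T - {t}. degree [:- s, 1:])"
    using assms by (intro degree_prod_sum_le [THEN order_trans]) auto
  also have "\<dots> \<le> card T"
    using assms by (simp add: card_mono)
  finally show ?thesis
    unfolding lagrange_poly_def by (rule order_trans [OF degree_smult_le])
qed

text \<open>The remainder modulo f vanishes at \<open>degree f\<close> distinct points but has
  smaller degree.\<close>

lemma dvd_if_vanishes_on_simple_roots:
  fixes f R :: "'k::{alg_closed_field, field_gcd, field_char_0} poly"
  assumes f: "f \<noteq> 0" "\<And>t. poly f t = 0 \<Longrightarrow> poly (pderiv f) t \<noteq> 0"
    and R: "\<And>t. poly f t = 0 \<Longrightarrow> poly R t = 0"
  shows "f dvd R"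
proof -
  define r where "r = R mod f"
  have "poly r t = 0" if "poly f t = 0" for t
  proof -
    have "R = f * (R div f) + r" by (simp add: r_def)
    then have "poly R t = poly f t * poly (R div f) t + poly r t"
      by (metis poly_add poly_mult)
    then show ?thesis
      using R [OF that] that by simp
  qed
  then have sub: "{t. poly f t = 0} \<subseteq> {t. poly r t = 0}" by blast
  have "r = 0"
  proof (rule ccontr)
    assume "r \<noteq> 0"
    then have "degree f \<le> degree r"
      using card_mono [OF poly_roots_finite [OF \<open>r \<noteq> 0\<close>] sub] card_poly_roots_bound [OF \<open>r \<noteq> 0\<close>]
        poly_card_roots [OF f] by linarith
    moreover have "degree r < degree f"
      using degree_mod_less [OF f(1), of R] \<open>r \<noteq> 0\<close> by (simp add: r_def)
    ultimately show False by simp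
  qed
  then show ?thesis by (simp add: r_def mod_eq_0_iff_dvd)
qed

section \<open>Spans of curve points and bounds for the rank\<close>

context twisted_rational_normal_curve
begin

lemma pairing_sum: "pairing z (\<Sum>i\<in>A. f i) = (\<Sum>i\<in>A. pairing z (f i))"
  by (induction A rule: infinite_finite_induct) (simp_all add: pairing_add, simp_all add: pairing_def)

text \<open>The monomial with exponent \<open>k\<close> agrees modulo \<open>f\<close> with its
  Lagrange interpolant at the roots of \<open>f\<close>. Apolarity removes the multiple of
  \<open>f\<close>, and what is left expresses \<open>z\<close> by the curve points.\<close>

lemma apolar_imp_in_span:
  assumes f: "apolar z e f" "degree f = e" "f \<noteq> 0" "e \<le> d"
    and simple: "\<And>t. poly f t = 0 \<Longrightarrow> poly (pderiv f) t \<noteq> 0"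
  shows "z \<in> vec.span ((\<lambda>t. veronese t 1) ` {t. poly f t = 0})"
proof -
  define T where "T = {t. poly f t = 0}"
  have T: "finite T" "card T = e"
    using poly_roots_finite [OF f(3)] poly_card_roots [OF f(3) simple] f(2) by (simp_all add: T_def)
  have z: "z = (\<Sum>t\<in>T. pairing z (lagrange_poly T t) *s veronese t 1)"
  proof (rule coord_eqI)
    fix k assume k: "k \<le> d"
    define L where "L = (\<Sum>t\<in>T. smult (t ^ k) (lagrange_poly T t))"
    define R where "R = monom 1 k - L"
    have R0: "poly R s = 0" if "poly f s = 0" for s
    proof -
      have "s \<in> T"
        using that by (simp add: T_def)
      then have "poly L s = (\<Sum>t\<in>T. if s = t then t ^ k else 0)"
        unfolding L_def poly_sum poly_smult
        by (intro sum.cong refl) (simp add: poly_lagrange_poly [OF T(1)])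
      also have "\<dots> = s ^ k"
        using \<open>s \<in> T\<close> T(1) by simp
      finally show ?thesis by (simp add: R_def poly_monom)
    qed
    have "f dvd R"
      using f(3) simple R0 by (rule dvd_if_vanishes_on_simple_roots)
    then obtain q where q: "R = f * q" by (rule dvdE)
    have "degree L \<le> d"
      unfolding L_def using degree_lagrange_poly [OF T(1)] T f(4)
      by (intro degree_sum_le order_trans [OF degree_smult_le]) (auto intro: order_trans)
    then have "degree R \<le> d"
      unfolding R_def using k by (intro degree_diff_le) (auto simp: degree_monom_eq)
    then have "degree q \<le> d - e"
      using f(2,3) q by (cases "q = 0") (auto simp: degree_mult_eq)
    then have "pairing z R = 0"
      using f(1) q by (simp add: apolar_def)
    moreover have "pairing z (monom 1 k) = pairing z R + pairing z L"
      by (simp flip: pairing_add add: R_def)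
    moreover have "pairing z (monom 1 k) = coord b k z"
      using k by (simp add: pairing_def if_distrib [of "\<lambda>c. c * _"] cong: if_cong)
    ultimately have "coord b k z = (\<Sum>t\<in>T. t ^ k * pairing z (lagrange_poly T t))"
      by (simp add: L_def pairing_sum pairing_smult)
    then show "coord b k z = coord b k (\<Sum>t\<in>T. pairing z (lagrange_poly T t) *s veronese t 1)"
      using k by (simp add: coord_sum coord_scale coord_veronese mult.commute)
  qed
  show ?thesis
    by (subst z, unfold T_def [symmetric]) (intro vec.span_sum vec.span_scale vec.span_base imageI)
qed

text \<open>If \<open>z\<close> lies in the span of fewer than \<open>e\<close> points of the curve, then the product of the
  linear forms vanishing at these points is in the kernel of the Hankel matrix of \<open>z\<close>.\<close>

lemma hankel_nondegenerate_imp_card_ge: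
  assumes nondeg: "\<And>g. degree g < e \<Longrightarrow> (\<And>j. j < e \<Longrightarrow> (\<Sum>k<e. coeff g k * coord b (k + j) z) = 0) \<Longrightarrow> g = 0"
    and e: "1 \<le> e" "2 * e \<le> d + 2"
    and S: "finite S" "S \<subseteq> X" "z \<in> vec.span (\<Union>Q\<in>S. line Q)"
  shows "e \<le> card S"
proof (rule ccontr)
  assume "\<not> e \<le> card S"
  then have cS: "card S \<le> e - 1" by simp
  have "\<exists>u. u \<noteq> (0, 0) \<and> Q = point (veronese (fst u) (snd u))" if Q: "Q \<in> S" for Q
  proof -
    obtain x y where "(x, y) \<noteq> (0, 0)" "Q = point (veronese x y)"
      using curve_cases S(2) Q by blast
    then show ?thesis by (intro exI [of _ "(x, y)"]) simp
  qed
  then have "\<forall>Q\<in>S. \<exists>u. u \<noteq> (0, 0) \<and> Q = point (veronese (fst u) (snd u))"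
    by blast
  from bchoice [OF this] obtain u where
    u: "\<forall>Q\<in>S. u Q \<noteq> (0, 0) \<and> Q = point (veronese (fst (u Q)) (snd (u Q)))" ..
  define x y where "x = (\<lambda>Q. fst (u Q))" and "y = (\<lambda>Q. snd (u Q))"
  have xy: "(x Q, y Q) \<noteq> (0, 0)" "Q = point (veronese (x Q) (y Q))" if "Q \<in> S" for Q
    using u that by (simp_all add: x_def y_def)
  \<comment> \<open>As a binary form in s and t the factor is \<open>y Q * s - x Q * t\<close>,
    which also covers the point at infinity.\<close>
  define g where "g = (\<Prod>Q\<in>S. [:- x Q, y Q:])"
  have "g \<noteq> 0"
    unfolding g_def using S(1) xy(1) by (auto simp: prod_zero_iff)
  have lin: "degree [:- x Q, y Q:] \<le> 1" for Q by simp
  have dg: "degree g \<le> card S" "hev (card S) g s t = (\<Prod>Q\<in>S. hev 1 [:- x Q, y Q:] s t)" for s t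
    using hev_prod [OF S(1), of "\<lambda>Q. [:- x Q, y Q:]" "\<lambda>_. 1" s t] lin by (auto simp: g_def)
  \<comment> \<open>With fewer than \<open>e - 1\<close> points, the form is multiplied by a power
    of the second variable, represented by the factor 1 with a larger degree bound.\<close>
  have h0: "hev (e - 1) g (x Q) (y Q) = 0" if Q: "Q \<in> S" for Q
  proof -
    have "hev 1 [:- x Q, y Q:] (x Q) (y Q) = 0" by (simp add: hev_def)
    then have "hev (card S) g (x Q) (y Q) = 0"
      unfolding dg(2) using S(1) Q by (intro prod_zero) auto
    then have "hev (card S + (e - 1 - card S)) (g * 1) (x Q) (y Q) = 0"
      using dg(1) by (subst hev_mult) auto
    moreover have "card S + (e - 1 - card S) = e - 1"
      using cS by simp
    ultimately show ?thesis by (simp only: mult_1_right)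
  qed
  have "(\<Sum>k<e. coeff g k * coord b (k + j) z) = 0" if j: "j < e" for j
  proof -
    let ?H = "{w. (\<Sum>k<e. coeff g k * coord b (k + j) w) = 0}"
    have "vec.subspace ?H"
      unfolding vec.subspace_def
      by (auto simp: coord_0 coord_add coord_scale distrib_left sum.distrib mult.left_commute
          simp flip: sum_distrib_left)
    moreover have "line Q \<subseteq> ?H" if Q: "Q \<in> S" for Q
    proof
      fix w assume "w \<in> line Q"
      moreover have "veronese (x Q) (y Q) \<noteq> 0"
        using xy(1) [OF Q] by (auto simp: veronese_eq_0_iff)
      ultimately obtain c where w: "w = c *s veronese (x Q) (y Q)"
        using xy(2) [OF Q] by (metis (no_types, lifting) line_point vec.span_singleton rangeE)
      have "(\<Sum>k<e. coeff g k * coord b (k + j) w) =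
          (\<Sum>k<e. c * (x Q ^ j * y Q ^ (d - (e - 1) - j)) * (coeff g k * x Q ^ k * y Q ^ (e - 1 - k)))"
      proof (intro sum.cong refl)
        fix k assume "k \<in> {..<e}"
        then have "k + j \<le> d" "d - (k + j) = (d - (e - 1) - j) + (e - 1 - k)"
          using e j by auto
        then show "coeff g k * coord b (k + j) w =
            c * (x Q ^ j * y Q ^ (d - (e - 1) - j)) * (coeff g k * x Q ^ k * y Q ^ (e - 1 - k))"
          by (simp only: w coord_scale coord_veronese power_add mult_ac)
      qed
      also have "\<dots> = c * (x Q ^ j * y Q ^ (d - (e - 1) - j)) * hev (e - 1) g (x Q) (y Q)"
      proof -
        have "{..<e} = {..e - 1}"
          using e(1) by auto
        then show ?thesis by (simp only: hev_def sum_distrib_left)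
      qed
      finally show "w \<in> ?H"
        using h0 [OF Q] by simp
    qed
    ultimately have "vec.span (\<Union>Q\<in>S. line Q) \<subseteq> ?H"
      by (intro vec.span_minimal) auto
    then show ?thesis
      using S(3) by blast
  qed
  then have "g = 0"
    using dg(1) cS e(1) by (intro nondeg) auto
  then show False
    using \<open>g \<noteq> 0\<close> by simp
qed

lemma admissible_rank_eq:
  fixes x0 :: "'r ^ 'n"
  defines "z \<equiv> \<chi> i. of_base (x0 $ i)"
  assumes x0: "x0 \<noteq> 0"
    and nondeg: "\<And>g. degree g < e \<Longrightarrow> (\<And>j. j < e \<Longrightarrow> (\<Sum>k<e. coeff g k * coord b (k + j) z) = 0) \<Longrightarrow> g = 0"
    and e: "1 \<le> e" "2 * e \<le> d + 2"
    and f: "apolar z e f" "degree f = e" "f \<noteq> 0" "\<And>t. poly f t = 0 \<Longrightarrow> poly (pderiv f) t \<noteq> 0"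
      "twist e f = smult s f"
  shows "admissible_rank X (point x0) = enat e"
proof -
  have z0: "z \<noteq> 0"
    using x0 by (auto simp: z_def vec_eq_iff)
  have cz: "complexify (point x0) = point z"
    unfolding z_def by (rule complexify_point [OF x0])
  define S where "S = (\<lambda>t. point (veronese t 1)) ` {t. poly f t = 0}"
  have v: "veronese t 1 \<noteq> 0" for t by (auto simp: veronese_eq_0_iff)
  have finS: "finite S"
    unfolding S_def using poly_roots_finite [OF f(3)] by simp
  have cardS: "card S \<le> e"
    unfolding S_def using card_image_le [OF poly_roots_finite [OF f(3)]] poly_card_roots [OF f(3,4)] f(2)
    by metis
  have SX: "S \<subseteq> X"
    unfolding S_def using veronese_in_curve by auto
  have conjS: "conj_proj ` S = S"
    unfolding S_def using eigenform_zeros_conj_stable f(2,3,5) by blast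
  have "(\<lambda>t. veronese t 1) ` {t. poly f t = 0} \<subseteq> (\<Union>Q\<in>S. line Q)"
    using point_in_line [OF v] by (auto simp: S_def)
  moreover have "z \<in> vec.span ((\<lambda>t. veronese t 1) ` {t. poly f t = 0})"
    using f(1-3) _ f(4) by (rule apolar_imp_in_span) (use e d in linarith)
  ultimately have "z \<in> vec.span (\<Union>Q\<in>S. line Q)"
    using vec.span_mono by blast
  then have "line (point z) \<subseteq> vec.span (\<Union>Q\<in>S. line Q)"
    unfolding line_point [OF z0] by (intro vec.span_minimal vec.subspace_span) auto
  then have zS: "complexify (point x0) \<in> linear_span S"
    by (simp add: cz linear_span_def)
  have lower: "e \<le> card S'" if "finite S'" "S' \<subseteq> X" "complexify (point x0) \<in> linear_span S'" for S'
  proof -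
    have "z \<in> vec.span (\<Union>Q\<in>S'. line Q)"
      using that(3) point_in_line [OF z0] by (auto simp: cz linear_span_def)
    then show ?thesis
      using hankel_nondegenerate_imp_card_ge [OF nondeg e that(1,2)] by blast
  qed
  \<comment> \<open>The lower bound, applied to \<open>S\<close> itself, shows that the
    \<open>e\<close> roots give distinct points.\<close>
  have "card S = e"
    using lower [OF finS SX zS] cardS by simp
  let ?A = "{enat (card S) |S. finite S \<and> S \<subseteq> X \<and> conj_proj ` S = S \<and>
    complexify (point x0) \<in> linear_span S}"
  show ?thesis
    unfolding admissible_rank_def
  proof (rule antisym)
    show "Inf ?A \<le> enat e"
      using finS SX conjS zS \<open>card S = e\<close> by (intro Inf_lower) blast
    show "enat e \<le> Inf ?A"
      using lower by (intro Inf_greatest) auto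
  qed
qed

end

section \<open>Genericity\<close>

text \<open>The size \<open>e\<close> is a term and not the cardinality of a type, hence the
  matrices with explicit dimensions.\<close>

definition hankel :: "nat \<Rightarrow> (nat \<Rightarrow> 'k::field) \<Rightarrow> 'k Matrix.mat"
  where "hankel e a = Matrix.mat e e (\<lambda>(i, j). a (i + j))"

lemma hankel_carrier: "hankel e a \<in> carrier_mat e e"
  by (simp add: hankel_def)

lemma hankel_adj:
  assumes "i < e" "l < e"
  shows "(\<Sum>k<e. a (i + k) * adj_mat (hankel e a) $$ (k, l)) = (if i = l then Determinant.det (hankel e a) else 0)"
    and "(\<Sum>k<e. adj_mat (hankel e a) $$ (l, k) * a (k + i)) = (if l = i then Determinant.det (hankel e a) else 0)"
proof -
  note A = hankel_carrier [of e a] and adj = adj_mat [OF hankel_carrier [of e a]]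
  have "(hankel e a * adj_mat (hankel e a)) $$ (i, l) = (\<Sum>k<e. a (i + k) * adj_mat (hankel e a) $$ (k, l))"
    using assms A adj(1) by (simp add: scalar_prod_def hankel_def lessThan_atLeast0)
  then show "(\<Sum>k<e. a (i + k) * adj_mat (hankel e a) $$ (k, l)) = (if i = l then Determinant.det (hankel e a) else 0)"
    using assms by (auto simp: adj(2))
  have "(adj_mat (hankel e a) * hankel e a) $$ (l, i) = (\<Sum>k<e. adj_mat (hankel e a) $$ (l, k) * a (k + i))"
    using assms A adj(1) by (simp add: scalar_prod_def hankel_def lessThan_atLeast0)
  then show "(\<Sum>k<e. adj_mat (hankel e a) $$ (l, k) * a (k + i)) = (if l = i then Determinant.det (hankel e a) else 0)"
    using assms by (auto simp: adj(3))
qed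

lemma hankel_det_nonzero_imp_kernel_trivial:
  assumes det: "Determinant.det (hankel e a) \<noteq> 0"
    and g: "degree g < e" "\<And>j. j < e \<Longrightarrow> (\<Sum>k<e. coeff g k * a (k + j)) = 0"
  shows "g = 0"
proof (rule poly_eqI)
  fix l
  show "coeff g l = coeff 0 l"
  proof (cases "l < e")
    case True
    have "Determinant.det (hankel e a) * coeff g l =
        (\<Sum>k<e. (\<Sum>j<e. adj_mat (hankel e a) $$ (l, j) * a (j + k)) * coeff g k)"
      using True by (simp add: hankel_adj(2) if_distrib [of "\<lambda>c. c * _"] cong: if_cong sum.cong_simp)
    also have "\<dots> = (\<Sum>j<e. adj_mat (hankel e a) $$ (l, j) * (\<Sum>k<e. coeff g k * a (k + j)))"
      unfolding sum_distrib_left sum_distrib_right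
      by (subst sum.swap) (simp add: mult_ac add.commute)
    also have "\<dots> = 0"
      using g(2) by simp
    finally show ?thesis
      using det by simp
  next
    case False
    then show ?thesis
      using g(1) by (simp add: coeff_eq_0)
  qed
qed

lemma hankel_det_nonzero:
  assumes "\<And>v. (\<And>i. i < e \<Longrightarrow> (\<Sum>k<e. a (i + k) * v k) = 0) \<Longrightarrow> (\<And>k. k < e \<Longrightarrow> v k = 0)"
  shows "Determinant.det (hankel e a) \<noteq> 0"
proof
  assume "Determinant.det (hankel e a) = 0"
  then obtain v where v: "v \<in> carrier_vec e" "v \<noteq> 0\<^sub>v e" "hankel e a *\<^sub>v v = 0\<^sub>v e"
    unfolding det_0_iff_vec_prod_zero_field [OF hankel_carrier] by blast
  have "(\<Sum>k<e. a (i + k) * vec_index v k) = 0" if "i < e" for i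
  proof -
    have "vec_index (hankel e a *\<^sub>v v) i = (\<Sum>k<e. a (i + k) * vec_index v k)"
      using that v(1) by (simp add: scalar_prod_def hankel_def lessThan_atLeast0)
    then show ?thesis
      using that v(3) by simp
  qed
  then have "vec_index v k = 0" if "k < e" for k
    using assms [of "vec_index v"] that by blast
  then have "v = 0\<^sub>v e"
    using v(1) by (intro eq_vecI) auto
  then show False
    using v(2) by simp
qed

text \<open>Cramer's rule: a polynomial of degree \<open>e\<close> in the kernel of the \<open>e \<times> (e + 1)\<close> Hankel matrix of
  \<open>a\<close>, with leading coefficient the Hankel determinant.\<close>

definition hankel_poly :: "nat \<Rightarrow> (nat \<Rightarrow> 'k::field) \<Rightarrow> 'k poly"
  where "hankel_poly e a = monom (Determinant.det (hankel e a)) e -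
    (\<Sum>k<e. monom (\<Sum>j<e. adj_mat (hankel e a) $$ (k, j) * a (e + j)) k)"

lemma coeff_hankel_poly:
  "coeff (hankel_poly e a) k = (if k = e then Determinant.det (hankel e a) else
    if k < e then - (\<Sum>j<e. adj_mat (hankel e a) $$ (k, j) * a (e + j)) else 0)"
  by (auto simp: hankel_poly_def coeff_sum if_distrib [of uminus] cong: if_cong)

lemma degree_hankel_poly: "degree (hankel_poly e a) \<le> e"
  by (rule degree_le) (auto simp: coeff_hankel_poly)

lemma hankel_poly_kernel:
  assumes "i < e"
  shows "(\<Sum>k\<le>e. coeff (hankel_poly e a) k * a (k + i)) = 0"
proof -
  have "(\<Sum>k<e. (\<Sum>j<e. adj_mat (hankel e a) $$ (k, j) * a (e + j)) * a (k + i)) =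
      (\<Sum>j<e. (\<Sum>k<e. a (i + k) * adj_mat (hankel e a) $$ (k, j)) * a (e + j))"
    unfolding sum_distrib_left sum_distrib_right
    by (subst sum.swap) (simp add: mult_ac add.commute)
  also have "\<dots> = Determinant.det (hankel e a) * a (e + i)"
    using assms by (simp add: hankel_adj(1) if_distrib [of "\<lambda>c. c * _"] cong: if_cong sum.cong_simp)
  finally have "(\<Sum>k<e. (\<Sum>j<e. adj_mat (hankel e a) $$ (k, j) * a (e + j)) * a (k + i)) =
      Determinant.det (hankel e a) * a (e + i)" .
  moreover have "{..e} = insert e {..<e}" by auto
  ultimately show ?thesis by (simp add: coeff_hankel_poly sum_negf)
qed

text \<open>The resultant is taken with the formal degrees \<open>e\<close> and
  \<open>e - 1\<close>, so \<open>disc e\<close> is polynomial in the coefficients even where the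
  degree drops; the leading coefficient as a factor makes it vanish there.\<close>

definition disc :: "nat \<Rightarrow> 'k::field poly \<Rightarrow> 'k"
  where "disc e f = coeff f e * resultant_sub e (e - 1) f (pderiv f)"

lemma disc_eq:
  fixes f :: "'k::field_char_0 poly"
  assumes "degree f = e"
  shows "disc e f = lead_coeff f * resultant f (pderiv f)"
  using assms by (simp add: disc_def resultant_sub degree_pderiv)

lemma disc_nonzero_iff:
  fixes f :: "'r::real_closed_field cplx poly"
  assumes "degree f \<le> e" "1 \<le> e"
  shows "disc e f \<noteq> 0 \<longleftrightarrow> degree f = e \<and> (\<forall>t. poly f t = 0 \<longrightarrow> poly (pderiv f) t \<noteq> 0)"
proof (cases "degree f = e")
  case True
  then have f0: "f \<noteq> 0"
    using assms by auto
  have "degree (gcd f (pderiv f)) = 0 \<longleftrightarrow> (\<forall>t. poly f t = 0 \<longrightarrow> poly (pderiv f) t \<noteq> 0)"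
  proof
    assume 0: "degree (gcd f (pderiv f)) = 0"
    show "\<forall>t. poly f t = 0 \<longrightarrow> poly (pderiv f) t \<noteq> 0"
    proof (intro allI impI notI)
      fix t assume "poly f t = 0" "poly (pderiv f) t = 0"
      then have "[:- t, 1:] dvd gcd f (pderiv f)" by (simp add: poly_eq_0_iff_dvd)
      then have "degree [:- t, 1:] \<le> degree (gcd f (pderiv f))"
        using f0 by (intro dvd_imp_degree_le) auto
      then show False
        using 0 by simp
    qed
  next
    assume *: "\<forall>t. poly f t = 0 \<longrightarrow> poly (pderiv f) t \<noteq> 0"
    show "degree (gcd f (pderiv f)) = 0"
    proof (rule ccontr)
      assume "degree (gcd f (pderiv f)) \<noteq> 0"
      then obtain t where "poly (gcd f (pderiv f)) t = 0"
        using alg_closed_imp_poly_has_root by blast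
      then have "[:- t, 1:] dvd gcd f (pderiv f)" by (simp add: poly_eq_0_iff_dvd)
      then have "[:- t, 1:] dvd f" "[:- t, 1:] dvd pderiv f"
        by (meson dvd_trans gcd_dvd1 gcd_dvd2)+
      then show False
        using * by (simp add: poly_eq_0_iff_dvd)
    qed
  qed
  moreover have "coeff f e \<noteq> 0"
    using True f0 by auto
  ultimately show ?thesis
    using True by (simp add: disc_eq resultant_0_gcd)
next
  case False
  then show ?thesis
    using assms by (simp add: disc_def coeff_eq_0)
qed

section \<open>Polynomial dependence of determinants and discriminants\<close>

lemma permutes_atLeastLessThan_less: "\<pi> permutes {0..<n} \<Longrightarrow> i < n \<Longrightarrow> \<pi> i < n" for n :: nat
  using permutes_in_image [of \<pi> "{0..<n}" i] by simp

lemma det_poly_line: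
  assumes A: "\<And>t. A t \<in> carrier_mat n n"
    and p: "\<And>i j. i < n \<Longrightarrow> j < n \<Longrightarrow> \<exists>p. \<forall>t. A t $$ (i, j) = poly p (t :: 'k::field)"
  shows "\<exists>p. \<forall>t. Determinant.det (A t) = poly p t"
proof -
  obtain P where P: "\<And>i j t. i < n \<Longrightarrow> j < n \<Longrightarrow> A t $$ (i, j) = poly (P i j) t"
    using p by metis
  have "Determinant.det (A t) = poly (\<Sum>\<pi> | \<pi> permutes {0..<n}. smult (signof \<pi>) (\<Prod>i = 0..<n. P i (\<pi> i))) t" for t
    unfolding det_def' [OF A] poly_sum poly_smult poly_prod
    by (intro sum.cong refl arg_cong2 [where f = times] prod.cong) (auto simp: P permutes_atLeastLessThan_less)
  then show ?thesis by blast
qed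

lemma disc_poly_line:
  fixes f g :: "'k::field_char_0 poly"
  shows "\<exists>p. \<forall>t. disc e (f + smult t g) = poly p t"
proof -
  define A where "A = (\<lambda>t. sylvester_mat_sub e (e - 1) (f + smult t g) (pderiv (f + smult t g)))"
  let ?n = "e + (e - 1)"
  have lin: "\<exists>p. \<forall>t. coeff (f + smult t g) k = poly p t" for k
    by (intro exI [of _ "[:coeff f k, coeff g k:]"]) simp
  have lin': "\<exists>p. \<forall>t. coeff (pderiv (f + smult t g)) k = poly p t" for k
    by (intro exI [of _ "[:coeff (pderiv f) k, coeff (pderiv g) k:]"]) (simp add: pderiv_add pderiv_smult)
  have z: "\<exists>p. \<forall>t :: 'k. 0 = poly p t" by (intro exI [of _ 0]) simp
  have "\<exists>p. \<forall>t. A t $$ (i, j) = poly p t" if "i < ?n" "j < ?n" for i j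
    unfolding A_def sylvester_mat_sub_index [OF that]
    by (cases "i < e - 1"; cases "i \<le> j \<and> j - i \<le> e"; cases "i - (e - 1) \<le> j \<and> j \<le> i")
      (simp_all only: if_True if_False simp_thms lin lin' z)
  then obtain p where p: "\<And>t. Determinant.det (A t) = poly p t"
    using det_poly_line [of A ?n] by (auto simp: A_def sylvester_mat_sub_carrier)
  obtain q where q: "\<And>t. coeff (f + smult t g) e = poly q t"
    using lin by blast
  show ?thesis
    by (intro exI [of _ "q * p"]) (simp only: disc_def resultant_sub_def p [unfolded A_def] q poly_mult simp_thms)
qed

lemma form_fun_det:
  assumes A: "\<And>x. A x \<in> carrier_mat n n"
    and f: "\<And>i j. i < n \<Longrightarrow> j < n \<Longrightarrow> form_fun k (\<lambda>x. A x $$ (i, j))"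
  shows "form_fun (n * k) (\<lambda>x. Determinant.det (A x))"
proof -
  have "form_fun (n * k) (\<lambda>x. \<Sum>\<pi> | \<pi> permutes {0..<n}. signof \<pi> * (\<Prod>i = 0..<n. A x $$ (i, \<pi> i)))"
  proof (intro form_fun_sum form_fun_scale)
    fix \<pi> assume "\<pi> \<in> {\<pi>. \<pi> permutes {0..<n}}"
    then have "form_fun (\<Sum>i\<in>{0..<n}. k) (\<lambda>x. \<Prod>i = 0..<n. A x $$ (i, \<pi> i))"
      by (intro form_fun_prod f) (auto simp: permutes_atLeastLessThan_less)
    then show "form_fun (n * k) (\<lambda>x. \<Prod>i = 0..<n. A x $$ (i, \<pi> i))"
      by simp
  qed
  then show ?thesis by (simp only: det_def' [OF A])
qed

text \<open>All coefficients have the same degree: the determinant has degree \<open>e\<close>, the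
  others are entries of the adjugate, of degree \<open>e - 1\<close>, times one coordinate.\<close>

lemma form_fun_coeff_hankel_poly:
  fixes a :: "'k::field ^ 'n::finite \<Rightarrow> nat \<Rightarrow> 'k"
  assumes a: "\<And>k. form_fun 1 (\<lambda>x. a x k)" and "1 \<le> e"
  shows "form_fun e (\<lambda>x. coeff (hankel_poly e (a x)) k)"
proof -
  have det: "form_fun (e * 1) (\<lambda>x. Determinant.det (hankel e (a x)))"
    by (rule form_fun_det [OF hankel_carrier]) (use a in \<open>simp add: hankel_def\<close>)
  have adj: "form_fun (e - 1) (\<lambda>x. adj_mat (hankel e (a x)) $$ (k, j))" if kj: "k < e" "j < e" for k j
  proof -
    have "form_fun ((e - 1) * 1) (\<lambda>x. Determinant.det (mat_delete (hankel e (a x)) j k))"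
    proof (rule form_fun_det)
      show "mat_delete (hankel e (a x)) j k \<in> carrier_mat (e - 1) (e - 1)" for x
        by (simp add: mat_delete_def hankel_def)
      fix i l assume "i < e - 1" "l < e - 1"
      then show "form_fun 1 (\<lambda>x. mat_delete (hankel e (a x)) j k $$ (i, l))"
        using a by (simp add: mat_delete_def hankel_def)
    qed
    then have "form_fun (e - 1) (\<lambda>x. (-1) ^ (j + k) * Determinant.det (mat_delete (hankel e (a x)) j k))"
      by (intro form_fun_scale) simp
    then show ?thesis
      using kj by (simp add: adj_mat_def cofactor_def hankel_def)
  qed
  have sum: "form_fun ((e - 1) + 1) (\<lambda>x. - (\<Sum>j<e. adj_mat (hankel e (a x)) $$ (k, j) * a x (e + j)))"
    if "k < e"
    using that by (intro form_fun_minus form_fun_sum form_fun_mult adj a) auto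
  show ?thesis
    unfolding coeff_hankel_poly using det sum \<open>1 \<le> e\<close> form_fun_zero [of e]
    by (cases "k = e"; cases "k < e") simp_all
qed

lemma form_fun_disc:
  fixes f :: "'k::field_char_0 ^ 'n::finite \<Rightarrow> 'k poly"
  assumes f: "\<And>k. form_fun m (\<lambda>x. coeff (f x) k)"
  shows "form_fun (m + (e + (e - 1)) * m) (\<lambda>x. disc e (f x))"
proof -
  have d: "form_fun m (\<lambda>x. coeff (pderiv (f x)) k)" for k
    unfolding coeff_pderiv by (intro form_fun_scale f)
  have "form_fun ((e + (e - 1)) * m) (\<lambda>x. resultant_sub e (e - 1) (f x) (pderiv (f x)))"
    unfolding resultant_sub_def
  proof (rule form_fun_det)
    fix i j assume ij: "i < e + (e - 1)" "j < e + (e - 1)"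
    show "form_fun m (\<lambda>x. sylvester_mat_sub e (e - 1) (f x) (pderiv (f x)) $$ (i, j))"
      unfolding sylvester_mat_sub_index [OF ij]
      by (cases "i < e - 1"; cases "i \<le> j \<and> j - i \<le> e"; cases "i - (e - 1) \<le> j \<and> j \<le> i")
        (simp_all only: if_True if_False simp_thms f d form_fun_zero)
  qed (rule sylvester_mat_sub_carrier)
  then show ?thesis
    unfolding disc_def by (intro form_fun_mult f)
qed

text \<open>For the following sequence \<open>a\<close> the polynomial \<open>X ^ e - 1\<close> spans the kernel of the Hankel matrix.\<close>

lemma disc_hankel_poly_example:
  assumes "2 \<le> e"
  defines "a \<equiv> (\<lambda>k. if k = e - 2 \<or> k = 2 * e - 2 then 1 else 0 :: 'r::real_closed_field cplx)"
  shows "disc e (hankel_poly e a) \<noteq> 0"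
proof -
  define D where "D = Determinant.det (hankel e a)"
  have "D \<noteq> 0"
    unfolding D_def
  \<comment> \<open>The matrix is a permutation matrix: row \<open>e - 1\<close> picks out entry
    \<open>e - 1\<close>, and row \<open>e - 2 - k\<close> picks out entry \<open>k\<close>.\<close>
  proof (rule hankel_det_nonzero)
    fix v k assume v: "\<And>i. i < e \<Longrightarrow> (\<Sum>k<e. a (i + k) * v k) = 0" and k: "k < e"
    show "v k = 0"
    proof (cases "k = e - 1")
      case True
      have "(\<Sum>l<e. a (e - 1 + l) * v l) = (\<Sum>l<e. if l = e - 1 then v l else 0)"
        using assms(1) by (intro sum.cong refl) (auto simp: a_def)
      then show ?thesis
        using v [of "e - 1"] assms(1) True by simp
    next
      case False
      then have k: "k \<le> e - 2"
        using k by simp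
      have s: "(\<Sum>l<e. a (e - 2 - k + l) * v l) = (\<Sum>l<e. if l = k then v l else 0)"
        using assms(1) k by (intro sum.cong refl) (auto simp: a_def)
      have "(\<Sum>l<e. if l = k then v l else 0) = 0"
        unfolding s [symmetric] by (rule v) (use assms(1) in simp)
      then show ?thesis
        using assms(1) k by (simp split: if_splits)
    qed
  qed
  define g where "g = smult D (monom 1 e - 1)"
  have cg: "coeff g k = (if k = e then D else if k = 0 then - D else 0)" for k
    using assms(1) by (auto simp: g_def)
  \<comment> \<open>Both polynomials are in the kernel and have leading coefficient
    \<open>D\<close>, so the difference falls under the triviality of the kernel in degrees below
    \<open>e\<close>.\<close>
  have "hankel_poly e a - g = 0"
  proof (rule hankel_det_nonzero_imp_kernel_trivial [of e a])
    show "Determinant.det (hankel e a) \<noteq> 0"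
      using \<open>D \<noteq> 0\<close> by (simp add: D_def)
    have top: "coeff (hankel_poly e a - g) k = 0" if "k \<ge> e" for k
      using that assms(1) by (auto simp: cg coeff_hankel_poly D_def)
    then show "degree (hankel_poly e a - g) < e"
      using assms(1) by (intro degree_lessI) auto
    fix i assume i: "i < e"
    have "(\<Sum>k\<le>e. coeff g k * a (k + i)) = (\<Sum>k\<in>{0, e}. coeff g k * a (k + i))"
      by (intro sum.mono_neutral_right) (auto simp: cg)
    also have "\<dots> = 0"
      using i assms(1) by (auto simp: cg a_def)
    finally have "(\<Sum>k\<le>e. coeff (hankel_poly e a - g) k * a (k + i)) = 0"
      using hankel_poly_kernel [OF i, of a] by (simp add: left_diff_distrib sum_subtractf)
    moreover have "{..e} = insert e {..<e}" by auto
    ultimately show "(\<Sum>k<e. coeff (hankel_poly e a - g) k * a (k + i)) = 0"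
      using top [of e] by (simp del: coeff_diff)
  qed
  then have hg: "hankel_poly e a = g" by simp
  have "degree g \<le> e" "coeff g e \<noteq> 0"
    using \<open>D \<noteq> 0\<close> by (auto simp: cg intro!: degree_le)
  then have "degree g = e" by (metis le_antisym le_degree)
  moreover have "poly (pderiv g) t \<noteq> 0" if "poly g t = 0" for t
  proof -
    have "t ^ e = 1"
      using that \<open>D \<noteq> 0\<close> by (simp add: g_def poly_monom)
    then have "t \<noteq> 0"
      using assms(1) by (auto simp: power_0_left)
    moreover have "(of_nat e :: 'r cplx) \<noteq> 0"
      using assms(1) by simp
    ultimately show ?thesis
      using \<open>D \<noteq> 0\<close> by (simp add: g_def pderiv_smult pderiv_diff pderiv_monom poly_monom)
  qed
  ultimately show ?thesis
    unfolding hg using disc_nonzero_iff [of g e] assms(1) by auto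
qed

section \<open>Forms on the real points\<close>

lemma form_fun_cre_cim:
  fixes f :: "'r::linordered_field cplx ^ 'n::finite \<Rightarrow> 'r cplx"
  assumes "form_fun k f"
  shows "form_fun k (\<lambda>x. cre (f (\<chi> i. of_base (x $ i))))" "form_fun k (\<lambda>x. cim (f (\<chi> i. of_base (x $ i))))"
proof -
  have m: "mon m (\<chi> i. of_base (x $ i)) = (of_base (mon m x) :: 'r cplx)" for m and x :: "'r ^ 'n"
    by (simp add: mon_def of_base_prod of_base_power)
  have "form_fun k (\<lambda>x. cre (f (\<chi> i. of_base (x $ i)))) \<and> form_fun k (\<lambda>x. cim (f (\<chi> i. of_base (x $ i))))"
    using assms
  proof (induction rule: form_fun.induct)
    case (mon m k c)
    then show ?case by (auto simp: m intro: form_fun.mon)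
  next
    case (add k f g)
    then show ?case by (auto intro: form_fun.add)
  qed
  then show "form_fun k (\<lambda>x. cre (f (\<chi> i. of_base (x $ i))))" "form_fun k (\<lambda>x. cim (f (\<chi> i. of_base (x $ i))))"
    by blast+
qed

text \<open>Write z = u + i w with real u and w. The polynomial f (u + t w) in t is not zero at t =
  i, hence not at some t in the base field.\<close>

lemma form_fun_nonzero_at_real_point:
  fixes f :: "'r::linordered_field cplx ^ 'n::finite \<Rightarrow> 'r cplx"
  assumes "form_fun k f" "f z \<noteq> 0"
  shows "\<exists>x :: 'r ^ 'n. f (\<chi> i. of_base (x $ i)) \<noteq> 0"
proof -
  define u w :: "'r cplx ^ 'n" where "u = (\<chi> i. of_base (cre (z $ i)))" and "w = (\<chi> i. of_base (cim (z $ i)))"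
  obtain p where p: "\<And>t. f (u + t *s w) = poly p t"
    using form_fun_line_poly [OF assms(1)] by blast
  have "z = u + Cplx 0 1 *s w" by (simp add: vec_eq_iff u_def w_def cplx_eq_iff)
  then have "p \<noteq> 0"
    using assms(2) p by auto
  then have "finite (of_base -` {t. poly p t = 0} :: 'r set)"
    by (intro finite_vimageI poly_roots_finite) (auto simp: inj_on_def)
  then obtain t :: 'r where "t \<notin> of_base -` {t. poly p t = 0}"
    using infinite_UNIV_char_0 [where ?'a = 'r] by (metis ex_new_if_finite)
  then have "f (u + of_base t *s w) \<noteq> 0" by (simp add: p)
  moreover have "u + of_base t *s w = (\<chi> i. of_base ((\<chi> j. cre (z $ j) + t * cim (z $ j)) $ i))"
    by (simp add: vec_eq_iff u_def w_def of_base_add of_base_mult)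
  ultimately show ?thesis by metis
qed

section \<open>Continuity of forms over an ordered field\<close>

abbreviation sqdist :: "'r::linordered_field ^ 'n::finite \<Rightarrow> 'r ^ 'n \<Rightarrow> 'r"
  where "sqdist y x \<equiv> \<Sum>j\<in>UNIV. (y $ j - x $ j) ^ 2"

text \<open>Distances are squared as in \<open>euclidean_open\<close>, since square roots need not
  exist in an ordered field.\<close>

definition continuous_at_point :: "('r::linordered_field ^ 'n::finite \<Rightarrow> 'r) \<Rightarrow> 'r ^ 'n \<Rightarrow> bool"
  where "continuous_at_point f x \<longleftrightarrow>
    (\<forall>\<eta>>0. \<exists>\<epsilon>>0. \<forall>y. sqdist y x < \<epsilon> ^ 2 \<longrightarrow> \<bar>f y - f x\<bar> < \<eta>)"

lemma continuous_at_point_two: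
  assumes "continuous_at_point f x" "continuous_at_point g x" "0 < \<eta>1" "0 < \<eta>2"
  shows "\<exists>\<epsilon>>0. \<forall>y. sqdist y x < \<epsilon> ^ 2 \<longrightarrow> \<bar>f y - f x\<bar> < \<eta>1 \<and> \<bar>g y - g x\<bar> < \<eta>2"
proof -
  obtain \<epsilon>1 where 1: "\<epsilon>1 > 0" "\<And>y. sqdist y x < \<epsilon>1 ^ 2 \<Longrightarrow> \<bar>f y - f x\<bar> < \<eta>1"
    using assms unfolding continuous_at_point_def by blast
  obtain \<epsilon>2 where 2: "\<epsilon>2 > 0" "\<And>y. sqdist y x < \<epsilon>2 ^ 2 \<Longrightarrow> \<bar>g y - g x\<bar> < \<eta>2"
    using assms unfolding continuous_at_point_def by blast
  have le: "min \<epsilon>1 \<epsilon>2 ^ 2 \<le> \<epsilon>1 ^ 2" "min \<epsilon>1 \<epsilon>2 ^ 2 \<le> \<epsilon>2 ^ 2"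
    using 1(1) 2(1) by (auto intro!: power_mono)
  show ?thesis
  proof (intro exI [of _ "min \<epsilon>1 \<epsilon>2"] conjI allI impI)
    fix y assume y: "sqdist y x < min \<epsilon>1 \<epsilon>2 ^ 2"
    show "\<bar>f y - f x\<bar> < \<eta>1"
      by (rule 1(2) [OF less_le_trans [OF y le(1)]])
    show "\<bar>g y - g x\<bar> < \<eta>2"
      by (rule 2(2) [OF less_le_trans [OF y le(2)]])
  qed (use 1(1) 2(1) in simp)
qed

lemma continuous_at_point_const: "continuous_at_point (\<lambda>_. c) x"
  unfolding continuous_at_point_def by (auto intro: exI [of _ 1])

lemma continuous_at_point_coord: "continuous_at_point (\<lambda>y. y $ i) x"
  unfolding continuous_at_point_def
proof (intro allI impI exI conjI)
  fix \<eta> :: 'a and y :: "'a ^ 'b"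
  assume \<eta>: "0 < \<eta>" and y: "sqdist y x < \<eta> ^ 2"
  have "(y $ i - x $ i) ^ 2 \<le> sqdist y x" by (rule member_le_sum) auto
  then have "\<bar>y $ i - x $ i\<bar> ^ 2 < \<eta> ^ 2"
    using y by simp
  then show "\<bar>y $ i - x $ i\<bar> < \<eta>"
    by (rule power_less_imp_less_base) (use \<eta> in simp)
qed

lemma continuous_at_point_add:
  assumes f: "continuous_at_point f x" and g: "continuous_at_point g x"
  shows "continuous_at_point (\<lambda>y. f y + g y) x"
  unfolding continuous_at_point_def
proof (intro allI impI)
  fix \<eta> :: 'a assume "0 < \<eta>"
  then obtain \<epsilon> where \<epsilon>: "\<epsilon> > 0" "\<And>y. sqdist y x < \<epsilon> ^ 2 \<Longrightarrow>
      \<bar>f y - f x\<bar> < \<eta> / 2 \<and> \<bar>g y - g x\<bar> < \<eta> / 2"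
    using continuous_at_point_two [OF f g, of "\<eta> / 2" "\<eta> / 2"] by auto
  have "\<bar>f y + g y - (f x + g x)\<bar> < \<eta>" if "sqdist y x < \<epsilon> ^ 2" for y
  proof -
    have "\<bar>f y + g y - (f x + g x)\<bar> \<le> \<bar>f y - f x\<bar> + \<bar>g y - g x\<bar>"
      using abs_triangle_ineq [of "f y - f x" "g y - g x"] by (simp add: algebra_simps)
    also have "\<dots> < \<eta> / 2 + \<eta> / 2"
      using \<epsilon>(2) [OF that] by (intro add_strict_mono) auto
    finally show ?thesis by simp
  qed
  then show "\<exists>\<epsilon>>0. \<forall>y. sqdist y x < \<epsilon> ^ 2 \<longrightarrow> \<bar>f y + g y - (f x + g x)\<bar> < \<eta>"
    using \<epsilon>(1) by blast
qed

lemma continuous_at_point_mult: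
  assumes f: "continuous_at_point f x" and g: "continuous_at_point g x"
  shows "continuous_at_point (\<lambda>y. f y * g y) x"
  unfolding continuous_at_point_def
proof (intro allI impI)
  fix \<eta> :: 'a assume "0 < \<eta>"
  \<comment> \<open>The difference of the products is split as (f y - f x) g y + f x (g y - g x).
    The bound 1 in \<open>\<eta>2\<close> controls g y, and the summands 1 in the denominators
    prevent division by zero.\<close>
  define \<eta>1 where "\<eta>1 = \<eta> / 2 / (\<bar>g x\<bar> + 1)"
  define \<eta>2 where "\<eta>2 = min 1 (\<eta> / 2 / (\<bar>f x\<bar> + 1))"
  have pos: "0 < \<bar>g x\<bar> + 1" "0 < \<bar>f x\<bar> + 1"
    by (simp_all add: add_nonneg_pos)
  then have "0 < \<eta>1" "0 < \<eta>2"
    using \<open>0 < \<eta>\<close> by (simp_all add: \<eta>1_def \<eta>2_def)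
  then obtain \<epsilon> where \<epsilon>: "\<epsilon> > 0" "\<And>y. sqdist y x < \<epsilon> ^ 2 \<Longrightarrow>
      \<bar>f y - f x\<bar> < \<eta>1 \<and> \<bar>g y - g x\<bar> < \<eta>2"
    using continuous_at_point_two [OF f g] by blast
  have "\<bar>f y * g y - f x * g x\<bar> < \<eta>" if "sqdist y x < \<epsilon> ^ 2" for y
  proof -
    have cancel: "c * (a / c) = a" if "c \<noteq> 0" for a c :: 'a
      using that by simp
    have fy: "\<bar>f y - f x\<bar> < \<eta>1" and gy: "\<bar>g y - g x\<bar> < \<eta>2"
      using \<epsilon>(2) [OF that] by auto
    have "\<bar>g y\<bar> \<le> \<bar>g x\<bar> + 1"
      using gy abs_triangle_ineq [of "g y - g x" "g x"] by (simp add: \<eta>2_def)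
    then have "\<bar>f y - f x\<bar> * \<bar>g y\<bar> \<le> \<bar>f y - f x\<bar> * (\<bar>g x\<bar> + 1)"
      by (intro mult_left_mono) auto
    also have "\<dots> < \<eta>1 * (\<bar>g x\<bar> + 1)"
      using fy pos(1) by (rule mult_strict_right_mono)
    finally have 1: "\<bar>f y - f x\<bar> * \<bar>g y\<bar> < \<eta>1 * (\<bar>g x\<bar> + 1)" .
    have 2: "\<bar>f x\<bar> * \<bar>g y - g x\<bar> \<le> (\<bar>f x\<bar> + 1) * \<eta>2"
      using gy by (intro mult_mono) auto
    have "(\<bar>f x\<bar> + 1) * \<eta>2 \<le> (\<bar>f x\<bar> + 1) * (\<eta> / 2 / (\<bar>f x\<bar> + 1))"
      using pos by (intro mult_left_mono) (auto simp: \<eta>2_def)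
    moreover have "(\<bar>f x\<bar> + 1) * (\<eta> / 2 / (\<bar>f x\<bar> + 1)) = \<eta> / 2"
      by (rule cancel) (use pos(2) in simp)
    ultimately have 3: "(\<bar>f x\<bar> + 1) * \<eta>2 \<le> \<eta> / 2"
      by (simp only:)
    have 4: "\<eta>1 * (\<bar>g x\<bar> + 1) = \<eta> / 2"
      unfolding \<eta>1_def mult.commute [of _ "\<bar>g x\<bar> + 1"] by (rule cancel) (use pos(1) in simp)
    have "f y * g y - f x * g x = (f y - f x) * g y + f x * (g y - g x)"
      by (simp add: algebra_simps)
    then have "\<bar>f y * g y - f x * g x\<bar> \<le> \<bar>f y - f x\<bar> * \<bar>g y\<bar> + \<bar>f x\<bar> * \<bar>g y - g x\<bar>"
      using abs_triangle_ineq [of "(f y - f x) * g y" "f x * (g y - g x)"] by (simp add: abs_mult)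
    also have "\<dots> < \<eta> / 2 + \<eta> / 2"
      using 1 2 3 4 by (intro add_less_le_mono) auto
    finally show ?thesis by simp
  qed
  then show "\<exists>\<epsilon>>0. \<forall>y. sqdist y x < \<epsilon> ^ 2 \<longrightarrow> \<bar>f y * g y - f x * g x\<bar> < \<eta>"
    using \<epsilon>(1) by blast
qed

lemma continuous_at_point_prod:
  "(\<And>i. i \<in> A \<Longrightarrow> continuous_at_point (f i) x) \<Longrightarrow> continuous_at_point (\<lambda>y. \<Prod>i\<in>A. f i y) x"
  by (induction A rule: infinite_finite_induct) (auto intro: continuous_at_point_const continuous_at_point_mult)

lemma continuous_at_point_power: "continuous_at_point f x \<Longrightarrow> continuous_at_point (\<lambda>y. f y ^ m) x"
  by (induction m) (auto intro: continuous_at_point_const continuous_at_point_mult)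

lemma form_fun_continuous: "form_fun k f \<Longrightarrow> continuous_at_point f x"
proof (induction rule: form_fun.induct)
  case (mon m k c)
  show ?case
    unfolding mon_def
    by (intro continuous_at_point_mult continuous_at_point_const continuous_at_point_prod
        continuous_at_point_power continuous_at_point_coord)
qed (rule continuous_at_point_add)

lemma euclidean_open_nonzero_set:
  fixes G :: "'r::linordered_field ^ 'n::finite \<Rightarrow> 'r"
  assumes G: "form_fun k G"
  shows "euclidean_open (- zero_set G)"
  unfolding euclidean_open_def
proof (intro allI impI)
  fix i and x :: "'r ^ 'n"
  assume x: "x $ i = 1" "point x \<in> - zero_set G"
  have ne: "y \<noteq> 0" if "y $ i = 1" for y :: "'r ^ 'n"
    using that by auto
  have "G x \<noteq> 0"
    using x point_in_zero_set [OF G ne] by auto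
  then obtain \<epsilon> where \<epsilon>: "\<epsilon> > 0" "\<And>y. sqdist y x < \<epsilon> ^ 2 \<Longrightarrow> \<bar>G y - G x\<bar> < \<bar>G x\<bar>"
    using form_fun_continuous [OF G, of x] unfolding continuous_at_point_def by (metis zero_less_abs_iff)
  have "point y \<in> - zero_set G" if "y $ i = 1" "sqdist y x < \<epsilon> ^ 2" for y
    using \<epsilon>(2) [OF that(2)] point_in_zero_set [OF G ne [OF that(1)]] by auto
  then show "\<exists>\<epsilon>>0. \<forall>y. y $ i = 1 \<longrightarrow> sqdist y x < \<epsilon> ^ 2 \<longrightarrow> point y \<in> - zero_set G"
    using \<epsilon>(1) by blast
qed

lemma semialgebraic_zero_set:
  assumes "form_fun k G"
  shows "semialgebraic (zero_set G)"
proof -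
  obtain F where "homogeneous k F" "peval F = G"
    using form_fun_imp_peval [OF assms] by blast
  then show ?thesis
    using semialgebraic.zero [of k F] by (simp add: vanishes_at_zero_set)
qed

lemma zariski_closure_closed: "zariski_closed A \<Longrightarrow> zariski_closure A = A"
  by (auto simp: zariski_closure_def)

lemma nat_ceiling_half: "nat \<lceil>(real d + 1) / 2\<rceil> = d div 2 + 1"
proof (cases "even d")
  case True
  then obtain m where "d = 2 * m" by (rule evenE)
  then have "\<lceil>(real d + 1) / 2\<rceil> = int m + 1"
    by (intro ceiling_unique) auto
  then show ?thesis
    using \<open>d = 2 * m\<close> by simp
next
  case False
  then obtain m where "d = 2 * m + 1" by (rule oddE)
  then have "\<lceil>(real d + 1) / 2\<rceil> = int m + 1"
    by (intro ceiling_unique) auto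
  then show ?thesis
    using \<open>d = 2 * m + 1\<close> by simp
qed

section \<open>The rank of a general real point\<close>

context twisted_rational_normal_curve
begin

text \<open>\<open>hankel_poly e\<close> reads entries up to index 2 e - 1, which is d + 1 if e = d
  div 2 + 1 and d is even. Setting the missing entry to 0 selects one form from the apolar
  forms.\<close>

definition trunc_coord :: "'r cplx ^ 'n \<Rightarrow> nat \<Rightarrow> 'r cplx"
  where "trunc_coord z k = (if k \<le> d then coord b k z else 0)"

lemma form_fun_trunc_coord: "form_fun 1 (\<lambda>z. trunc_coord z k)"
  unfolding trunc_coord_def using form_fun_coord_functional form_fun_zero by (cases "k \<le> d") auto

lemma pairing_monom_mult:
  assumes "degree f \<le> e" "j + e \<le> d"
  shows "pairing z (monom 1 j * f) = (\<Sum>k\<le>e. coeff f k * coord b (k + j) z)"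
proof -
  have "pairing z (monom 1 j * f) = (\<Sum>l\<in>{j..j + e}. coeff f (l - j) * coord b l z)"
    unfolding pairing_def coeff_monom_mult using assms
    by (intro sum.mono_neutral_cong_right) (auto simp: coeff_eq_0)
  also have "\<dots> = (\<Sum>k\<le>e. coeff f k * coord b (k + j) z)"
    by (rule sum.reindex_bij_witness [of _ "\<lambda>k. k + j" "\<lambda>l. l - j"]) auto
  finally show ?thesis .
qed

lemma apolar_hankel_poly:
  assumes e: "e \<le> d" "d < 2 * e"
  shows "apolar z e (hankel_poly e (trunc_coord z))"
  unfolding apolar_def
proof (intro conjI allI impI degree_hankel_poly)
  let ?f = "hankel_poly e (trunc_coord z)"
  fix h :: "'r cplx poly" assume h: "degree h \<le> d - e"
  have "pairing z (monom 1 j * ?f) = 0" if "j \<le> d - e" for j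
  proof -
    have "pairing z (monom 1 j * ?f) = (\<Sum>k\<le>e. coeff ?f k * coord b (k + j) z)"
      using that e degree_hankel_poly by (intro pairing_monom_mult) auto
    also have "\<dots> = (\<Sum>k\<le>e. coeff ?f k * trunc_coord z (k + j))"
      using that e by (intro sum.cong refl) (auto simp: trunc_coord_def)
    also have "\<dots> = 0"
      using that e by (intro hankel_poly_kernel) auto
    finally show ?thesis .
  qed
  then have "pairing z (\<Sum>j\<le>d - e. smult (coeff h j) (monom 1 j * ?f)) = 0"
    by (simp add: pairing_sum pairing_smult)
  moreover have hexp: "h = (\<Sum>j\<le>d - e. smult (coeff h j) (monom 1 j))"
    using h by (intro poly_eqI) (auto simp: coeff_sum coeff_eq_0 if_distrib [of "\<lambda>c. _ * c"] cong: if_cong)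
  have "h * ?f = (\<Sum>j\<le>d - e. smult (coeff h j) (monom 1 j * ?f))"
    using arg_cong [OF hexp, of "\<lambda>h. h * ?f"] by (simp only: sum_distrib_right mult_smult_left)
  ultimately show "pairing z (?f * h) = 0" by (simp only: mult.commute [of ?f h])
qed

text \<open>The leading coefficient of the Hankel polynomial is the Hankel determinant, so a
  non-zero value means both a regular Hankel matrix and a squarefree apolar form.\<close>

definition generic_form :: "nat \<Rightarrow> 'r cplx ^ 'n \<Rightarrow> 'r cplx"
  where "generic_form e z = disc e (hankel_poly e (trunc_coord z))"

lemma form_fun_generic_form: "1 \<le> e \<Longrightarrow> form_fun (e + (e + (e - 1)) * e) (generic_form e)"
  unfolding generic_form_def [abs_def]
  by (intro form_fun_disc form_fun_coeff_hankel_poly form_fun_trunc_coord)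

text \<open>The entries of the example sequence beyond index 2 e - 2 are zero, so truncation at
  \<open>d\<close> leaves it unchanged.\<close>

lemma generic_form_nonzero:
  assumes "2 \<le> e" "2 * e - 2 \<le> d"
  shows "\<exists>z. generic_form e z \<noteq> 0"
proof -
  define a :: "nat \<Rightarrow> 'r cplx" where "a = (\<lambda>k. if k = e - 2 \<or> k = 2 * e - 2 then 1 else 0)"
  obtain z where "\<And>k. k \<le> d \<Longrightarrow> coord b k z = a k"
    using coord_surj [of a] by blast
  then have "trunc_coord z = a"
    using assms by (auto simp: trunc_coord_def a_def fun_eq_iff)
  then show ?thesis
    using disc_hankel_poly_example [OF assms(1)]
    by (intro exI [of _ z]) (simp add: generic_form_def a_def)
qed

text \<open>The Hankel polynomial need not be an eigenform of \<open>twist e\<close>. It witnesses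
  that the discriminant is not identically zero on the apolar forms, and
  \<open>apolar_twist_eigenform\<close> then supplies a suitable eigenform.\<close>

lemma admissible_rank_generic:
  fixes x0 :: "'r ^ 'n"
  assumes gen: "generic_form e (\<chi> i. of_base (x0 $ i)) \<noteq> 0" and "x0 \<noteq> 0"
    and e: "1 \<le> e" "d < 2 * e" "2 * e \<le> d + 2" and pos: "0 < twist_scalar ^ e"
  shows "admissible_rank X (point x0) = enat e"
proof -
  define z :: "'r cplx ^ 'n" where "z = (\<chi> i. of_base (x0 $ i))"
  let ?f = "hankel_poly e (trunc_coord z)"
  have "e \<le> d"
    using e d by linarith
  have "vec_conj z = z" by (simp add: z_def vec_conj_def vec_eq_iff)
  moreover have "disc e ?f \<noteq> 0"
    using gen by (simp add: generic_form_def z_def)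
  ultimately obtain f s where f: "apolar z e f" "disc e f \<noteq> 0" "twist e f = smult s f"
    using apolar_twist_eigenform [of z e ?f "disc e"] \<open>e \<le> d\<close> pos apolar_hankel_poly [OF \<open>e \<le> d\<close> e(2)]
      disc_poly_line by blast
  have "degree f = e" and simple: "\<And>t. poly f t = 0 \<Longrightarrow> poly (pderiv f) t \<noteq> 0"
    using disc_nonzero_iff [of f e] f(1,2) e(1) by (auto simp: apolar_def)
  moreover have "f \<noteq> 0"
    using calculation(1) e(1) by auto
  moreover have "g = 0" if g: "degree g < e" "\<And>j. j < e \<Longrightarrow> (\<Sum>k<e. coeff g k * coord b (k + j) z) = 0" for g
  proof (rule hankel_det_nonzero_imp_kernel_trivial [of e "trunc_coord z", OF _ g(1)])
    show "Determinant.det (hankel e (trunc_coord z)) \<noteq> 0"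
      using \<open>disc e ?f \<noteq> 0\<close> by (auto simp: disc_def coeff_hankel_poly)
    fix j assume j: "j < e"
    have "(\<Sum>k<e. coeff g k * trunc_coord z (k + j)) = (\<Sum>k<e. coeff g k * coord b (k + j) z)"
      using j e(3) by (intro sum.cong refl) (auto simp: trunc_coord_def)
    then show "(\<Sum>k<e. coeff g k * trunc_coord z (k + j)) = 0"
      using g(2) [OF j] by simp
  qed
  ultimately show ?thesis
    using f e(1,3) \<open>x0 \<noteq> 0\<close> unfolding z_def by (intro admissible_rank_eq) auto
qed

end

(* The last hypothesis is empty unless 4 divides d. It cannot be dropped: if 4 divides d and X has no
   real point, conjugation acts freely on X, so conjugation-stable finite subsets of X have even
   cardinality, whereas the claimed rank d / 2 + 1 is odd. *)

theorem theorem1: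
  fixes X :: "('r::real_closed_field cplx, 'n::finite) proj set" and d :: nat
  assumes "2 \<le> d"
    and "rational_normal_curve d X" and "defined_over_base X"
    and "4 dvd d \<longrightarrow> (\<exists>P\<in>X. conj_proj P = P)"
  shows "\<exists>U :: ('r, 'n) proj set.
    U \<noteq> {} \<and> euclidean_open U \<and>
    semialgebraic (- U) \<and> semialgebraic_dim (- U) < enat d \<and>
    (\<forall>q\<in>U. admissible_rank X q = enat (nat \<lceil>(real d + 1) / 2\<rceil>))"
proof -
  have card: "CARD('n) = d + 1"
    using assms(2) by (simp add: rational_normal_curve_def)
  obtain b :: "nat \<Rightarrow> 'r cplx ^ 'n" where b:
    "\<And>x. (\<And>k. k \<le> d \<Longrightarrow> coord b k x = 0) \<Longrightarrow> x = 0"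
    "\<And>c. \<exists>x. \<forall>k\<le>d. coord b k x = c k"
    "\<And>x. x \<noteq> 0 \<Longrightarrow> point x \<in> X \<longleftrightarrow> (\<exists>c s t. \<forall>k\<le>d. coord b k x = c * s ^ k * t ^ (d - k))"
    by (rule rational_normal_curve_coordinates [OF assms(2)]) (use assms(1) in simp, blast)
  interpret real_rational_normal_curve X d b
    by unfold_locales (fact assms(1) b defined_over_base_conj [OF assms(3)])+
  obtain \<kappa> \<alpha> \<beta> \<gamma> \<delta> where "\<kappa> \<noteq> 0" "\<forall>k\<le>d. \<forall>x y. hev d (conj_poly k) x y =
      \<kappa> * (\<alpha> * x + \<beta> * y) ^ k * (\<gamma> * x + \<delta> * y) ^ (d - k)"
    using conj_poly_form by blast
  then interpret twisted_rational_normal_curve X d b \<kappa> \<alpha> \<beta> \<gamma> \<delta>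
    by unfold_locales auto
  define e where "e = d div 2 + 1"
  have e: "2 \<le> e" "d < 2 * e" "2 * e \<le> d + 2"
    using assms(1) by (auto simp: e_def)
  have pos: "0 < twist_scalar ^ e"
  proof (cases "odd d \<or> 4 dvd d")
    case True
    then have "0 < twist_scalar"
      using twist_scalar_pos_if_odd twist_scalar_pos_if_real_point assms(4) by blast
    then show ?thesis by simp
  next
    case False
    then have "even e"
      unfolding e_def by presburger
    then show ?thesis
      using twist_scalar_nonzero by (simp add: zero_less_power_eq)
  qed
  define m where "m = e + (e + (e - 1)) * e"
  have gf: "form_fun m (generic_form e)"
    unfolding m_def using e(1) by (intro form_fun_generic_form) simp
  define R :: "'r ^ 'n \<Rightarrow> 'r cplx" where "R = (\<lambda>x. generic_form e (\<chi> i. of_base (x $ i)))"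
  \<comment> \<open>\<open>R\<close> takes values in the quadratic extension even at real points;
    its norm is a form over the base field with the same zeros.\<close>
  define G where "G = (\<lambda>x. cre (R x) * cre (R x) + cim (R x) * cim (R x))"
  have G: "form_fun (m + m) G"
    unfolding G_def R_def by (intro form_fun.add form_fun_mult form_fun_cre_cim gf)
  have G0: "G x = 0 \<longleftrightarrow> R x = 0" for x
    by (simp add: G_def cplx_eq_iff sum_squares_eq_zero_iff)
  have "0 < m + m"
    using e(1) by (simp add: m_def)
  have "2 * e - 2 \<le> d"
    using e by linarith
  then obtain z where "generic_form e z \<noteq> 0"
    using generic_form_nonzero [of e] e(1) by blast
  then obtain x1 where "R x1 \<noteq> 0"
    using form_fun_nonzero_at_real_point [OF gf] unfolding R_def by blast
  then have x1: "G x1 \<noteq> 0" by (simp add: G0)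
  then have "x1 \<noteq> 0"
    using form_fun_zero_arg [OF G \<open>0 < m + m\<close>] by auto
  show ?thesis
  proof (intro exI [of _ "- zero_set G"] conjI ballI)
    show "- zero_set G \<noteq> {}"
      using point_in_zero_set [OF G \<open>x1 \<noteq> 0\<close>] x1 by blast
    show "euclidean_open (- zero_set G)" by (rule euclidean_open_nonzero_set [OF G])
    show "semialgebraic (- (- zero_set G))"
      using semialgebraic_zero_set [OF G] by simp
    show "semialgebraic_dim (- (- zero_set G)) < enat d"
      using krull_dim_zero_set_less [OF G \<open>0 < m + m\<close> x1 card] assms(1)
      by (simp add: semialgebraic_dim_def zariski_closure_closed zariski_closed_zero_set [OF G])
    fix q assume q: "q \<in> - zero_set G"
    obtain x0 where x0: "x0 \<noteq> 0" "q = point x0"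
      by (rule point_cases)
    then have "R x0 \<noteq> 0"
      using q point_in_zero_set [OF G x0(1)] G0 by auto
    then have "admissible_rank X (point x0) = enat e"
      using x0(1) e pos unfolding R_def by (intro admissible_rank_generic) auto
    then show "admissible_rank X q = enat (nat \<lceil>(real d + 1) / 2\<rceil>)"
      using x0(2) by (simp add: nat_ceiling_half e_def)
  qed
qed

end
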